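(* For all $k\in\mathcal{M}(W)$, there are $W$-equivariant (weak) equivalences in $\mathrm{dAff}_{\mathbf{k}}$ $$V^h_k(W)\;\simeq\;\mathrm{RSpec}[Q_k(W)]\;\simeq\;V_k(W),$$ where $V_k(W)$ are the classical varieties of quasi-invariants viewed as objects in $\mathrm{dAff}_{\mathbf{k}}$.
   Context: Let $\mathbf{k}$ be a field of characteristic zero, $W$ a finite Coxeter group and $V$ a finite-dimensional $\mathbf{k}$-vector space carrying a reflection representation of $W$. Let $\mathcal{A}$ be the set of reflection hyperplanes; for each fix a linear form $\alpha\in V^*$ with $H_\alpha=\mathrm{Ker}(\alpha)$ (we write $\alpha\in\mathcal{A}$), let $s_\alpha$ be the corresponding reflection and $W_\alpha=\{1,s_\alpha\}$. $\mathcal{M}(W)$ is the set of $W$-invariant functions $k:\mathcal{A}\to\mathbb{Z}_{\ge0}$. $Q_k(W)=\{p\in\mathbf{k}[V]: s_\alpha(p)\equiv p\bmod\langle\alpha\rangle^{2k_\alpha}\ \forall\alpha\in\mathcal{A}\}$, and $V_k(W)=\mathrm{Spec}\,Q_k(W)$ is the classical variety of quasi-invariants. $\mathrm{dAff}_{\mathbf{k}}$, the category of derived affine schemes, is the opposite of the category of non-positively graded commutative cochain dg $\mathbf{k}$-algebras, with the model structure dual to the projective one (weak equivalences of dg algebras are quasi-isomorphisms, fibrations are maps surjective in strictly negative cohomological degrees). $\mathrm{RSpec}(A)$ is the object corresponding to $A$; ordinary commutative algebras are viewed as dg algebras concentrated in degree $0$. Write $V=\mathrm{RSpec}\,\mathbf{k}[V]$,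 $V/\!/W_\alpha=\mathrm{RSpec}\,\mathbf{k}[V]^{W_\alpha}$, $H_\alpha=\mathrm{RSpec}\,\mathbf{k}[H_\alpha]$. For $X\to S\leftarrow Y$ in $\mathrm{dAff}_{\mathbf{k}}$ the derived relative join is $X*^h_SY:=\mathrm{hocolim}\{X\leftarrow X\times^h_SY\to Y\}$, where $X\times^h_SY$ is the homotopy fibre product; it maps canonically to $S$. Put $V_0^h(W_\alpha)=V$ and $V^h_{j+1}(W_\alpha):=V^h_j(W_\alpha)*^h_{V/\!/W_\alpha}H_\alpha$ for $j\ge0$, where $H_\alpha\to V/\!/W_\alpha$ is the composite $H_\alpha\hookrightarrow V\to V/\!/W_\alpha$. Let $\mathcal{S}(W)$ be the poset, ordered by inclusion, of the trivial subgroup $W_0$ and all subgroups $W_\alpha$. Let $\mathcal{V}^h_k(W):\mathcal{S}(W)\to\mathrm{dAff}_{\mathbf{k}}$ be $W_0\mapsto V$, $W_\alpha\mapsto V^h_{k_\alpha}(W_\alpha)$ with the canonical maps $V\to V^h_{k_\alpha}(W_\alpha)$, and define $V^h_k(W):=\mathrm{hocolim}_{\mathcal{S}(W)}\mathcal{V}^h_k(W)$. It carries a $W$-action induced by the maps $g:V\to V$, $H_\alpha\to H_{g(\alpha)}$, $V/\!/W_\alpha\to V/\!/W_{g(\alpha)}$ ($g\in W$) and the conjugation action of $W$ on $\mathcal{S}(W)$. *)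

theory Defs
  imports "HOL-Algebra.Algebra" "HOL-Algebra.Algebraic_Closure_Type"
begin

text \<open>
  Throughout, an object of the category dAff of derived affine schemes is represented by its
  dg algebra of functions, and a morphism X \<open>\<rightarrow>\<close> Y of dAff by the dg algebra morphism
  O(Y) \<open>\<rightarrow>\<close> O(X).  Arrows are therefore reversed: (co)limits, (co)fibrations and their homotopy
  versions in dAff appear below as (limits, fibrations)/(colimits, cofibrations) of dg algebras.
\<close>

section \<open>Non-positively graded commutative cochain dg algebras\<close>

record ('k, 'a) dg_alg = "('k, 'a) Module.module" +
  hpart :: "int \<Rightarrow> 'a set"
  dif :: "'a \<Rightarrow> 'a"

text \<open>The carrier is the internal direct sum of the homogeneous parts; \<open>hpart A n\<close> is the part
  of cohomological degree \<open>n\<close>.\<close>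

locale cdga =
  ring A + Module.module ring_of_type_algebra A
  for A :: "('k::field_char_0, 'a) dg_alg" (structure) +
  assumes smult_mult_left:
      "\<lbrakk>x \<in> carrier A; y \<in> carrier A\<rbrakk> \<Longrightarrow> (c \<odot> x) \<otimes> y = c \<odot> (x \<otimes> y)"
    and smult_mult_right:
      "\<lbrakk>x \<in> carrier A; y \<in> carrier A\<rbrakk> \<Longrightarrow> x \<otimes> (c \<odot> y) = c \<odot> (x \<otimes> y)"
    and hpart_subgroup: "additive_subgroup (hpart A n) A"
    and hpart_smult: "x \<in> hpart A n \<Longrightarrow> c \<odot> x \<in> hpart A n"
    and hpart_decomp:
      "x \<in> carrier A \<Longrightarrow>
        \<exists>!f. (\<forall>n. f n \<in> hpart A n) \<and> finite {n. f n \<noteq> \<zero>} \<and>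
             x = finsum A f {n. f n \<noteq> \<zero>}"
    and hpart_nonpos: "n > 0 \<Longrightarrow> hpart A n = {\<zero>}"
    and hpart_one: "\<one> \<in> hpart A 0"
    and hpart_mult: "\<lbrakk>x \<in> hpart A m; y \<in> hpart A n\<rbrakk> \<Longrightarrow> x \<otimes> y \<in> hpart A (m + n)"
    and graded_comm:
      "\<lbrakk>x \<in> hpart A m; y \<in> hpart A n\<rbrakk> \<Longrightarrow>
        x \<otimes> y = (if odd m \<and> odd n then \<ominus> (y \<otimes> x) else y \<otimes> x)"
    and dif_hpart: "x \<in> hpart A n \<Longrightarrow> dif A x \<in> hpart A (n + 1)"
    and dif_add: "\<lbrakk>x \<in> carrier A; y \<in> carrier A\<rbrakk> \<Longrightarrow> dif A (x \<oplus> y) = dif A x \<oplus> dif A y"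
    and dif_smult: "x \<in> carrier A \<Longrightarrow> dif A (c \<odot> x) = c \<odot> dif A x"
    and dif_dif: "x \<in> carrier A \<Longrightarrow> dif A (dif A x) = \<zero>"
    and leibniz:
      "\<lbrakk>x \<in> hpart A m; y \<in> hpart A n\<rbrakk> \<Longrightarrow>
        dif A (x \<otimes> y) =
          dif A x \<otimes> y \<oplus> (if odd m then \<ominus> (x \<otimes> dif A y) else x \<otimes> dif A y)"

definition dg_hom :: "('k, 'a) dg_alg \<Rightarrow> ('k, 'b) dg_alg \<Rightarrow> ('a \<Rightarrow> 'b) set" where
  "dg_hom A B = {f \<in> ring_hom A B.
     (\<forall>c. \<forall>x\<in>carrier A. f (c \<odot>\<^bsub>A\<^esub> x) = c \<odot>\<^bsub>B\<^esub> f x) \<and>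
     (\<forall>n. f ` hpart A n \<subseteq> hpart B n) \<and>
     (\<forall>x\<in>carrier A. f (dif A x) = dif B (f x))}"

definition cocycles :: "('k, 'a) dg_alg \<Rightarrow> int \<Rightarrow> 'a set" where
  "cocycles A n = {x \<in> hpart A n. dif A x = \<zero>\<^bsub>A\<^esub>}"

definition coh_class :: "('k, 'a) dg_alg \<Rightarrow> int \<Rightarrow> 'a \<Rightarrow> 'a set" where
  "coh_class A n x = {x \<oplus>\<^bsub>A\<^esub> dif A y | y. y \<in> hpart A (n - 1)}"

definition cohomology :: "('k, 'a) dg_alg \<Rightarrow> int \<Rightarrow> 'a set set" where
  "cohomology A n = coh_class A n ` cocycles A n"

definition coh_map :: "('a \<Rightarrow> 'b) \<Rightarrow> ('k, 'b) dg_alg \<Rightarrow> int \<Rightarrow> 'a set \<Rightarrow> 'b set" where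
  "coh_map f B n c = (\<Union>x\<in>c. coh_class B n (f x))"

definition quasi_iso :: "('k, 'a) dg_alg \<Rightarrow> ('k, 'b) dg_alg \<Rightarrow> ('a \<Rightarrow> 'b) \<Rightarrow> bool" where
  "quasi_iso A B f \<longleftrightarrow> f \<in> dg_hom A B \<and>
     (\<forall>n. bij_betw (coh_map f B n) (cohomology A n) (cohomology B n))"

definition fibration :: "('k, 'a) dg_alg \<Rightarrow> ('k, 'b) dg_alg \<Rightarrow> ('a \<Rightarrow> 'b) \<Rightarrow> bool" where
  "fibration A B f \<longleftrightarrow> f \<in> dg_hom A B \<and> (\<forall>n<0. f ` hpart A n = hpart B n)"

text \<open>Cofibrations are the maps with the left lifting property against all trivial fibrations.
  The type \<open>'u\<close> is the universe in which the dg algebras under consideration live.\<close>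

definition cofibration ::
  "('k::field_char_0, 'u) dg_alg \<Rightarrow> ('k, 'u) dg_alg \<Rightarrow> ('u \<Rightarrow> 'u) \<Rightarrow> bool" where
  "cofibration A B f \<longleftrightarrow> f \<in> dg_hom A B \<and>
     (\<forall>(P :: ('k, 'u) dg_alg) (Q :: ('k, 'u) dg_alg) p u v.
        cdga P \<and> cdga Q \<and> fibration P Q p \<and> quasi_iso P Q p \<and>
        u \<in> dg_hom A P \<and> v \<in> dg_hom B Q \<and> (\<forall>x\<in>carrier A. p (u x) = v (f x)) \<longrightarrow>
        (\<exists>h\<in>dg_hom B P. (\<forall>x\<in>carrier A. h (f x) = u x) \<and> (\<forall>y\<in>carrier B. p (h y) = v y)))"

text \<open>\<open>Z\<close> with \<open>zM : M \<rightarrow> Z\<close>, \<open>zN : N \<rightarrow> Z\<close> is a pushout of \<open>f : S \<rightarrow> M\<close> and \<open>g : S \<rightarrow> N\<close>.\<close>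

definition is_pushout ::
  "('k::field_char_0, 'u) dg_alg \<Rightarrow> ('k, 'u) dg_alg \<Rightarrow> ('k, 'u) dg_alg \<Rightarrow>
   ('u \<Rightarrow> 'u) \<Rightarrow> ('u \<Rightarrow> 'u) \<Rightarrow>
   ('k, 'u) dg_alg \<Rightarrow> ('u \<Rightarrow> 'u) \<Rightarrow> ('u \<Rightarrow> 'u) \<Rightarrow> bool" where
  "is_pushout S M N f g Z zM zN \<longleftrightarrow>
     cdga Z \<and> zM \<in> dg_hom M Z \<and> zN \<in> dg_hom N Z \<and>
     (\<forall>s\<in>carrier S. zM (f s) = zN (g s)) \<and>
     (\<forall>(T :: ('k, 'u) dg_alg) u v.
        cdga T \<and> u \<in> dg_hom M T \<and> v \<in> dg_hom N T \<and> (\<forall>s\<in>carrier S. u (f s) = v (g s)) \<longrightarrow>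
        (\<exists>h\<in>dg_hom Z T. (\<forall>x\<in>carrier M. h (zM x) = u x) \<and> (\<forall>y\<in>carrier N. h (zN y) = v y) \<and>
           (\<forall>h'\<in>dg_hom Z T.
              (\<forall>x\<in>carrier M. h' (zM x) = u x) \<and> (\<forall>y\<in>carrier N. h' (zN y) = v y) \<longrightarrow>
              (\<forall>z\<in>carrier Z. h' z = h z))))"

text \<open>Limits of dg algebras are formed degreewise on underlying sets.\<close>

definition is_pullback ::
  "('k::field_char_0, 'u) dg_alg \<Rightarrow> ('k, 'u) dg_alg \<Rightarrow> ('k, 'u) dg_alg \<Rightarrow>
   ('u \<Rightarrow> 'u) \<Rightarrow> ('u \<Rightarrow> 'u) \<Rightarrow>
   ('k, 'u) dg_alg \<Rightarrow> ('u \<Rightarrow> 'u) \<Rightarrow> ('u \<Rightarrow> 'u) \<Rightarrow> bool" where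
  "is_pullback M N Z f g P pM pN \<longleftrightarrow>
     cdga P \<and> pM \<in> dg_hom P M \<and> pN \<in> dg_hom P N \<and>
     (\<forall>n. bij_betw (\<lambda>a. (pM a, pN a)) (hpart P n)
            {(x, y). x \<in> hpart M n \<and> y \<in> hpart N n \<and> f x = g y})"

section \<open>Equivariant families and homotopy colimits\<close>

text \<open>
  A \<open>G\<close>-equivariant family over a \<open>G\<close>-set \<open>I\<close> (action \<open>ix\<close>): dg algebras \<open>obj F i\<close> together with
  maps \<open>act F g i : obj F i \<rightarrow> obj F (g i)\<close>, functorial in \<open>g\<close>.  With the one-point index set this
  is a dg algebra with a \<open>G\<close>-action.  On the geometric side, \<open>act F g i\<close> is the pull-back of
  functions along the action of the inverse of \<open>g\<close>.
\<close>

record ('g, 'i, 'k, 'u) fam =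
  obj :: "'i \<Rightarrow> ('k, 'u) dg_alg"
  act :: "'g \<Rightarrow> 'i \<Rightarrow> 'u \<Rightarrow> 'u"

definition equiv_family ::
  "'g monoid \<Rightarrow> ('g \<Rightarrow> 'i \<Rightarrow> 'i) \<Rightarrow> 'i set \<Rightarrow> ('g, 'i, 'k::field_char_0, 'u) fam \<Rightarrow> bool" where
  "equiv_family G ix I F \<longleftrightarrow>
     (\<forall>i\<in>I. cdga (obj F i)) \<and>
     (\<forall>g\<in>carrier G. \<forall>i\<in>I. ix g i \<in> I \<and> act F g i \<in> dg_hom (obj F i) (obj F (ix g i))) \<and>
     (\<forall>i\<in>I. \<forall>x\<in>carrier (obj F i). act F \<one>\<^bsub>G\<^esub> i x = x) \<and>
     (\<forall>g\<in>carrier G. \<forall>h\<in>carrier G. \<forall>i\<in>I. \<forall>x\<in>carrier (obj F i).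
        act F (g \<otimes>\<^bsub>G\<^esub> h) i x = act F g (ix h i) (act F h i x))"

definition equiv_map ::
  "'g monoid \<Rightarrow> ('g \<Rightarrow> 'i \<Rightarrow> 'i) \<Rightarrow> 'i set \<Rightarrow>
   ('g, 'i, 'k, 'u) fam \<Rightarrow> ('g, 'i, 'k, 'u) fam \<Rightarrow> ('i \<Rightarrow> 'u \<Rightarrow> 'u) \<Rightarrow> bool" where
  "equiv_map G ix I F F' f \<longleftrightarrow>
     (\<forall>i\<in>I. f i \<in> dg_hom (obj F i) (obj F' i)) \<and>
     (\<forall>g\<in>carrier G. \<forall>i\<in>I. \<forall>x\<in>carrier (obj F i).
        f (ix g i) (act F g i x) = act F' g i (f i x))"

definition equiv_quasi_iso ::
  "'g monoid \<Rightarrow> ('g \<Rightarrow> 'i \<Rightarrow> 'i) \<Rightarrow> 'i set \<Rightarrow>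
   ('g, 'i, 'k, 'u) fam \<Rightarrow> ('g, 'i, 'k, 'u) fam \<Rightarrow> ('i \<Rightarrow> 'u \<Rightarrow> 'u) \<Rightarrow> bool" where
  "equiv_quasi_iso G ix I F F' f \<longleftrightarrow>
     equiv_map G ix I F F' f \<and> (\<forall>i\<in>I. quasi_iso (obj F i) (obj F' i) (f i))"

text \<open>\<open>G\<close>-equivariant weak equivalence of two objects with \<open>G\<close>-action: a finite zigzag of
  \<open>G\<close>-equivariant quasi-isomorphisms between dg algebras with \<open>G\<close>-action.\<close>

definition equivariantly_equivalent ::
  "'g monoid \<Rightarrow> ('g, unit, 'k::field_char_0, 'u) fam \<Rightarrow> ('g, unit, 'k, 'u) fam \<Rightarrow> bool" where
  "equivariantly_equivalent G =
     equivclp (\<lambda>F F'. equiv_family G (\<lambda>_ _. ()) UNIV F \<and> equiv_family G (\<lambda>_ _. ()) UNIV F' \<and>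
                 (\<exists>f. equiv_quasi_iso G (\<lambda>_ _. ()) UNIV F F' f))"

text \<open>
  \<open>Z\<close> is (the algebra of functions on) the homotopy fibre product, over \<open>S\<close>, of \<open>M\<close> and \<open>N\<close>,
  computed after replacing \<open>c : S \<rightarrow> M\<close> by a cofibration \<open>c' : S \<rightarrow> M'\<close> followed by a weak
  equivalence \<open>q : M' \<rightarrow> M\<close>; replacing one leg suffices because the model category is left proper.
\<close>

definition homotopy_fibre_product ::
  "'g monoid \<Rightarrow> ('g \<Rightarrow> 'i \<Rightarrow> 'i) \<Rightarrow> 'i set \<Rightarrow>
   ('g, 'i, 'k::field_char_0, 'u) fam \<Rightarrow> ('g, 'i, 'k, 'u) fam \<Rightarrow> ('g, 'i, 'k, 'u) fam \<Rightarrow>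
   ('i \<Rightarrow> 'u \<Rightarrow> 'u) \<Rightarrow> ('i \<Rightarrow> 'u \<Rightarrow> 'u) \<Rightarrow>
   ('g, 'i, 'k, 'u) fam \<Rightarrow> ('i \<Rightarrow> 'u \<Rightarrow> 'u) \<Rightarrow> ('i \<Rightarrow> 'u \<Rightarrow> 'u) \<Rightarrow>
   ('g, 'i, 'k, 'u) fam \<Rightarrow> ('i \<Rightarrow> 'u \<Rightarrow> 'u) \<Rightarrow> ('i \<Rightarrow> 'u \<Rightarrow> 'u) \<Rightarrow> bool" where
  "homotopy_fibre_product G ix I S M N c b M' c' q Z zM zN \<longleftrightarrow>
     equiv_family G ix I M' \<and> equiv_map G ix I S M' c' \<and> equiv_quasi_iso G ix I M' M q \<and>
     (\<forall>i\<in>I. cofibration (obj S i) (obj M' i) (c' i) \<and>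
            (\<forall>s\<in>carrier (obj S i). q i (c' i s) = c i s)) \<and>
     equiv_family G ix I Z \<and> equiv_map G ix I M' Z zM \<and> equiv_map G ix I N Z zN \<and>
     (\<forall>i\<in>I. is_pushout (obj S i) (obj M' i) (obj N i) (c' i) (b i) (obj Z i) (zM i) (zN i))"

text \<open>
  \<open>J\<close> is the homotopy pushout in dAff, i.e. the homotopy pullback of dg algebras, of
  \<open>zM : M \<rightarrow> Z\<close> and \<open>zN : N \<rightarrow> Z\<close>, computed after replacing \<open>zN\<close> by a weak equivalence
  \<open>w : N \<rightarrow> N'\<close> followed by a fibration \<open>N' \<rightarrow> Z\<close> (one leg suffices since all dg algebras are
  fibrant).
\<close>

definition homotopy_pushout ::
  "'g monoid \<Rightarrow> ('g \<Rightarrow> 'i \<Rightarrow> 'i) \<Rightarrow> 'i set \<Rightarrow>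
   ('g, 'i, 'k::field_char_0, 'u) fam \<Rightarrow> ('g, 'i, 'k, 'u) fam \<Rightarrow> ('g, 'i, 'k, 'u) fam \<Rightarrow>
   ('i \<Rightarrow> 'u \<Rightarrow> 'u) \<Rightarrow> ('i \<Rightarrow> 'u \<Rightarrow> 'u) \<Rightarrow>
   ('g, 'i, 'k, 'u) fam \<Rightarrow> ('i \<Rightarrow> 'u \<Rightarrow> 'u) \<Rightarrow>
   ('g, 'i, 'k, 'u) fam \<Rightarrow> ('i \<Rightarrow> 'u \<Rightarrow> 'u) \<Rightarrow> ('i \<Rightarrow> 'u \<Rightarrow> 'u) \<Rightarrow> bool" where
  "homotopy_pushout G ix I M N Z zM zN N' w J rM rN \<longleftrightarrow>
     equiv_family G ix I N' \<and> equiv_quasi_iso G ix I N N' w \<and>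
     (\<exists>p. equiv_map G ix I N' Z p \<and>
        (\<forall>i\<in>I. fibration (obj N' i) (obj Z i) (p i) \<and>
               (\<forall>y\<in>carrier (obj N i). p i (w i y) = zN i y) \<and>
               is_pullback (obj M i) (obj N' i) (obj Z i) (zM i) (p i) (obj J i) (rM i) (rN i))) \<and>
     equiv_family G ix I J \<and> equiv_map G ix I J M rM \<and> equiv_map G ix I J N' rN"

text \<open>
  \<open>J\<close> is a derived relative join over \<open>S\<close> of \<open>M\<close> (structure map \<open>c : S \<rightarrow> M\<close>) and \<open>N\<close> (structure
  map \<open>b : S \<rightarrow> N\<close>), with \<open>cJ : S \<rightarrow> J\<close> the canonical structure map and \<open>e : J \<rightarrow> M\<close> the function
  side of the canonical map from \<open>M\<close> to the join.
\<close>

definition derived_join ::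
  "'g monoid \<Rightarrow> ('g \<Rightarrow> 'i \<Rightarrow> 'i) \<Rightarrow> 'i set \<Rightarrow>
   ('g, 'i, 'k::field_char_0, 'u) fam \<Rightarrow> ('g, 'i, 'k, 'u) fam \<Rightarrow> ('g, 'i, 'k, 'u) fam \<Rightarrow>
   ('i \<Rightarrow> 'u \<Rightarrow> 'u) \<Rightarrow> ('i \<Rightarrow> 'u \<Rightarrow> 'u) \<Rightarrow>
   ('g, 'i, 'k, 'u) fam \<Rightarrow> ('i \<Rightarrow> 'u \<Rightarrow> 'u) \<Rightarrow> ('i \<Rightarrow> 'u \<Rightarrow> 'u) \<Rightarrow> bool" where
  "derived_join G ix I S M N c b J cJ e \<longleftrightarrow>
     (\<exists>M' c' q Z zM zN N' w rM rN.
        homotopy_fibre_product G ix I S M N c b M' c' q Z zM zN \<and>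
        homotopy_pushout G ix I M' N Z zM zN N' w J rM rN \<and>
        equiv_map G ix I S J cJ \<and>
        (\<forall>i\<in>I. (\<forall>s\<in>carrier (obj S i). rM i (cJ i s) = c' i s \<and> rN i (cJ i s) = w i (b i s)) \<and>
               (\<forall>a\<in>carrier (obj J i). e i a = q i (rM i a))))"

text \<open>
  A \<open>G\<close>-equivariant diagram on a poset \<open>I\<close> on which \<open>G\<close> acts: for \<open>q \<le> p\<close> the map
  \<open>obj D q \<rightarrow> obj D p\<close> of derived schemes is given on functions by \<open>r p q : obj D p \<rightarrow> obj D q\<close>.
\<close>

definition equiv_diagram ::
  "'g monoid \<Rightarrow> ('g \<Rightarrow> 'i \<Rightarrow> 'i) \<Rightarrow> 'i::order set \<Rightarrow>
   ('g, 'i, 'k::field_char_0, 'u) fam \<Rightarrow> ('i \<Rightarrow> 'i \<Rightarrow> 'u \<Rightarrow> 'u) \<Rightarrow> bool" where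
  "equiv_diagram G ix I D r \<longleftrightarrow>
     equiv_family G ix I D \<and>
     (\<forall>p\<in>I. \<forall>q\<in>I. q \<le> p \<longrightarrow> r p q \<in> dg_hom (obj D p) (obj D q)) \<and>
     (\<forall>p\<in>I. \<forall>x\<in>carrier (obj D p). r p p x = x) \<and>
     (\<forall>p\<in>I. \<forall>q\<in>I. \<forall>t\<in>I. t \<le> q \<and> q \<le> p \<longrightarrow>
        (\<forall>x\<in>carrier (obj D p). r q t (r p q x) = r p t x)) \<and>
     (\<forall>g\<in>carrier G. \<forall>p\<in>I. \<forall>q\<in>I. q \<le> p \<longrightarrow>
        (\<forall>x\<in>carrier (obj D p). r (ix g p) (ix g q) (act D g p x) = act D g q (r p q x)))"

definition compatible ::
  "'i::order set \<Rightarrow> ('g, 'i, 'k, 'u) fam \<Rightarrow> ('i \<Rightarrow> 'i \<Rightarrow> 'u \<Rightarrow> 'u) \<Rightarrow> int \<Rightarrow> ('i \<Rightarrow> 'u) set" where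
  "compatible I D r n =
     {x \<in> PiE I (\<lambda>p. hpart (obj D p) n). \<forall>p\<in>I. \<forall>q\<in>I. q \<le> p \<longrightarrow> r p q (x p) = x q}"

text \<open>Reedy fibrancy: the maps to the matching objects are fibrations, that is, surjective in
  strictly negative degrees.\<close>

definition reedy_fibrant ::
  "'i::order set \<Rightarrow> ('g, 'i, 'k, 'u) fam \<Rightarrow> ('i \<Rightarrow> 'i \<Rightarrow> 'u \<Rightarrow> 'u) \<Rightarrow> bool" where
  "reedy_fibrant I D r \<longleftrightarrow>
     (\<forall>p\<in>I. \<forall>n<0. \<forall>x\<in>compatible {q\<in>I. q < p} D r n.
        \<exists>y\<in>hpart (obj D p) n. \<forall>q\<in>I. q < p \<longrightarrow> r p q y = x q)"

text \<open>
  \<open>L\<close> is the homotopy colimit in dAff, with the induced \<open>G\<close>-action, of the diagram \<open>D\<close> on \<open>I\<close>: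
  the limit of a Reedy fibrant replacement of the corresponding diagram of dg algebras on the
  opposite of \<open>I\<close>.
\<close>

definition homotopy_colimit ::
  "'g monoid \<Rightarrow> ('g \<Rightarrow> 'i \<Rightarrow> 'i) \<Rightarrow> 'i::order set \<Rightarrow>
   ('g, 'i, 'k::field_char_0, 'u) fam \<Rightarrow> ('i \<Rightarrow> 'i \<Rightarrow> 'u \<Rightarrow> 'u) \<Rightarrow>
   ('g, unit, 'k, 'u) fam \<Rightarrow> bool" where
  "homotopy_colimit G ix I D r L \<longleftrightarrow>
     equiv_diagram G ix I D r \<and> equiv_family G (\<lambda>_ _. ()) UNIV L \<and>
     (\<exists>D' r' t \<pi>.
        equiv_diagram G ix I D' r' \<and> equiv_quasi_iso G ix I D D' t \<and>
        (\<forall>p\<in>I. \<forall>q\<in>I. q \<le> p \<longrightarrow>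
           (\<forall>x\<in>carrier (obj D p). t q (r p q x) = r' p q (t p x))) \<and>
        reedy_fibrant I D' r' \<and>
        (\<forall>p\<in>I. \<pi> p \<in> dg_hom (obj L ()) (obj D' p)) \<and>
        (\<forall>g\<in>carrier G. \<forall>p\<in>I. \<forall>x\<in>carrier (obj L ()).
           \<pi> (ix g p) (act L g () x) = act D' g p (\<pi> p x)) \<and>
        (\<forall>n. bij_betw (\<lambda>x. \<lambda>p\<in>I. \<pi> p x) (hpart (obj L ()) n) (compatible I D' r' n)))"

section \<open>Finite Coxeter groups and reflection representations\<close>

text \<open>Equality of words modulo the Coxeter relations \<open>(s t)\<^bsup>m(s,t)\<^esup> = 1\<close>, where \<open>m(s,t)\<close> is the
  order of \<open>s t\<close> (so \<open>m(s,s) = 1\<close>).\<close>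

inductive coxeter_eq :: "'g monoid \<Rightarrow> 'g set \<Rightarrow> 'g list \<Rightarrow> 'g list \<Rightarrow> bool"
  for G S where
  relation: "\<lbrakk>s \<in> S; t \<in> S\<rbrakk> \<Longrightarrow>
     coxeter_eq G S (u @ concat (replicate (group.ord G (s \<otimes>\<^bsub>G\<^esub> t)) [s, t]) @ v) (u @ v)"
| refl: "coxeter_eq G S u u"
| sym: "coxeter_eq G S u v \<Longrightarrow> coxeter_eq G S v u"
| trans: "\<lbrakk>coxeter_eq G S u v; coxeter_eq G S v w\<rbrakk> \<Longrightarrow> coxeter_eq G S u w"

definition coxeter_system :: "'g monoid \<Rightarrow> 'g set \<Rightarrow> bool" where
  "coxeter_system G S \<longleftrightarrow>
     group G \<and> S \<subseteq> carrier G \<and> generate G S = carrier G \<and>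
     (\<forall>s\<in>S. s \<noteq> \<one>\<^bsub>G\<^esub> \<and> s \<otimes>\<^bsub>G\<^esub> s = \<one>\<^bsub>G\<^esub>) \<and>
     (\<forall>w\<in>lists S. foldr (\<lambda>s x. s \<otimes>\<^bsub>G\<^esub> x) w \<one>\<^bsub>G\<^esub> = \<one>\<^bsub>G\<^esub> \<longrightarrow> coxeter_eq G S w [])"

definition fixed_space :: "('g \<Rightarrow> 'v \<Rightarrow> 'v) \<Rightarrow> 'g set \<Rightarrow> 'v set" where
  "fixed_space \<rho> U = {v. \<forall>u\<in>U. \<rho> u v = v}"

definition is_reflection ::
  "('k::field \<Rightarrow> 'v::ab_group_add \<Rightarrow> 'v) \<Rightarrow> ('v \<Rightarrow> 'v) \<Rightarrow> bool" where
  "is_reflection scale s \<longleftrightarrow>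
     Vector_Spaces.linear scale scale s \<and> s \<circ> s = id \<and>
     vector_space.dim scale {v. s v = v} + 1 = vector_space.dim scale UNIV"

text \<open>The vector space is the whole type \<open>'v\<close>; \<open>Basis\<close> only witnesses that it is
  finite-dimensional.\<close>

definition coxeter_reflection_rep ::
  "('k::field_char_0 \<Rightarrow> 'v::ab_group_add \<Rightarrow> 'v) \<Rightarrow> 'v set \<Rightarrow>
   'g monoid \<Rightarrow> 'g set \<Rightarrow> ('g \<Rightarrow> 'v \<Rightarrow> 'v) \<Rightarrow> bool" where
  "coxeter_reflection_rep scale Basis G S \<rho> \<longleftrightarrow>
     finite_dimensional_vector_space scale Basis \<and>
     coxeter_system G S \<and> finite (carrier G) \<and>
     (\<forall>g\<in>carrier G. Vector_Spaces.linear scale scale (\<rho> g)) \<and>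
     \<rho> \<one>\<^bsub>G\<^esub> = id \<and> (\<forall>g\<in>carrier G. \<forall>h\<in>carrier G. \<rho> (g \<otimes>\<^bsub>G\<^esub> h) = \<rho> g \<circ> \<rho> h) \<and>
     inj_on \<rho> (carrier G) \<and>
     (\<forall>s\<in>S. is_reflection scale (\<rho> s))"

definition reflection_hyperplanes ::
  "('k::field_char_0 \<Rightarrow> 'v::ab_group_add \<Rightarrow> 'v) \<Rightarrow> 'g monoid \<Rightarrow> ('g \<Rightarrow> 'v \<Rightarrow> 'v) \<Rightarrow> 'v set set" where
  "reflection_hyperplanes scale G \<rho> =
     {fixed_space \<rho> {s} | s. s \<in> carrier G \<and> is_reflection scale (\<rho> s)}"

definition refl_at ::
  "('k::field_char_0 \<Rightarrow> 'v::ab_group_add \<Rightarrow> 'v) \<Rightarrow> 'g monoid \<Rightarrow> ('g \<Rightarrow> 'v \<Rightarrow> 'v) \<Rightarrow> 'v set \<Rightarrow> 'g" where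
  "refl_at scale G \<rho> H =
     (THE s. s \<in> carrier G \<and> is_reflection scale (\<rho> s) \<and> fixed_space \<rho> {s} = H)"

definition refl_subgroup ::
  "('k::field_char_0 \<Rightarrow> 'v::ab_group_add \<Rightarrow> 'v) \<Rightarrow> 'g monoid \<Rightarrow> ('g \<Rightarrow> 'v \<Rightarrow> 'v) \<Rightarrow> 'v set \<Rightarrow> 'g set" where
  "refl_subgroup scale G \<rho> H = {\<one>\<^bsub>G\<^esub>, refl_at scale G \<rho> H}"

definition subgroup_poset ::
  "('k::field_char_0 \<Rightarrow> 'v::ab_group_add \<Rightarrow> 'v) \<Rightarrow> 'g monoid \<Rightarrow> ('g \<Rightarrow> 'v \<Rightarrow> 'v) \<Rightarrow> 'g set set" where
  "subgroup_poset scale G \<rho> =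
     insert {\<one>\<^bsub>G\<^esub>} (refl_subgroup scale G \<rho> ` reflection_hyperplanes scale G \<rho>)"

definition conj_action :: "'g monoid \<Rightarrow> 'g \<Rightarrow> 'g set \<Rightarrow> 'g set" where
  "conj_action G g U = (\<lambda>u. g \<otimes>\<^bsub>G\<^esub> u \<otimes>\<^bsub>G\<^esub> inv\<^bsub>G\<^esub> g) ` U"

definition hyperplane_forms ::
  "('k::field_char_0 \<Rightarrow> 'v::ab_group_add \<Rightarrow> 'v) \<Rightarrow> 'v set set \<Rightarrow> ('v set \<Rightarrow> 'v \<Rightarrow> 'k) \<Rightarrow> bool" where
  "hyperplane_forms scale \<A> \<alpha> \<longleftrightarrow>
     (\<forall>H\<in>\<A>. Vector_Spaces.linear scale (*) (\<alpha> H) \<and> {v. \<alpha> H v = 0} = H)"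

definition multiplicities ::
  "'g monoid \<Rightarrow> ('g \<Rightarrow> 'v \<Rightarrow> 'v) \<Rightarrow> 'v set set \<Rightarrow> ('v set \<Rightarrow> nat) set" where
  "multiplicities G \<rho> \<A> = {k. \<forall>g\<in>carrier G. \<forall>H\<in>\<A>. k (\<rho> g ` H) = k H}"

section \<open>Coordinate rings and quasi-invariants\<close>

text \<open>As the ground field is infinite, \<open>k[V]\<close> is the algebra of polynomial functions on \<open>V\<close>.\<close>

inductive_set polynomials ::
  "('k::field_char_0 \<Rightarrow> 'v::ab_group_add \<Rightarrow> 'v) \<Rightarrow> ('v \<Rightarrow> 'k) set" for scale where
  const: "(\<lambda>_. c) \<in> polynomials scale"
| form: "Vector_Spaces.linear scale (*) l \<Longrightarrow> l \<in> polynomials scale"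
| add: "\<lbrakk>p \<in> polynomials scale; q \<in> polynomials scale\<rbrakk> \<Longrightarrow> (\<lambda>v. p v + q v) \<in> polynomials scale"
| mult: "\<lbrakk>p \<in> polynomials scale; q \<in> polynomials scale\<rbrakk> \<Longrightarrow> (\<lambda>v. p v * q v) \<in> polynomials scale"

text \<open>Functions on a subset \<open>D\<close> of \<open>V\<close> are represented by functions on \<open>V\<close> vanishing outside
  \<open>D\<close>.\<close>

definition restr :: "'v set \<Rightarrow> ('v \<Rightarrow> 'k::zero) \<Rightarrow> 'v \<Rightarrow> 'k" where
  "restr D p = (\<lambda>v. if v \<in> D then p v else 0)"

definition function_algebra ::
  "'v set \<Rightarrow> ('v \<Rightarrow> 'k::field_char_0) set \<Rightarrow> ('k, 'v \<Rightarrow> 'k) Module.module" where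
  "function_algebra D F =
     \<lparr>carrier = F, monoid.mult = (\<lambda>p q v. p v * q v), one = restr D (\<lambda>_. 1),
      ring.zero = (\<lambda>_. 0), add = (\<lambda>p q v. p v + q v), module.smult = (\<lambda>c p v. c * p v)\<rparr>"

definition translate :: "'g monoid \<Rightarrow> ('g \<Rightarrow> 'v \<Rightarrow> 'v) \<Rightarrow> 'g \<Rightarrow> ('v \<Rightarrow> 'k) \<Rightarrow> 'v \<Rightarrow> 'k" where
  "translate G \<rho> g p = p \<circ> \<rho> (inv\<^bsub>G\<^esub> g)"

definition invariants ::
  "('k::field_char_0 \<Rightarrow> 'v::ab_group_add \<Rightarrow> 'v) \<Rightarrow> 'g monoid \<Rightarrow> ('g \<Rightarrow> 'v \<Rightarrow> 'v) \<Rightarrow> 'g set \<Rightarrow>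
   ('v \<Rightarrow> 'k) set" where
  "invariants scale G \<rho> U = {p \<in> polynomials scale. \<forall>u\<in>U. translate G \<rho> u p = p}"

text \<open>The ideal \<open>\<langle>\<alpha>\<rangle>\<^bsup>2k\<^esup>\<close> of \<open>k[V]\<close> is generated by the power \<open>\<alpha>\<^bsup>2k\<^esup>\<close>.\<close>

definition quasi_invariants ::
  "('k::field_char_0 \<Rightarrow> 'v::ab_group_add \<Rightarrow> 'v) \<Rightarrow> 'g monoid \<Rightarrow> ('g \<Rightarrow> 'v \<Rightarrow> 'v) \<Rightarrow>
   ('v set \<Rightarrow> 'v \<Rightarrow> 'k) \<Rightarrow> ('v set \<Rightarrow> nat) \<Rightarrow> ('v \<Rightarrow> 'k) set" where
  "quasi_invariants scale G \<rho> \<alpha> k =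
     {p \<in> polynomials scale. \<forall>H\<in>reflection_hyperplanes scale G \<rho>.
        \<exists>q\<in>polynomials scale. \<forall>v.
          translate G \<rho> (refl_at scale G \<rho> H) p v - p v = \<alpha> H v ^ (2 * k H) * q v}"

section \<open>Derived spaces of quasi-invariants\<close>

text \<open>
  A commutative algebra with underlying type \<open>'b\<close> regarded as a dg algebra concentrated in degree
  0, transported into the universe \<open>'u\<close> along an injection \<open>\<epsilon>\<close>; \<open>lift\<close> transports maps.
\<close>

definition RSpec :: "('b \<Rightarrow> 'u) \<Rightarrow> ('k, 'b) Module.module \<Rightarrow> ('k, 'u) dg_alg" where
  "RSpec \<epsilon> R =
     \<lparr>carrier = \<epsilon> ` carrier R,
      monoid.mult = (\<lambda>x y. \<epsilon> (the_inv \<epsilon> x \<otimes>\<^bsub>R\<^esub> the_inv \<epsilon> y)), one = \<epsilon> \<one>\<^bsub>R\<^esub>,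
      ring.zero = \<epsilon> \<zero>\<^bsub>R\<^esub>, add = (\<lambda>x y. \<epsilon> (the_inv \<epsilon> x \<oplus>\<^bsub>R\<^esub> the_inv \<epsilon> y)),
      module.smult = (\<lambda>c x. \<epsilon> (c \<odot>\<^bsub>R\<^esub> the_inv \<epsilon> x)),
      hpart = (\<lambda>n. if n = 0 then \<epsilon> ` carrier R else {\<epsilon> \<zero>\<^bsub>R\<^esub>}),
      dif = (\<lambda>_. \<epsilon> \<zero>\<^bsub>R\<^esub>)\<rparr>"

definition lift :: "('b \<Rightarrow> 'u) \<Rightarrow> ('b \<Rightarrow> 'b) \<Rightarrow> 'u \<Rightarrow> 'u" where
  "lift \<epsilon> f = (\<lambda>x. \<epsilon> (f (the_inv \<epsilon> x)))"

definition function_fam ::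
  "(('v \<Rightarrow> 'k::field_char_0) \<Rightarrow> 'u) \<Rightarrow> 'g monoid \<Rightarrow> ('g \<Rightarrow> 'v \<Rightarrow> 'v) \<Rightarrow>
   ('i \<Rightarrow> 'v set) \<Rightarrow> ('i \<Rightarrow> ('v \<Rightarrow> 'k) set) \<Rightarrow> ('g, 'i, 'k, 'u) fam" where
  "function_fam \<epsilon> G \<rho> D F =
     \<lparr>obj = (\<lambda>i. RSpec \<epsilon> (function_algebra (D i) (F i))), act = (\<lambda>g _. lift \<epsilon> (translate G \<rho> g))\<rparr>"

abbreviation hyp_action :: "('g \<Rightarrow> 'v \<Rightarrow> 'v) \<Rightarrow> 'g \<Rightarrow> 'v set \<Rightarrow> 'v set" where
  "hyp_action \<rho> g H \<equiv> \<rho> g ` H"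

text \<open>The families, indexed by the reflection hyperplanes \<open>H\<close>, of the derived schemes \<open>V\<close>,
  \<open>V // W\<^sub>H\<close> and \<open>H\<close>.\<close>

definition space_fam ::
  "('k::field_char_0 \<Rightarrow> 'v::ab_group_add \<Rightarrow> 'v) \<Rightarrow> 'g monoid \<Rightarrow> ('g \<Rightarrow> 'v \<Rightarrow> 'v) \<Rightarrow>
   (('v \<Rightarrow> 'k) \<Rightarrow> 'u) \<Rightarrow> ('g, 'v set, 'k, 'u) fam" where
  "space_fam scale G \<rho> \<epsilon> = function_fam \<epsilon> G \<rho> (\<lambda>_. UNIV) (\<lambda>_. polynomials scale)"

definition quotient_fam ::
  "('k::field_char_0 \<Rightarrow> 'v::ab_group_add \<Rightarrow> 'v) \<Rightarrow> 'g monoid \<Rightarrow> ('g \<Rightarrow> 'v \<Rightarrow> 'v) \<Rightarrow>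
   (('v \<Rightarrow> 'k) \<Rightarrow> 'u) \<Rightarrow> ('g, 'v set, 'k, 'u) fam" where
  "quotient_fam scale G \<rho> \<epsilon> = function_fam \<epsilon> G \<rho> (\<lambda>_. UNIV)
     (\<lambda>H. invariants scale G \<rho> (refl_subgroup scale G \<rho> H))"

definition hyperplane_fam ::
  "('k::field_char_0 \<Rightarrow> 'v::ab_group_add \<Rightarrow> 'v) \<Rightarrow> 'g monoid \<Rightarrow> ('g \<Rightarrow> 'v \<Rightarrow> 'v) \<Rightarrow>
   (('v \<Rightarrow> 'k) \<Rightarrow> 'u) \<Rightarrow> ('g, 'v set, 'k, 'u) fam" where
  "hyperplane_fam scale G \<rho> \<epsilon> = function_fam \<epsilon> G \<rho> (\<lambda>H. H) (\<lambda>H. restr H ` polynomials scale)"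

text \<open>
  \<open>A j H\<close> is \<open>V\<^sup>h\<^sub>j(W\<^sub>H)\<close>, with structure map \<open>c j H\<close> to \<open>V // W\<^sub>H\<close> and canonical map \<open>e j H\<close>
  from \<open>V\<^sup>h\<^sub>j(W\<^sub>H)\<close> to \<open>V\<^sup>h\<^sub>j\<^sub>+\<^sub>1(W\<^sub>H)\<close>, everything \<open>W\<close>-equivariant in \<open>H\<close>.  The join being defined
  up to weak equivalence only, any equivariant choice of the replacements is admitted.
\<close>

definition join_tower ::
  "('k::field_char_0 \<Rightarrow> 'v::ab_group_add \<Rightarrow> 'v) \<Rightarrow> 'g monoid \<Rightarrow> ('g \<Rightarrow> 'v \<Rightarrow> 'v) \<Rightarrow>
   (('v \<Rightarrow> 'k) \<Rightarrow> 'u) \<Rightarrow>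
   (nat \<Rightarrow> ('g, 'v set, 'k, 'u) fam) \<Rightarrow> (nat \<Rightarrow> 'v set \<Rightarrow> 'u \<Rightarrow> 'u) \<Rightarrow>
   (nat \<Rightarrow> 'v set \<Rightarrow> 'u \<Rightarrow> 'u) \<Rightarrow> bool" where
  "join_tower scale G \<rho> \<epsilon> A c e \<longleftrightarrow>
     A 0 = space_fam scale G \<rho> \<epsilon> \<and>
     (\<forall>H\<in>reflection_hyperplanes scale G \<rho>.
        \<forall>x\<in>carrier (obj (quotient_fam scale G \<rho> \<epsilon>) H). c 0 H x = x) \<and>
     (\<forall>j. derived_join G (hyp_action \<rho>) (reflection_hyperplanes scale G \<rho>)
            (quotient_fam scale G \<rho> \<epsilon>) (A j) (hyperplane_fam scale G \<rho> \<epsilon>)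
            (c j) (\<lambda>H. lift \<epsilon> (restr H)) (A (Suc j)) (c (Suc j)) (e j))"

text \<open>The function side of the canonical map from \<open>V\<close> to \<open>V\<^sup>h\<^sub>j(W\<^sub>H)\<close>.\<close>

primrec from_space :: "(nat \<Rightarrow> 'h \<Rightarrow> 'u \<Rightarrow> 'u) \<Rightarrow> nat \<Rightarrow> 'h \<Rightarrow> 'u \<Rightarrow> 'u" where
  "from_space e 0 H = id"
| "from_space e (Suc j) H = from_space e j H \<circ> e j H"

text \<open>The diagram on the poset of the subgroups \<open>W\<^sub>0\<close> and \<open>W\<^sub>H\<close>; the hyperplane is recovered from
  the subgroup \<open>W\<^sub>H\<close> as its fixed space.\<close>

definition qi_diagram ::
  "('k::field_char_0 \<Rightarrow> 'v::ab_group_add \<Rightarrow> 'v) \<Rightarrow> 'g monoid \<Rightarrow> ('g \<Rightarrow> 'v \<Rightarrow> 'v) \<Rightarrow>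
   (('v \<Rightarrow> 'k) \<Rightarrow> 'u) \<Rightarrow> (nat \<Rightarrow> ('g, 'v set, 'k, 'u) fam) \<Rightarrow> ('v set \<Rightarrow> nat) \<Rightarrow>
   ('g, 'g set, 'k, 'u) fam" where
  "qi_diagram scale G \<rho> \<epsilon> A k =
     \<lparr>obj = (\<lambda>U. let H = fixed_space \<rho> U in
               if U = {\<one>\<^bsub>G\<^esub>} then obj (space_fam scale G \<rho> \<epsilon>) H else obj (A (k H)) H),
      act = (\<lambda>g U. let H = fixed_space \<rho> U in
               if U = {\<one>\<^bsub>G\<^esub>} then act (space_fam scale G \<rho> \<epsilon>) g H else act (A (k H)) g H)\<rparr>"

definition qi_diagram_maps ::
  "('g \<Rightarrow> 'v \<Rightarrow> 'v) \<Rightarrow> (nat \<Rightarrow> 'v set \<Rightarrow> 'u \<Rightarrow> 'u) \<Rightarrow> ('v set \<Rightarrow> nat) \<Rightarrow>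
   'g set \<Rightarrow> 'g set \<Rightarrow> 'u \<Rightarrow> 'u" where
  "qi_diagram_maps \<rho> e k U U' =
     (if U = U' then id else from_space e (k (fixed_space \<rho> U)) (fixed_space \<rho> U))"

text \<open>\<open>L\<close>, with its \<open>W\<close>-action, is (a model of) the derived space \<open>V\<^sup>h\<^sub>k(W)\<close>.\<close>

definition derived_qi_space ::
  "('k::field_char_0 \<Rightarrow> 'v::ab_group_add \<Rightarrow> 'v) \<Rightarrow> 'g monoid \<Rightarrow> ('g \<Rightarrow> 'v \<Rightarrow> 'v) \<Rightarrow>
   (('v \<Rightarrow> 'k) \<Rightarrow> 'u) \<Rightarrow> ('v set \<Rightarrow> nat) \<Rightarrow> ('g, unit, 'k, 'u) fam \<Rightarrow> bool" where
  "derived_qi_space scale G \<rho> \<epsilon> k L \<longleftrightarrow>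
     (\<exists>A c e. join_tower scale G \<rho> \<epsilon> A c e \<and>
        homotopy_colimit G (conj_action G) (subgroup_poset scale G \<rho>)
          (qi_diagram scale G \<rho> \<epsilon> A k) (qi_diagram_maps \<rho> e k) L)"

definition RSpec_qi ::
  "('k::field_char_0 \<Rightarrow> 'v::ab_group_add \<Rightarrow> 'v) \<Rightarrow> 'g monoid \<Rightarrow> ('g \<Rightarrow> 'v \<Rightarrow> 'v) \<Rightarrow>
   (('v \<Rightarrow> 'k) \<Rightarrow> 'u) \<Rightarrow> ('v set \<Rightarrow> 'v \<Rightarrow> 'k) \<Rightarrow> ('v set \<Rightarrow> nat) \<Rightarrow> ('g, unit, 'k, 'u) fam" where
  "RSpec_qi scale G \<rho> \<epsilon> \<alpha> k =
     function_fam \<epsilon> G \<rho> (\<lambda>_. UNIV) (\<lambda>_. quasi_invariants scale G \<rho> \<alpha> k)"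

text \<open>
  The category of affine schemes over \<open>k\<close> is the opposite of that of commutative \<open>k\<close>-algebras, so
  a classical affine scheme with group action is represented by its coordinate algebra together
  with the induced action \<open>\<tau>\<close>; \<open>classical_in_dAff\<close> is the embedding into dAff.
\<close>

definition classical_in_dAff ::
  "('b \<Rightarrow> 'u) \<Rightarrow> ('k, 'b) Module.module \<times> ('g \<Rightarrow> 'b \<Rightarrow> 'b) \<Rightarrow> ('g, unit, 'k, 'u) fam" where
  "classical_in_dAff \<epsilon> = (\<lambda>(R, \<tau>). \<lparr>obj = (\<lambda>_. RSpec \<epsilon> R), act = (\<lambda>g _. lift \<epsilon> (\<tau> g))\<rparr>)"

definition qi_variety ::
  "('k::field_char_0 \<Rightarrow> 'v::ab_group_add \<Rightarrow> 'v) \<Rightarrow> 'g monoid \<Rightarrow> ('g \<Rightarrow> 'v \<Rightarrow> 'v) \<Rightarrow>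
   ('v set \<Rightarrow> 'v \<Rightarrow> 'k) \<Rightarrow> ('v set \<Rightarrow> nat) \<Rightarrow>
   ('k, 'v \<Rightarrow> 'k) Module.module \<times> ('g \<Rightarrow> ('v \<Rightarrow> 'k) \<Rightarrow> 'v \<Rightarrow> 'k)" where
  "qi_variety scale G \<rho> \<alpha> k =
     (function_algebra UNIV (quasi_invariants scale G \<rho> \<alpha> k), translate G \<rho>)"

end

theory Submission
  imports Defs "HOL-Computational_Algebra.Polynomial"
begin

text \<open>
  Writing \<open>Q\<^sub>j\<close> for the polynomials \<open>p\<close> with \<open>s p - p\<close> divisible by \<open>\<alpha>\<^sup>2\<^sup>j\<close>, induction on \<open>j\<close> shows
  that the function algebra of the \<open>j\<close>-th join resolves \<open>Q\<^sub>j\<close>, i.e. has cohomology \<open>Q\<^sub>j\<close> in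
  degree 0.  The algebra \<open>k[H]\<close> is the quotient of the invariants \<open>S = k[V]\<^sup>s\<close> by \<open>x = \<alpha>\<^sup>2\<close>, and \<open>x\<close>
  acts without torsion on a cofibrant \<open>S\<close>-algebra \<open>M\<close>, so the homotopy fibre product is \<open>M/xM\<close>,
  with cohomology \<open>Q\<^sub>j/\<alpha>\<^sup>2Q\<^sub>j\<close> in degree 0; Mayer-Vietoris then yields \<open>S + \<alpha>\<^sup>2Q\<^sub>j = Q\<^sub>j\<^sub>+\<^sub>1\<close>.  In the
  limit over the star-shaped poset the same argument yields the intersection, over all
  hyperplanes, of these algebras inside \<open>k[V]\<close>, which is the algebra of quasi-invariants; taking
  classes of degree 0 elements is the equivariant quasi-isomorphism.

  The absence of torsion in \<open>M\<close> is read off from the lifting property, without a description of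
  cofibrations as retracts of semi-free extensions.
\<close>

section \<open>Graded components in a dg algebra\<close>

text \<open>Joins and homotopy limits are specified only up to choices, so the argument has to hold
  for every admissible \<open>M'\<close>, \<open>Z\<close>, \<open>N'\<close> and fibrant diagram.
  Lifting and universal properties are tested only against algebras with underlying type
  \<open>'u\<close>; every auxiliary algebra must therefore be realised inside \<open>'u\<close>,
  which is possible because \<open>'u\<close> contains a copy of the infinite ground field.

  The invariants \<open>S\<close> are polynomials in \<open>x = \<alpha>^2\<close> with coefficients
  pulled back from the hyperplane. Hence there is a substitution \<open>x -> x + Y\<close> from
  \<open>S\<close> to \<open>S[Y]\<close>, and the torsion argument rests on it. Next, an invariant
  divisible by \<open>x\<close> in \<open>k[V]\<close> vanishes on \<open>H\<close>, so
  \<open>k[H]\<close> embeds into \<open>Q_j/xQ_j\<close>; this is why the join has its degree 0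
  cohomology inside \<open>Q_j\<close>. Fibrations are surjective in negative degrees only and all
  algebras live in non-positive degrees, so the cokernel of the Mayer-Vietoris map in degree 0
  produces no class in degree 1.

  Equivariance follows from uniqueness: the comparison map is determined by the component at the
  trivial subgroup, which conjugation fixes.\<close>

lemma (in abelian_group) hom_finsum_into:
  assumes f: "finite F" "\<And>n. n \<in> F \<Longrightarrow> f n \<in> carrier G"
    and B: "abelian_group B"
    and h: "\<And>x. x \<in> carrier G \<Longrightarrow> h x \<in> carrier B" "h \<zero> = \<zero>\<^bsub>B\<^esub>"
      "\<And>x y. x \<in> carrier G \<Longrightarrow> y \<in> carrier G \<Longrightarrow> h (x \<oplus> y) = h x \<oplus>\<^bsub>B\<^esub> h y"
  shows "h (finsum G f F) = finsum B (\<lambda>n. h (f n)) F"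
  using f
proof (induction F rule: finite_induct)
  case empty
  interpret B: abelian_group B by fact
  show ?case using h(2) by simp
next
  case (insert a F)
  interpret B: abelian_group B by fact
  have "finsum G f F \<in> carrier G" using insert by (intro finsum_closed) auto
  then show ?case using insert h by (simp add: Pi_def)
qed

text \<open>Projections \<open>pr n\<close> are easier to supply than decompositions: applied to a
  finite sum of homogeneous elements, \<open>pr m\<close> returns the summand of degree
  \<open>m\<close>, which forces uniqueness. For existence, \<open>x\<close> minus the sum of its
  \<open>pr n x\<close> is killed by all projections, so \<open>pr_ext\<close> makes it
  zero.\<close>

lemma (in abelian_group) graded_decomposition:
  fixes pr :: "int \<Rightarrow> 'a \<Rightarrow> 'a"
  assumes sub: "\<And>n. additive_subgroup (H n) G"
    and pr_in: "\<And>n x. x \<in> carrier G \<Longrightarrow> pr n x \<in> H n"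
    and pr_add: "\<And>n x y. x \<in> carrier G \<Longrightarrow> y \<in> carrier G \<Longrightarrow> pr n (x \<oplus> y) = pr n x \<oplus> pr n y"
    and pr_hom: "\<And>n m x. x \<in> H m \<Longrightarrow> pr n x = (if n = m then x else \<zero>)"
    and pr_fin: "\<And>x. x \<in> carrier G \<Longrightarrow> finite {n. pr n x \<noteq> \<zero>}"
    and pr_ext: "\<And>x. x \<in> carrier G \<Longrightarrow> (\<And>n. pr n x = \<zero>) \<Longrightarrow> x = \<zero>"
    and x: "x \<in> carrier G"
  shows "\<exists>!f. (\<forall>n. f n \<in> H n) \<and> finite {n. f n \<noteq> \<zero>} \<and> x = finsum G f {n. f n \<noteq> \<zero>}"
proof -
  have Hc: "y \<in> H n \<Longrightarrow> y \<in> carrier G" for y n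
    using additive_subgroup.a_Hcarr[OF sub] by blast
  have zH: "\<zero> \<in> H n" for n
    using additive_subgroup.zero_closed[OF sub] by blast
  have pr_zero: "pr n \<zero> = \<zero>" for n
    using pr_hom[OF zH[of n], of n] by simp
  have pr_sum: "pr m (finsum G f F) = (if m \<in> F then f m else \<zero>)"
    if F: "finite F" "\<And>n. f n \<in> H n" for f F m
  proof -
    have "pr m (finsum G f F) = finsum G (\<lambda>n. pr m (f n)) F"
      using F Hc[OF pr_in] Hc[OF F(2)] pr_zero pr_add abelian_group_axioms
      by (intro hom_finsum_into) auto
    also have "\<dots> = finsum G (\<lambda>n. if m = n then f n else \<zero>) F"
      using F Hc[OF F(2)] by (intro finsum_cong') (auto simp: pr_hom)
    also have "\<dots> = (if m \<in> F then f m else \<zero>)"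
    proof (cases "m \<in> F")
      case True
      then show ?thesis
        using add.finprod_singleton[of m F f] F Hc by (auto simp: Pi_def)
    next
      case False
      then have "finsum G (\<lambda>n. if m = n then f n else \<zero>) F = finsum G (\<lambda>n. \<zero>) F"
        by (intro finsum_cong') auto
      with False show ?thesis by simp
    qed
    finally show ?thesis .
  qed
  show ?thesis
  proof (rule ex1I[of _ "\<lambda>n. pr n x"], intro conjI allI)
    let ?S = "{n. pr n x \<noteq> \<zero>}" and ?y = "finsum G (\<lambda>n. pr n x) {n. pr n x \<noteq> \<zero>}"
    have yc: "?y \<in> carrier G"
      using Hc pr_in x by (intro finsum_closed) auto
    have py: "pr m ?y = pr m x" for m
      using pr_sum[of ?S "\<lambda>n. pr n x" m] pr_fin[OF x] pr_in[OF x] by auto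
    have "pr m (x \<ominus> ?y) = \<zero>" for m
    proof -
      have "pr m (x \<ominus> ?y) \<oplus> pr m ?y = pr m x"
        using pr_add[of "x \<ominus> ?y" ?y m] x yc by (simp add: a_minus_def a_assoc l_neg)
      moreover have "pr m (x \<ominus> ?y) \<in> carrier G" "pr m ?y \<in> carrier G"
        using Hc[OF pr_in] x yc by auto
      ultimately show ?thesis using py[of m] by simp
    qed
    then have "x \<ominus> ?y = \<zero>" using pr_ext[of "x \<ominus> ?y"] x yc by simp
    then show "x = ?y" using x yc minus_equality[of x "\<ominus> ?y"] by (simp add: a_minus_def)
  next
    fix f assume f: "(\<forall>n. f n \<in> H n) \<and> finite {n. f n \<noteq> \<zero>} \<and> x = finsum G f {n. f n \<noteq> \<zero>}"
    show "f = (\<lambda>n. pr n x)"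
    proof
      fix n show "f n = pr n x" using f pr_sum[of "{n. f n \<noteq> \<zero>}" f n] by auto
    qed
  qed (use pr_in pr_fin x in auto)
qed

text \<open>The interface through which quotients, Koszul and polynomial extensions and function
  algebras are shown to be dg algebras: \<open>hpart_decomp\<close> is traded for a family of
  projections, and the module laws over the scalar field are listed in plain form.\<close>

lemma cdgaI:
  fixes A :: "('k::field_char_0, 'a) dg_alg" (structure) and pr :: "int \<Rightarrow> 'a \<Rightarrow> 'a"
  assumes "ring A"
    and "\<And>c x. x \<in> carrier A \<Longrightarrow> c \<odot> x \<in> carrier A"
    and "\<And>b c x. x \<in> carrier A \<Longrightarrow> (b + c) \<odot> x = b \<odot> x \<oplus> c \<odot> x"
    and "\<And>c x y. x \<in> carrier A \<Longrightarrow> y \<in> carrier A \<Longrightarrow> c \<odot> (x \<oplus> y) = c \<odot> x \<oplus> c \<odot> y"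
    and "\<And>b c x. x \<in> carrier A \<Longrightarrow> (b * c) \<odot> x = b \<odot> (c \<odot> x)"
    and "\<And>x. x \<in> carrier A \<Longrightarrow> 1 \<odot> x = x"
    and "\<And>c x y. \<lbrakk>x \<in> carrier A; y \<in> carrier A\<rbrakk> \<Longrightarrow> (c \<odot> x) \<otimes> y = c \<odot> (x \<otimes> y)"
    and "\<And>c x y. \<lbrakk>x \<in> carrier A; y \<in> carrier A\<rbrakk> \<Longrightarrow> x \<otimes> (c \<odot> y) = c \<odot> (x \<otimes> y)"
    and "\<And>n. additive_subgroup (hpart A n) A"
    and "\<And>n c x. x \<in> hpart A n \<Longrightarrow> c \<odot> x \<in> hpart A n"
    and "\<And>n x. x \<in> carrier A \<Longrightarrow> pr n x \<in> hpart A n"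
    and "\<And>n x y. x \<in> carrier A \<Longrightarrow> y \<in> carrier A \<Longrightarrow> pr n (x \<oplus> y) = pr n x \<oplus> pr n y"
    and "\<And>n m x. x \<in> hpart A m \<Longrightarrow> pr n x = (if n = m then x else \<zero>)"
    and "\<And>x. x \<in> carrier A \<Longrightarrow> finite {n. pr n x \<noteq> \<zero>}"
    and "\<And>x. x \<in> carrier A \<Longrightarrow> (\<And>n. pr n x = \<zero>) \<Longrightarrow> x = \<zero>"
    and "\<And>n. n > 0 \<Longrightarrow> hpart A n = {\<zero>}"
    and "\<one> \<in> hpart A 0"
    and "\<And>x y m n. \<lbrakk>x \<in> hpart A m; y \<in> hpart A n\<rbrakk> \<Longrightarrow> x \<otimes> y \<in> hpart A (m + n)"
    and "\<And>x y m n. \<lbrakk>x \<in> hpart A m; y \<in> hpart A n\<rbrakk> \<Longrightarrow>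
        x \<otimes> y = (if odd m \<and> odd n then \<ominus> (y \<otimes> x) else y \<otimes> x)"
    and "\<And>x n. x \<in> hpart A n \<Longrightarrow> dif A x \<in> hpart A (n + 1)"
    and "\<And>x y. \<lbrakk>x \<in> carrier A; y \<in> carrier A\<rbrakk> \<Longrightarrow> dif A (x \<oplus> y) = dif A x \<oplus> dif A y"
    and "\<And>c x. x \<in> carrier A \<Longrightarrow> dif A (c \<odot> x) = c \<odot> dif A x"
    and "\<And>x. x \<in> carrier A \<Longrightarrow> dif A (dif A x) = \<zero>"
    and "\<And>x y m n. \<lbrakk>x \<in> hpart A m; y \<in> hpart A n\<rbrakk> \<Longrightarrow>
        dif A (x \<otimes> y) =
          dif A x \<otimes> y \<oplus> (if odd m then \<ominus> (x \<otimes> dif A y) else x \<otimes> dif A y)"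
  shows "cdga A"
proof -
  interpret A: ring A by fact
  have "module ring_of_type_algebra A"
    by (rule moduleI[OF cring_from_type_algebra A.abelian_group_axioms])
      (auto simp: ring_of_type_algebra_def assms)
  then show ?thesis
    using A.graded_decomposition[of "hpart A" pr] assms
    by (intro cdga.intro cdga_axioms.intro) auto
qed

text \<open>Within the locale \<open>cdga\<close> the short names of ring facts refer to the scalars; here they refer to
  the dg algebra.\<close>

locale cdg = ring A for A :: "('k::field_char_0, 'a) dg_alg" (structure) +
  assumes cdga: "cdga A"
begin

lemmas smult_mult_left = cdga.smult_mult_left[OF cdga]
  and smult_mult_right = cdga.smult_mult_right[OF cdga]
  and hpart_subgroup = cdga.hpart_subgroup[OF cdga]
  and hpart_smult = cdga.hpart_smult[OF cdga]
  and hpart_decomp = cdga.hpart_decomp[OF cdga]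
  and hpart_nonpos = cdga.hpart_nonpos[OF cdga]
  and hpart_one = cdga.hpart_one[OF cdga]
  and hpart_mult = cdga.hpart_mult[OF cdga]
  and graded_comm = cdga.graded_comm[OF cdga]
  and dif_hpart = cdga.dif_hpart[OF cdga]
  and dif_add = cdga.dif_add[OF cdga]
  and dif_smult = cdga.dif_smult[OF cdga]
  and dif_dif = cdga.dif_dif[OF cdga]
  and leibniz = cdga.leibniz[OF cdga]

lemma module: "module ring_of_type_algebra A"
  using cdga by (simp add: cdga_def)

definition comp :: "int \<Rightarrow> 'a \<Rightarrow> 'a" where
  "comp n x = (THE f. (\<forall>n. f n \<in> hpart A n) \<and> finite {n. f n \<noteq> \<zero>} \<and>
             x = finsum A f {n. f n \<noteq> \<zero>}) n"

lemma hpart_carrier: "x \<in> hpart A n \<Longrightarrow> x \<in> carrier A"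
  using additive_subgroup.a_Hcarr[OF hpart_subgroup] by blast

lemma hpart_zero [simp]: "\<zero> \<in> hpart A n"
  using additive_subgroup.zero_closed[OF hpart_subgroup] by blast

lemma hpart_add: "x \<in> hpart A n \<Longrightarrow> y \<in> hpart A n \<Longrightarrow> x \<oplus> y \<in> hpart A n"
  using additive_subgroup.a_closed[OF hpart_subgroup] by blast

lemma hpart_neg: "x \<in> hpart A n \<Longrightarrow> \<ominus> x \<in> hpart A n"
  using additive_subgroup.a_inv_closed[OF hpart_subgroup] by blast

lemma hpart_minus: "x \<in> hpart A n \<Longrightarrow> y \<in> hpart A n \<Longrightarrow> x \<ominus> y \<in> hpart A n"
  by (simp add: a_minus_def hpart_add hpart_neg)

lemma hpart_pos: "x \<in> hpart A n \<Longrightarrow> n > 0 \<Longrightarrow> x = \<zero>"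
  using hpart_nonpos by blast

lemma comp_props:
  assumes "x \<in> carrier A"
  shows "comp n x \<in> hpart A n" "finite {n. comp n x \<noteq> \<zero>}"
    "x = finsum A (\<lambda>n. comp n x) {n. comp n x \<noteq> \<zero>}"
proof -
  have "(\<forall>n. comp n x \<in> hpart A n) \<and> finite {n. comp n x \<noteq> \<zero>} \<and>
             x = finsum A (\<lambda>n. comp n x) {n. comp n x \<noteq> \<zero>}"
    unfolding comp_def by (rule theI'[OF hpart_decomp[OF assms]])
  then show "comp n x \<in> hpart A n" "finite {n. comp n x \<noteq> \<zero>}"
    "x = finsum A (\<lambda>n. comp n x) {n. comp n x \<noteq> \<zero>}" by blast+
qed

lemma comp_carrier [simp]: "x \<in> carrier A \<Longrightarrow> comp n x \<in> carrier A"
  using comp_props(1) hpart_carrier by blast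

lemma finsum_hpart:
  "finite F \<Longrightarrow> (\<And>i. i \<in> F \<Longrightarrow> f i \<in> hpart A n) \<Longrightarrow> finsum A f F \<in> hpart A n"
proof (induction F rule: finite_induct)
  case (insert a F)
  have "f i \<in> carrier A" if "i \<in> insert a F" for i
    using that insert.prems hpart_carrier by blast
  then show ?case using insert hpart_add by (subst finsum_insert) auto
qed simp

lemma comp_eqI:
  assumes "finite F" "\<And>n. f n \<in> hpart A n" "x = finsum A f F" "\<And>n. n \<notin> F \<Longrightarrow> f n = \<zero>"
  shows "comp n x = f n"
proof -
  have c: "f n \<in> carrier A" for n using assms hpart_carrier by blast
  have fin: "finite {n. f n \<noteq> \<zero>}" by (rule finite_subset[OF _ assms(1)]) (use assms in auto)
  have "finsum A f F = finsum A f {n. f n \<noteq> \<zero>}"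
    by (rule add.finprod_mono_neutral_cong_right) (use assms c in auto)
  then have *: "(\<forall>n. f n \<in> hpart A n) \<and> finite {n. f n \<noteq> \<zero>} \<and> x = finsum A f {n. f n \<noteq> \<zero>}"
    using assms fin by simp
  have "x \<in> carrier A" using assms c by auto
  then show ?thesis unfolding comp_def
    using the1_equality[OF hpart_decomp, OF _ *] by simp
qed

lemma finsum_comp:
  assumes "x \<in> carrier A" "finite F" "{n. comp n x \<noteq> \<zero>} \<subseteq> F"
  shows "x = finsum A (\<lambda>n. comp n x) F"
proof -
  have "finsum A (\<lambda>n. comp n x) F = finsum A (\<lambda>n. comp n x) {n. comp n x \<noteq> \<zero>}"
    by (rule add.finprod_mono_neutral_cong_right) (use assms in auto)
  then show ?thesis using comp_props(3)[OF assms(1)] by simp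
qed

lemma comp_add:
  assumes x: "x \<in> carrier A" and y: "y \<in> carrier A"
  shows "comp n (x \<oplus> y) = comp n x \<oplus> comp n y"
proof -
  let ?F = "{n. comp n x \<noteq> \<zero>} \<union> {n. comp n y \<noteq> \<zero>}"
  have F: "finite ?F" using comp_props(2) assms by simp
  show ?thesis
  proof (rule comp_eqI[OF F])
    have "x \<oplus> y = finsum A (\<lambda>n. comp n x) ?F \<oplus> finsum A (\<lambda>n. comp n y) ?F"
      using finsum_comp[OF x F] finsum_comp[OF y F] by auto
    also have "\<dots> = finsum A (\<lambda>n. comp n x \<oplus> comp n y) ?F"
      using assms by (subst finsum_addf) auto
    finally show "x \<oplus> y = finsum A (\<lambda>n. comp n x \<oplus> comp n y) ?F" .
  qed (use assms comp_props hpart_add in auto)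
qed

lemma comp_hpart:
  assumes "x \<in> hpart A m"
  shows "comp n x = (if n = m then x else \<zero>)"
  by (rule comp_eqI[of "{m}"]) (use assms hpart_carrier in auto)

lemma comp_zero [simp]: "comp n \<zero> = \<zero>"
  using comp_hpart[of \<zero> n n] by simp

lemma comp_neg: "x \<in> carrier A \<Longrightarrow> comp n (\<ominus> x) = \<ominus> comp n x"
  using comp_add[of x "\<ominus> x" n] by (metis a_inv_closed comp_carrier comp_zero minus_equality
    add.inv_comm r_neg a_comm)

lemma comp_ext:
  assumes "x \<in> carrier A" "y \<in> carrier A" "\<And>n. comp n x = comp n y"
  shows "x = y"
  using comp_props(3)[OF assms(1)] comp_props(3)[OF assms(2)] assms(3) by simp

text \<open>The sign rules are available only for homogeneous elements; identities that are additive
  in each argument extend from them to the whole algebra by this induction.\<close>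

lemma homogeneous_induct [consumes 1, case_names zero add homogeneous]:
  assumes x: "x \<in> carrier A" and zero: "P \<zero>"
    and add: "\<And>x y. x \<in> carrier A \<Longrightarrow> y \<in> carrier A \<Longrightarrow> P x \<Longrightarrow> P y \<Longrightarrow> P (x \<oplus> y)"
    and hom: "\<And>x n. x \<in> hpart A n \<Longrightarrow> P x"
  shows "P x"
proof -
  have "finite F \<Longrightarrow> P (finsum A (\<lambda>n. comp n x) F)" for F
  proof (induction F rule: finite_induct)
    case (insert a F)
    then show ?case
      using x comp_props(1) by (subst finsum_insert) (auto intro!: add intro: hom)
  qed (use zero in simp)
  then show ?thesis using comp_props(2,3)[OF x] by metis
qed

lemma smult_carrier [simp]: "x \<in> carrier A \<Longrightarrow> c \<odot> x \<in> carrier A"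
  using module.smult_closed[OF module, of c x] by (simp add: ring_of_type_algebra_def)

lemma smult_plus: "x \<in> carrier A \<Longrightarrow> (b + c) \<odot> x = b \<odot> x \<oplus> c \<odot> x"
  using module.smult_l_distr[OF module, of b c x] by (simp add: ring_of_type_algebra_def)

lemma smult_add: "x \<in> carrier A \<Longrightarrow> y \<in> carrier A \<Longrightarrow> c \<odot> (x \<oplus> y) = c \<odot> x \<oplus> c \<odot> y"
  using module.smult_r_distr[OF module, of c x y] by (simp add: ring_of_type_algebra_def)

lemma smult_times: "x \<in> carrier A \<Longrightarrow> (b * c) \<odot> x = b \<odot> (c \<odot> x)"
  using module.smult_assoc1[OF module, of b c x] by (simp add: ring_of_type_algebra_def)

lemma smult_1 [simp]: "x \<in> carrier A \<Longrightarrow> 1 \<odot> x = x"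
  using module.smult_one[OF module, of x] by (simp add: ring_of_type_algebra_def)

lemma smult_zero_right [simp]: "c \<odot> \<zero> = \<zero>"
  using smult_add[of \<zero> \<zero> c] by (metis smult_carrier add.l_cancel_one' zero_closed l_zero)

lemma smult_neg: "x \<in> carrier A \<Longrightarrow> c \<odot> (\<ominus> x) = \<ominus> (c \<odot> x)"
  by (metis a_inv_closed l_neg minus_equality smult_add smult_carrier smult_zero_right)

lemma comp_smult:
  assumes "x \<in> carrier A"
  shows "comp n (c \<odot> x) = c \<odot> comp n x"
  using assms
proof (induction x rule: homogeneous_induct)
  case (homogeneous x m)
  then show ?case using comp_hpart[OF homogeneous] comp_hpart[OF hpart_smult[OF homogeneous]] by simp
qed (auto simp: smult_add comp_add)

lemma dif_carrier [simp]: "x \<in> carrier A \<Longrightarrow> dif A x \<in> carrier A"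
proof (induction x rule: homogeneous_induct)
  case zero
  then show ?case using dif_hpart[OF hpart_zero] hpart_carrier by blast
next
  case (add x y)
  then show ?case by (simp add: dif_add)
next
  case (homogeneous x n)
  then show ?case using dif_hpart hpart_carrier by blast
qed

lemma dif_zero [simp]: "dif A \<zero> = \<zero>"
  using dif_add[of \<zero> \<zero>] by (metis dif_carrier add.l_cancel_one' zero_closed l_zero)

lemma dif_neg: "x \<in> carrier A \<Longrightarrow> dif A (\<ominus> x) = \<ominus> dif A x"
  by (metis a_inv_closed l_neg minus_equality dif_add dif_carrier dif_zero)

lemma dif_minus: "x \<in> carrier A \<Longrightarrow> y \<in> carrier A \<Longrightarrow> dif A (x \<ominus> y) = dif A x \<ominus> dif A y"
  by (simp add: a_minus_def dif_add dif_neg)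

lemma comp_dif:
  assumes "x \<in> carrier A"
  shows "comp n (dif A x) = dif A (comp (n - 1) x)"
  using assms
proof (induction x rule: homogeneous_induct)
  case (homogeneous x m)
  then show ?case using comp_hpart[OF homogeneous] comp_hpart[OF dif_hpart[OF homogeneous]] by auto
qed (auto simp: dif_add comp_add)

lemma dif_hpart_0: "x \<in> hpart A 0 \<Longrightarrow> dif A x = \<zero>"
  using dif_hpart[of x 0] hpart_pos by simp

text \<open>In a non-positive grading an element of degree 0 is a cocycle and is central, so
  multiplication by it commutes with components and with the differential. This is what makes the
  multiples of such an element a dg ideal.\<close>

lemma comp_hpart_0_mult:
  assumes a: "a \<in> hpart A 0" and x: "x \<in> carrier A"
  shows "comp n (a \<otimes> x) = a \<otimes> comp n x"
  using x
proof (induction x rule: homogeneous_induct)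
  case (homogeneous x m)
  then show ?case using comp_hpart[OF homogeneous] comp_hpart[OF hpart_mult[OF a homogeneous]]
      hpart_carrier[OF a] by auto
qed (use hpart_carrier[OF a] in \<open>auto simp: r_distr comp_add\<close>)

lemma hpart_0_comm:
  assumes a: "a \<in> hpart A 0" and x: "x \<in> carrier A"
  shows "a \<otimes> x = x \<otimes> a"
  using x
proof (induction x rule: homogeneous_induct)
  case (homogeneous x m)
  then show ?case using graded_comm[OF a homogeneous] by simp
qed (use hpart_carrier[OF a] in \<open>auto simp: r_distr l_distr\<close>)

lemma dif_hpart_0_mult:
  assumes a: "a \<in> hpart A 0" and x: "x \<in> carrier A"
  shows "dif A (a \<otimes> x) = a \<otimes> dif A x"
  using x
proof (induction x rule: homogeneous_induct)
  case (homogeneous x m)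
  then show ?case using leibniz[OF a homogeneous] dif_hpart_0[OF a] hpart_carrier[OF a]
     hpart_carrier[OF homogeneous] by simp
qed (use hpart_carrier[OF a] in \<open>auto simp: r_distr dif_add\<close>)

text \<open>Positive degrees are empty, so a product has a degree 0 part only through the degree 0
  parts of both factors; the elements of negative degree form an ideal.\<close>

lemma comp_0_mult:
  assumes x: "x \<in> carrier A" and y: "y \<in> carrier A"
  shows "comp 0 (x \<otimes> y) = comp 0 x \<otimes> comp 0 y"
  using x
proof (induction x rule: homogeneous_induct)
  case (homogeneous x m)
  note xm = homogeneous and xc = hpart_carrier[OF homogeneous]
  show ?case using y
  proof (induction y rule: homogeneous_induct)
    case (homogeneous y n)
    note yc = hpart_carrier[OF homogeneous]
    consider "m > 0" | "n > 0" | "m = 0" "n = 0" | "m + n < 0" "m < 0 \<or> n < 0" by linarith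
    then show ?case
      using hpart_pos[OF homogeneous] hpart_pos[OF xm] xc yc comp_hpart[OF homogeneous]
        comp_hpart[OF xm] comp_hpart[OF hpart_mult[OF xm homogeneous]]
      by cases auto
  qed (use xc in \<open>auto simp: r_distr comp_add\<close>)
qed (use y in \<open>auto simp: l_distr comp_add\<close>)

end

lemma cdgI: "cdga A \<Longrightarrow> cdg A"
  by (simp add: cdga_def cdg_def cdg_axioms_def)

lemma dg_homI:
  assumes "\<And>x. x \<in> carrier A \<Longrightarrow> f x \<in> carrier B"
    and "\<And>x y. x \<in> carrier A \<Longrightarrow> y \<in> carrier A \<Longrightarrow> f (x \<otimes>\<^bsub>A\<^esub> y) = f x \<otimes>\<^bsub>B\<^esub> f y"
    and "\<And>x y. x \<in> carrier A \<Longrightarrow> y \<in> carrier A \<Longrightarrow> f (x \<oplus>\<^bsub>A\<^esub> y) = f x \<oplus>\<^bsub>B\<^esub> f y"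
    and "f \<one>\<^bsub>A\<^esub> = \<one>\<^bsub>B\<^esub>"
    and "\<And>c x. x \<in> carrier A \<Longrightarrow> f (c \<odot>\<^bsub>A\<^esub> x) = c \<odot>\<^bsub>B\<^esub> f x"
    and "\<And>n x. x \<in> hpart A n \<Longrightarrow> f x \<in> hpart B n"
    and "\<And>x. x \<in> carrier A \<Longrightarrow> f (dif A x) = dif B (f x)"
  shows "f \<in> dg_hom A B"
  using assms by (auto simp: dg_hom_def intro: ring_hom_memI)

lemma dg_homD:
  assumes "f \<in> dg_hom A B"
  shows "\<And>x. x \<in> carrier A \<Longrightarrow> f x \<in> carrier B"
    and "\<And>x y. x \<in> carrier A \<Longrightarrow> y \<in> carrier A \<Longrightarrow> f (x \<otimes>\<^bsub>A\<^esub> y) = f x \<otimes>\<^bsub>B\<^esub> f y"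
    and "\<And>x y. x \<in> carrier A \<Longrightarrow> y \<in> carrier A \<Longrightarrow> f (x \<oplus>\<^bsub>A\<^esub> y) = f x \<oplus>\<^bsub>B\<^esub> f y"
    and "f \<one>\<^bsub>A\<^esub> = \<one>\<^bsub>B\<^esub>"
    and "\<And>c x. x \<in> carrier A \<Longrightarrow> f (c \<odot>\<^bsub>A\<^esub> x) = c \<odot>\<^bsub>B\<^esub> f x"
    and "\<And>n x. x \<in> hpart A n \<Longrightarrow> f x \<in> hpart B n"
    and "\<And>x. x \<in> carrier A \<Longrightarrow> f (dif A x) = dif B (f x)"
  using assms by (auto simp: dg_hom_def ring_hom_def image_subset_iff)

lemma dg_hom_compose:
  assumes "f \<in> dg_hom A B" "g \<in> dg_hom B C"
  shows "(\<lambda>x. g (f x)) \<in> dg_hom A C"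
  by (rule dg_homI) (use dg_homD[OF assms(1)] dg_homD[OF assms(2)] in auto)

lemma dg_hom_cong:
  assumes A: "cdga A" and f: "f \<in> dg_hom A B" and g: "\<And>x. x \<in> carrier A \<Longrightarrow> g x = f x"
  shows "g \<in> dg_hom A B"
proof -
  interpret A: cdg A by (rule cdgI[OF A])
  show ?thesis
    by (rule dg_homI) (use dg_homD[OF f] g A.hpart_carrier in auto)
qed

lemma dg_hom_id: "(\<lambda>x. x) \<in> dg_hom A A"
  by (rule dg_homI) auto

lemma dg_hom_zero:
  assumes A: "cdga A" and B: "cdga B" and f: "f \<in> dg_hom A B"
  shows "f \<zero>\<^bsub>A\<^esub> = \<zero>\<^bsub>B\<^esub>"
proof -
  interpret A: cdg A by (rule cdgI[OF A])
  interpret B: cdg B by (rule cdgI[OF B])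
  have "f \<zero>\<^bsub>A\<^esub> \<oplus>\<^bsub>B\<^esub> f \<zero>\<^bsub>A\<^esub> = f \<zero>\<^bsub>A\<^esub>"
    using dg_homD(3)[OF f, of "\<zero>\<^bsub>A\<^esub>" "\<zero>\<^bsub>A\<^esub>"] by simp
  then show ?thesis using dg_homD(1)[OF f A.zero_closed] by simp
qed

lemma dg_hom_neg:
  assumes A: "cdga A" and B: "cdga B" and f: "f \<in> dg_hom A B" and x: "x \<in> carrier A"
  shows "f (\<ominus>\<^bsub>A\<^esub> x) = \<ominus>\<^bsub>B\<^esub> f x"
proof -
  interpret A: cdg A by (rule cdgI[OF A])
  interpret B: cdg B by (rule cdgI[OF B])
  have "f (\<ominus>\<^bsub>A\<^esub> x) \<oplus>\<^bsub>B\<^esub> f x = \<zero>\<^bsub>B\<^esub>"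
    using dg_homD(3)[OF f, of "\<ominus>\<^bsub>A\<^esub> x" x] x dg_hom_zero[OF A B f] by (simp add: A.l_neg)
  then show ?thesis using dg_homD(1)[OF f] x B.minus_equality by simp
qed

lemma dg_hom_minus:
  assumes A: "cdga A" and B: "cdga B" and f: "f \<in> dg_hom A B"
    and "x \<in> carrier A" "y \<in> carrier A"
  shows "f (x \<ominus>\<^bsub>A\<^esub> y) = f x \<ominus>\<^bsub>B\<^esub> f y"
proof -
  interpret A: cdg A by (rule cdgI[OF A])
  show ?thesis
    using assms dg_homD(3)[OF f] dg_hom_neg[OF A B f] by (simp add: a_minus_def)
qed

lemma dg_hom_comp:
  assumes A: "cdga A" and B: "cdga B" and f: "f \<in> dg_hom A B" and x: "x \<in> carrier A"
  shows "cdg.comp B n (f x) = f (cdg.comp A n x)"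
proof -
  interpret A: cdg A by (rule cdgI[OF A])
  interpret B: cdg B by (rule cdgI[OF B])
  show ?thesis using x
  proof (induction x rule: A.homogeneous_induct)
    case (homogeneous x m)
    then show ?case
      using A.comp_hpart[OF homogeneous] B.comp_hpart[OF dg_homD(6)[OF f homogeneous]]
        dg_hom_zero[OF A B f] by simp
  qed (simp_all add: dg_hom_zero[OF A B f] dg_homD(1,3)[OF f] A.comp_add B.comp_add)
qed

section \<open>Cocycles, boundaries and quasi-isomorphisms on elements\<close>

definition boundaries :: "('k, 'a) dg_alg \<Rightarrow> int \<Rightarrow> 'a set" where
  "boundaries A n = dif A ` hpart A (n - 1)"

lemma dg_hom_boundaries:
  assumes "cdga A" "f \<in> dg_hom A B" "x \<in> boundaries A n"
  shows "f x \<in> boundaries B n"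
proof -
  interpret A: cdg A by (rule cdgI) fact
  show ?thesis using assms dg_homD(6,7)[OF assms(2)] A.hpart_carrier
    by (auto simp: boundaries_def)
qed

lemma dg_hom_cocycles:
  assumes "cdga A" "cdga B" "f \<in> dg_hom A B" "x \<in> cocycles A n"
  shows "f x \<in> cocycles B n"
proof -
  interpret A: cdg A by (rule cdgI) fact
  show ?thesis using assms dg_homD(6)[OF assms(3)] dg_homD(7)[OF assms(3), of x]
      A.hpart_carrier dg_hom_zero[OF assms(1-3)]
    by (auto simp: cocycles_def)
qed

context cdg
begin

lemma cocycles_carrier: "x \<in> cocycles A n \<Longrightarrow> x \<in> carrier A"
  using hpart_carrier by (auto simp: cocycles_def)

lemma boundaries_carrier: "x \<in> boundaries A n \<Longrightarrow> x \<in> carrier A"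
  using hpart_carrier by (auto simp: boundaries_def)

lemma zero_boundaries: "\<zero> \<in> boundaries A n"
  unfolding boundaries_def by (rule image_eqI[of _ _ \<zero>]) auto

lemma boundaries_add: "x \<in> boundaries A n \<Longrightarrow> y \<in> boundaries A n \<Longrightarrow> x \<oplus> y \<in> boundaries A n"
  unfolding boundaries_def using hpart_add hpart_carrier
  by (auto simp: dif_add[symmetric])

lemma boundaries_neg: "x \<in> boundaries A n \<Longrightarrow> \<ominus> x \<in> boundaries A n"
  unfolding boundaries_def using hpart_neg hpart_carrier
  by (auto simp: dif_neg[symmetric])

lemma boundaries_minus:
  "x \<in> boundaries A n \<Longrightarrow> y \<in> boundaries A n \<Longrightarrow> x \<ominus> y \<in> boundaries A n"
  by (simp add: a_minus_def boundaries_add boundaries_neg)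

lemma cocycles_minus:
  "x \<in> cocycles A n \<Longrightarrow> y \<in> cocycles A n \<Longrightarrow> x \<ominus> y \<in> cocycles A n"
  unfolding cocycles_def using hpart_minus hpart_carrier by (auto simp: dif_minus)

lemma hpart_0_cocycles: "x \<in> hpart A 0 \<Longrightarrow> x \<in> cocycles A 0"
  by (simp add: cocycles_def dif_hpart_0)

lemma coh_class_eq_iff:
  assumes x: "x \<in> carrier A" and y: "y \<in> carrier A"
  shows "coh_class A n x = coh_class A n y \<longleftrightarrow> x \<ominus> y \<in> boundaries A n"
proof
  assume eq: "coh_class A n x = coh_class A n y"
  have "x \<in> coh_class A n x"
    unfolding coh_class_def using x by (intro CollectI exI[of _ \<zero>]) auto
  then have "x \<in> coh_class A n y" using eq by simp
  then obtain z where z: "z \<in> hpart A (n - 1)" "x = y \<oplus> dif A z"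
    by (auto simp: coh_class_def)
  then have "x \<ominus> y = dif A z"
    using y hpart_carrier[OF z(1)] by (simp add: a_minus_def a_comm[of y] a_assoc r_neg)
  then show "x \<ominus> y \<in> boundaries A n" using z by (simp add: boundaries_def)
next
  assume "x \<ominus> y \<in> boundaries A n"
  then obtain z where z: "z \<in> hpart A (n - 1)" "x \<ominus> y = dif A z"
    by (auto simp: boundaries_def)
  have zc: "z \<in> carrier A" using z hpart_carrier by blast
  have x_eq: "x = y \<oplus> dif A z"
    unfolding z(2)[symmetric] using x y by (simp add: a_minus_def a_comm[of x] a_assoc[symmetric] r_neg)
  show "coh_class A n x = coh_class A n y"
  proof (intro subset_antisym subsetI)
    fix u assume "u \<in> coh_class A n x"
    then obtain v where v: "v \<in> hpart A (n - 1)" "u = x \<oplus> dif A v" by (auto simp: coh_class_def)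
    have "v \<in> carrier A" using v hpart_carrier by blast
    then have "u = y \<oplus> dif A (z \<oplus> v)" using v x_eq y zc by (simp add: dif_add a_assoc)
    then show "u \<in> coh_class A n y" using hpart_add[OF z(1) v(1)] by (auto simp: coh_class_def)
  next
    fix u assume "u \<in> coh_class A n y"
    then obtain v where v: "v \<in> hpart A (n - 1)" "u = y \<oplus> dif A v" by (auto simp: coh_class_def)
    have vc: "v \<in> carrier A" using v hpart_carrier by blast
    have "x \<oplus> dif A (v \<ominus> z) = y \<oplus> (dif A z \<oplus> (dif A v \<ominus> dif A z))"
      using x_eq y zc vc by (simp add: dif_minus a_assoc)
    also have "dif A z \<oplus> (dif A v \<ominus> dif A z) = dif A v"
      using zc vc by (simp add: a_minus_def a_lcomm r_neg)
    finally have "u = x \<oplus> dif A (v \<ominus> z)" using v(2) by simp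
    then show "u \<in> coh_class A n x" using hpart_minus[OF v(1) z(1)]
      unfolding coh_class_def by blast
  qed
qed

end

text \<open>\<open>coh_map\<close> is a union over all representatives; each of them contributes the
  same class, and the union of a nonempty constant family is that class.\<close>

lemma coh_map_coh_class:
  assumes A: "cdga A" and B: "cdga B" and f: "f \<in> dg_hom A B" and x: "x \<in> carrier A"
  shows "coh_map f B n (coh_class A n x) = coh_class B n (f x)"
proof -
  interpret A: cdg A by (rule cdgI[OF A])
  interpret B: cdg B by (rule cdgI[OF B])
  have "coh_class B n (f u) = coh_class B n (f x)" if u: "u \<in> coh_class A n x" for u
  proof -
    obtain y where y: "y \<in> hpart A (n - 1)" "u = x \<oplus>\<^bsub>A\<^esub> dif A y"
      using u by (auto simp: coh_class_def)
    have yc: "y \<in> carrier A" using y A.hpart_carrier by blast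
    have fc: "f x \<in> carrier B" "dif B (f y) \<in> carrier B"
      using dg_homD(1)[OF f] x yc by auto
    have "f u = f x \<oplus>\<^bsub>B\<^esub> dif B (f y)" using y x yc dg_homD(3,7)[OF f] by simp
    then have "f u \<ominus>\<^bsub>B\<^esub> f x = dif B (f y)"
      using fc by (simp add: a_minus_def B.a_comm[of "f x"] B.a_assoc B.r_neg)
    moreover have "f y \<in> hpart B (n - 1)" using dg_homD(6)[OF f] y by blast
    ultimately show ?thesis
      using \<open>f u = _\<close> fc by (subst B.coh_class_eq_iff) (auto simp: boundaries_def)
  qed
  moreover have "x \<in> coh_class A n x"
    unfolding coh_class_def using x by (intro CollectI exI[of _ "\<zero>\<^bsub>A\<^esub>"]) auto
  ultimately show ?thesis unfolding coh_map_def by (intro SUP_eq_const) blast+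
qed

text \<open>Injectivity and surjectivity on cohomology, freed of classes: every quasi-isomorphism
  below is proved and used in this form.\<close>

lemma quasi_iso_iff:
  assumes A: "cdga A" and B: "cdga B" and f: "f \<in> dg_hom A B"
  shows "quasi_iso A B f \<longleftrightarrow>
    (\<forall>n. \<forall>x\<in>cocycles A n. f x \<in> boundaries B n \<longrightarrow> x \<in> boundaries A n) \<and>
    (\<forall>n. \<forall>y\<in>cocycles B n. \<exists>x\<in>cocycles A n. y \<ominus>\<^bsub>B\<^esub> f x \<in> boundaries B n)"
proof -
  interpret A: cdg A by (rule cdgI[OF A])
  interpret B: cdg B by (rule cdgI[OF B])
  note fz = dg_hom_cocycles[OF A B f] and fm = dg_hom_minus[OF A B f]
  have "inj_on (coh_map f B n) (cohomology A n) \<longleftrightarrow>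
      (\<forall>x\<in>cocycles A n. f x \<in> boundaries B n \<longrightarrow> x \<in> boundaries A n)" for n
  proof -
    have "inj_on (coh_map f B n) (cohomology A n) \<longleftrightarrow>
      (\<forall>x\<in>cocycles A n. \<forall>y\<in>cocycles A n. coh_class B n (f x) = coh_class B n (f y) \<longrightarrow>
         coh_class A n x = coh_class A n y)"
      unfolding inj_on_def cohomology_def
      using coh_map_coh_class[OF A B f A.cocycles_carrier] by auto
    also have "\<dots> \<longleftrightarrow> (\<forall>x\<in>cocycles A n. \<forall>y\<in>cocycles A n.
        f (x \<ominus>\<^bsub>A\<^esub> y) \<in> boundaries B n \<longrightarrow> x \<ominus>\<^bsub>A\<^esub> y \<in> boundaries A n)"
      using A.cocycles_carrier dg_homD(1)[OF f]
      by (auto simp: A.coh_class_eq_iff B.coh_class_eq_iff fm)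
    \<comment> \<open>Cocycles are closed under differences, so comparing two of them amounts to
      comparing one with zero.\<close>
    also have "\<dots> \<longleftrightarrow> (\<forall>x\<in>cocycles A n. f x \<in> boundaries B n \<longrightarrow> x \<in> boundaries A n)"
    proof (intro iffI ballI impI)
      fix x assume *: "\<forall>x\<in>cocycles A n. \<forall>y\<in>cocycles A n.
        f (x \<ominus>\<^bsub>A\<^esub> y) \<in> boundaries B n \<longrightarrow> x \<ominus>\<^bsub>A\<^esub> y \<in> boundaries A n"
        and x: "x \<in> cocycles A n" "f x \<in> boundaries B n"
      have "\<zero>\<^bsub>A\<^esub> \<in> cocycles A n" by (simp add: cocycles_def)
      with * x have "f (x \<ominus>\<^bsub>A\<^esub> \<zero>\<^bsub>A\<^esub>) \<in> boundaries B n \<longrightarrow> x \<ominus>\<^bsub>A\<^esub> \<zero>\<^bsub>A\<^esub> \<in> boundaries A n" by blast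
      then show "x \<in> boundaries A n" using x A.cocycles_carrier by (simp add: a_minus_def)
    qed (use A.cocycles_minus in blast)
    finally show ?thesis .
  qed
  moreover have "coh_map f B n ` cohomology A n = cohomology B n \<longleftrightarrow>
      (\<forall>y\<in>cocycles B n. \<exists>x\<in>cocycles A n. y \<ominus>\<^bsub>B\<^esub> f x \<in> boundaries B n)" for n
  proof -
    have "coh_map f B n ` cohomology A n = (\<lambda>x. coh_class B n (f x)) ` cocycles A n"
      unfolding cohomology_def image_image
      using coh_map_coh_class[OF A B f A.cocycles_carrier] by (intro image_cong) auto
    moreover have "\<dots> \<subseteq> cohomology B n" using fz by (auto simp: cohomology_def)
    ultimately have "coh_map f B n ` cohomology A n = cohomology B n \<longleftrightarrow>
        cohomology B n \<subseteq> (\<lambda>x. coh_class B n (f x)) ` cocycles A n"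
      by (metis subset_antisym order_refl)
    also have "\<dots> \<longleftrightarrow>
        (\<forall>y\<in>cocycles B n. \<exists>x\<in>cocycles A n. coh_class B n y = coh_class B n (f x))"
      by (simp add: cohomology_def image_subset_iff image_iff)
    also have "\<dots> \<longleftrightarrow> (\<forall>y\<in>cocycles B n. \<exists>x\<in>cocycles A n. y \<ominus>\<^bsub>B\<^esub> f x \<in> boundaries B n)"
    proof -
      have "coh_class B n y = coh_class B n (f x) \<longleftrightarrow> y \<ominus>\<^bsub>B\<^esub> f x \<in> boundaries B n"
        if "x \<in> cocycles A n" "y \<in> cocycles B n" for x y
        using A.cocycles_carrier[OF that(1)] B.cocycles_carrier[OF that(2)] dg_homD(1)[OF f]
        by (intro B.coh_class_eq_iff)
      then show ?thesis by simp
    qed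
    finally show ?thesis .
  qed
  ultimately show ?thesis using f by (auto simp: quasi_iso_def bij_betw_def)
qed

section \<open>Quotients and transport of structure\<close>

text \<open>Operations are computed on chosen preimages. When the fibres of \<open>\<phi>\<close>
  are the cosets of a dg ideal this is the quotient algebra, realised on the target type of
  \<open>\<phi>\<close>; when \<open>\<phi>\<close> is injective it is an isomorphic copy.\<close>

definition dg_image :: "('a \<Rightarrow> 'b) \<Rightarrow> ('k, 'a) dg_alg \<Rightarrow> ('k, 'b) dg_alg" where
  "dg_image \<phi> A = (let \<iota> = inv_into (carrier A) \<phi> in
     \<lparr>carrier = \<phi> ` carrier A,
      monoid.mult = (\<lambda>x y. \<phi> (\<iota> x \<otimes>\<^bsub>A\<^esub> \<iota> y)), one = \<phi> \<one>\<^bsub>A\<^esub>,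
      ring.zero = \<phi> \<zero>\<^bsub>A\<^esub>, add = (\<lambda>x y. \<phi> (\<iota> x \<oplus>\<^bsub>A\<^esub> \<iota> y)),
      module.smult = (\<lambda>c x. \<phi> (c \<odot>\<^bsub>A\<^esub> \<iota> x)),
      hpart = (\<lambda>n. \<phi> ` hpart A n), dif = (\<lambda>x. \<phi> (dif A (\<iota> x)))\<rparr>)"

text \<open>Any map whose fibres are the cosets of \<open>I\<close> may serve as the projection, so
  the choice of a carrier for the quotient is left open. One development then covers both quotients
  by coset representatives and transport into another type. \<open>comp_ideal\<close> says that
  \<open>I\<close> is homogeneous.\<close>

locale dg_quotient = cdg A + ideal I A
  for A :: "('k::field_char_0, 'a) dg_alg" (structure) and I :: "'a set" +
  fixes \<phi> :: "'a \<Rightarrow> 'b"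
  assumes dif_ideal: "x \<in> I \<Longrightarrow> dif A x \<in> I"
    and comp_ideal: "x \<in> I \<Longrightarrow> comp n x \<in> I"
    and eq_iff: "x \<in> carrier A \<Longrightarrow> y \<in> carrier A \<Longrightarrow> \<phi> x = \<phi> y \<longleftrightarrow> x \<ominus> y \<in> I"
begin

abbreviation B :: "('k, 'b) dg_alg" where "B \<equiv> dg_image \<phi> A"
abbreviation \<iota> :: "'b \<Rightarrow> 'a" where "\<iota> \<equiv> inv_into (carrier A) \<phi>"

lemma \<iota>: assumes "x \<in> carrier A" shows "\<iota> (\<phi> x) \<in> carrier A" "\<iota> (\<phi> x) \<ominus> x \<in> I"
proof -
  show "\<iota> (\<phi> x) \<in> carrier A" using assms by (simp add: inv_into_into)
  then show "\<iota> (\<phi> x) \<ominus> x \<in> I"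
    using assms by (subst eq_iff[symmetric]) (auto simp: f_inv_into_f)
qed

lemma eqI: "x \<in> carrier A \<Longrightarrow> y \<in> carrier A \<Longrightarrow> x \<ominus> y \<in> I \<Longrightarrow> \<phi> x = \<phi> y"
  using eq_iff by blast

lemma B_carrier: "carrier B = \<phi> ` carrier A"
  by (simp add: dg_image_def Let_def)

lemma B_hpart: "hpart B n = \<phi> ` hpart A n"
  by (simp add: dg_image_def Let_def)

lemma B_one: "\<one>\<^bsub>B\<^esub> = \<phi> \<one>" and B_zero: "\<zero>\<^bsub>B\<^esub> = \<phi> \<zero>"
  by (simp_all add: dg_image_def Let_def)

text \<open>Scalars act through multiples of the unit, so a ring ideal absorbs them.\<close>

lemma smult_ideal: "x \<in> I \<Longrightarrow> c \<odot> x \<in> I"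
  using I_l_closed[of x "c \<odot> \<one>"] smult_mult_left[of \<one> x c] a_Hcarr by auto

lemma B_add:
  assumes "x \<in> carrier A" "y \<in> carrier A"
  shows "\<phi> x \<oplus>\<^bsub>B\<^esub> \<phi> y = \<phi> (x \<oplus> y)"
proof -
  note X = \<iota>[OF assms(1)] and Y = \<iota>[OF assms(2)]
  have "(\<iota> (\<phi> x) \<oplus> \<iota> (\<phi> y)) \<ominus> (x \<oplus> y) = (\<iota> (\<phi> x) \<ominus> x) \<oplus> (\<iota> (\<phi> y) \<ominus> y)"
    using X(1) Y(1) assms by (simp add: a_minus_def minus_add a_ac)
  also have "\<dots> \<in> I" using X(2) Y(2) a_closed by blast
  finally show ?thesis
    using X(1) Y(1) assms by (auto simp: dg_image_def Let_def intro!: eqI)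
qed

lemma B_mult:
  assumes "x \<in> carrier A" "y \<in> carrier A"
  shows "\<phi> x \<otimes>\<^bsub>B\<^esub> \<phi> y = \<phi> (x \<otimes> y)"
proof -
  note X = \<iota>[OF assms(1)] and Y = \<iota>[OF assms(2)]
  have "(\<iota> (\<phi> x) \<otimes> \<iota> (\<phi> y)) \<ominus> (x \<otimes> y)
      = (\<iota> (\<phi> x) \<ominus> x) \<otimes> \<iota> (\<phi> y) \<oplus> x \<otimes> (\<iota> (\<phi> y) \<ominus> y)"
    using X(1) Y(1) assms by (simp add: a_minus_def l_distr r_distr l_minus r_minus a_ac r_neg
      r_neg1 r_neg2)
  also have "\<dots> \<in> I" using X Y assms I_l_closed I_r_closed by (intro a_closed) auto
  finally show ?thesis
    using X(1) Y(1) assms by (auto simp: dg_image_def Let_def intro!: eqI)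
qed

lemma B_smult:
  assumes "x \<in> carrier A"
  shows "c \<odot>\<^bsub>B\<^esub> \<phi> x = \<phi> (c \<odot> x)"
proof -
  note X = \<iota>[OF assms]
  have "c \<odot> \<iota> (\<phi> x) \<ominus> c \<odot> x = c \<odot> (\<iota> (\<phi> x) \<ominus> x)"
    using X(1) assms by (simp add: a_minus_def smult_add smult_neg)
  also have "\<dots> \<in> I" using smult_ideal X(2) by blast
  finally show ?thesis
    using X(1) assms by (auto simp: dg_image_def Let_def intro!: eqI)
qed

lemma B_dif:
  assumes "x \<in> carrier A"
  shows "dif B (\<phi> x) = \<phi> (dif A x)"
proof -
  note X = \<iota>[OF assms]
  have "dif A (\<iota> (\<phi> x)) \<ominus> dif A x \<in> I"
    using dif_ideal[OF X(2)] X(1) assms by (simp add: dif_minus)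
  then show ?thesis
    using X(1) assms by (auto simp: dg_image_def Let_def intro!: eqI)
qed

lemma \<phi>_comp:
  assumes "x \<in> carrier A"
  shows "\<phi> (comp n (\<iota> (\<phi> x))) = \<phi> (comp n x)"
proof (rule eqI)
  note X = \<iota>[OF assms]
  show "comp n (\<iota> (\<phi> x)) \<ominus> comp n x \<in> I"
    using comp_ideal[OF X(2), of n] X(1) assms by (simp add: a_minus_def comp_add comp_neg)
qed (use \<iota>[OF assms] assms in auto)

lemma ring_B: "ring B"
proof (rule ringI)
  show "abelian_group B"
  proof (rule abelian_groupI)
    fix x assume "x \<in> carrier B"
    then obtain a where a: "a \<in> carrier A" "x = \<phi> a" by (auto simp: B_carrier)
    then show "\<exists>y\<in>carrier B. y \<oplus>\<^bsub>B\<^esub> x = \<zero>\<^bsub>B\<^esub>"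
      by (intro bexI[of _ "\<phi> (\<ominus> a)"]) (auto simp: B_carrier B_add B_zero l_neg)
  qed (auto simp: B_carrier B_add B_zero a_ac)
  show "monoid B"
    by (rule monoidI) (auto simp: B_carrier B_mult B_one m_assoc)
qed (auto simp: B_carrier B_add B_mult l_distr r_distr)

lemma B_neg: "x \<in> carrier A \<Longrightarrow> \<ominus>\<^bsub>B\<^esub> \<phi> x = \<phi> (\<ominus> x)"
  using abelian_group.minus_equality[OF ring.is_abelian_group[OF ring_B], of "\<phi> (\<ominus> x)" "\<phi> x"]
  by (auto simp: B_carrier B_add B_zero l_neg)

lemma cdga_B: "cdga B"
proof -
  interpret B: ring B by (rule ring_B)
  have sub: "additive_subgroup (hpart B n) B" for n
  proof
    show "hpart B n \<subseteq> carrier (add_monoid B)" using hpart_carrier by (auto simp: B_hpart B_carrier)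
    fix x assume "x \<in> hpart B n"
    then obtain a where a: "a \<in> hpart A n" "x = \<phi> a" by (auto simp: B_hpart)
    have "\<ominus>\<^bsub>B\<^esub> x = \<phi> (\<ominus> a)" using a hpart_carrier B_neg by blast
    then show "inv\<^bsub>add_monoid B\<^esub> x \<in> hpart B n" using a hpart_neg by (auto simp: B_hpart a_inv_def)
  qed (use hpart_carrier hpart_add in \<open>auto simp: B_hpart B_add B_zero\<close>)
  show ?thesis
  proof (rule cdgaI[where pr = "\<lambda>n x. \<phi> (comp n (\<iota> x))"], goal_cases)
    case (11 n x)
    then show ?case using \<phi>_comp comp_props(1) by (auto simp: B_carrier B_hpart)
  next
    case (12 n x y)
    then show ?case by (auto simp: B_carrier \<phi>_comp B_add comp_add)
  next
    case (13 n m x)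
    then obtain a where a: "a \<in> hpart A m" "x = \<phi> a" by (auto simp: B_hpart)
    then show ?case using \<phi>_comp[OF hpart_carrier[OF a(1)]] comp_hpart[OF a(1)] by (simp add: B_zero)
  next
    case (14 x)
    then obtain a where a: "a \<in> carrier A" "x = \<phi> a" by (auto simp: B_carrier)
    show ?case
      by (rule finite_subset[OF _ comp_props(2)[OF a(1)]])
        (use a \<phi>_comp[OF a(1)] in \<open>auto simp: B_zero\<close>)
  next
    case (15 x)
    then obtain a where a: "a \<in> carrier A" "x = \<phi> a" by (auto simp: B_carrier)
    \<comment> \<open>If all components vanish in the quotient, each component of \<open>a\<close>
      lies in \<open>I\<close>, and so does \<open>a\<close>, their finite sum.\<close>
    have comp_I: "comp n a \<in> I" for n
      using 15(2)[of n] a \<phi>_comp[OF a(1), of n] eq_iff[of "comp n a" \<zero>]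
        by (simp add: B_zero a_minus_def)
    have "finite F \<Longrightarrow> finsum A (\<lambda>n. comp n a) F \<in> I" for F
    proof (induction F rule: finite_induct)
      case (insert m F)
      then show ?case using a comp_I by (subst finsum_insert) auto
    qed simp
    then have "a \<in> I" using comp_props(2,3)[OF a(1)] by metis
    then show ?case using a eq_iff[of a \<zero>] by (simp add: B_zero a_minus_def)
  next
    case (20 x n)
    then obtain a where a: "a \<in> hpart A n" "x = \<phi> a" by (auto simp: B_hpart)
    then show ?case using B_dif[OF hpart_carrier[OF a(1)]] dif_hpart[OF a(1)] by (auto simp: B_hpart)
  next
    case (19 x y m n)
    then obtain a b where ab: "a \<in> hpart A m" "x = \<phi> a" "b \<in> hpart A n" "y = \<phi> b"
      by (auto simp: B_hpart)
    then show ?case using hpart_carrier[OF ab(1)] hpart_carrier[OF ab(3)] graded_comm[OF ab(1,3)]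
      by (simp add: B_mult B_neg)
  next
    case (24 x y m n)
    then obtain a b where ab: "a \<in> hpart A m" "x = \<phi> a" "b \<in> hpart A n" "y = \<phi> b"
      by (auto simp: B_hpart)
    then show ?case using hpart_carrier[OF ab(1)] hpart_carrier[OF ab(3)] leibniz[OF ab(1,3)]
      by (simp add: B_mult B_neg B_dif B_add)
  next
    case (18 x y m n)
    then obtain a b where ab: "a \<in> hpart A m" "x = \<phi> a" "b \<in> hpart A n" "y = \<phi> b"
      by (auto simp: B_hpart)
    then show ?case using hpart_carrier[OF ab(1)] hpart_carrier[OF ab(3)] hpart_mult[OF ab(1,3)]
      by (simp add: B_mult B_hpart)
  next
    case (10 n c x)
    then obtain a where a: "a \<in> hpart A n" "x = \<phi> a" by (auto simp: B_hpart)
    then show ?case using hpart_carrier[OF a(1)] hpart_smult[OF a(1)] by (auto simp: B_hpart B_smult)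
  next
    case (16 n)
    then show ?case using hpart_nonpos by (simp add: B_hpart B_zero)
  qed (use ring_B sub hpart_one in \<open>auto simp: B_carrier B_add B_smult B_mult B_dif smult_plus smult_add
      smult_times smult_mult_left smult_mult_right dif_add dif_smult dif_dif B_zero B_one B_hpart\<close>)
qed

lemma dg_hom_\<phi>: "\<phi> \<in> dg_hom A B"
  by (rule dg_homI) (auto simp: B_carrier B_mult B_add B_one B_smult B_hpart B_dif)

text \<open>Universal property of the quotient. For the zero ideal and the identity map it produces
  the inverse of a transport.\<close>

lemma factor:
  assumes T: "cdga T" and u: "u \<in> dg_hom A T" and 0: "\<And>x. x \<in> I \<Longrightarrow> u x = \<zero>\<^bsub>T\<^esub>"
  obtains h where "h \<in> dg_hom B T" "\<And>x. x \<in> carrier A \<Longrightarrow> h (\<phi> x) = u x"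
proof -
  interpret T: cdg T by (rule cdgI[OF T])
  have h: "u (\<iota> (\<phi> x)) = u x" if "x \<in> carrier A" for x
    using 0[OF \<iota>(2)[OF that]] dg_hom_minus[OF cdga T u \<iota>(1)[OF that] that]
      dg_homD(1)[OF u] that \<iota>(1)[OF that] by simp
  show ?thesis
  proof (rule that[of "\<lambda>y. u (\<iota> y)"])
    show "(\<lambda>y. u (\<iota> y)) \<in> dg_hom B T"
      using dg_homD[OF u] hpart_carrier
      by (intro dg_homI) (auto simp: B_carrier B_mult B_add B_one B_smult B_hpart B_dif h)
  qed (rule h)
qed

end

section \<open>Polynomial and Koszul extensions\<close>

context cdg
begin

text \<open>The sign incurred when an element is moved past an odd generator: multiplication by -1
  to the degree, extended additively.\<close>

definition twist :: "'a \<Rightarrow> 'a" where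
  "twist x = finsum A (\<lambda>n. if odd n then \<ominus> comp n x else comp n x) {n. comp n x \<noteq> \<zero>}"

lemma
  assumes x: "x \<in> carrier A"
  shows twist_carrier [simp]: "twist x \<in> carrier A"
    and comp_twist: "comp n (twist x) = (if odd n then \<ominus> comp n x else comp n x)"
proof -
  show "twist x \<in> carrier A" unfolding twist_def using x by (intro finsum_closed) auto
  show "comp n (twist x) = (if odd n then \<ominus> comp n x else comp n x)"
    by (rule comp_eqI[OF comp_props(2)[OF x] _ twist_def])
      (use x comp_props(1)[OF x] hpart_neg in auto)
qed

lemma twist_hpart: "x \<in> hpart A n \<Longrightarrow> twist x = (if odd n then \<ominus> x else x)"
  by (rule comp_ext) (auto simp: hpart_carrier comp_twist comp_neg comp_hpart)

lemma twist_zero [simp]: "twist \<zero> = \<zero>"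
  using twist_hpart[of \<zero> 0] by simp

lemma twist_one [simp]: "twist \<one> = \<one>"
  using twist_hpart[OF hpart_one] by simp

lemma twist_add: "x \<in> carrier A \<Longrightarrow> y \<in> carrier A \<Longrightarrow> twist (x \<oplus> y) = twist x \<oplus> twist y"
  by (rule comp_ext) (auto simp: comp_twist comp_add minus_add)

lemma twist_smult: "x \<in> carrier A \<Longrightarrow> twist (c \<odot> x) = c \<odot> twist x"
  by (rule comp_ext) (auto simp: comp_twist comp_smult smult_neg)

lemma twist_mult:
  assumes x: "x \<in> carrier A" and y: "y \<in> carrier A"
  shows "twist (x \<otimes> y) = twist x \<otimes> twist y"
  using x
proof (induction x rule: homogeneous_induct)
  case (homogeneous x m)
  note xm = homogeneous and xc = hpart_carrier[OF homogeneous]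
  show ?case using y
  proof (induction y rule: homogeneous_induct)
    case (homogeneous y n)
    show ?case
      using xc hpart_carrier[OF homogeneous] twist_hpart[OF homogeneous] twist_hpart[OF xm]
        twist_hpart[OF hpart_mult[OF xm homogeneous]]
      by (auto simp: l_minus r_minus)
  qed (use xc in \<open>auto simp: twist_add r_distr\<close>)
qed (use y in \<open>auto simp: twist_add l_distr\<close>)

end

text \<open>The pair \<open>(a, b)\<close> stands for \<open>a + eta b\<close>, where
  \<open>eta\<close> has degree -1, squares to zero and satisfies \<open>d eta = y\<close>. The
  formulas follow from \<open>a eta = eta (twist a)\<close> and from
  \<open>d (eta b) = y b - eta (d b)\<close>; the shift by 1 in the second factor of
  \<open>hpart\<close> is the degree of \<open>eta\<close>.\<close>

definition koszul_dg :: "('k::field_char_0, 'a) dg_alg \<Rightarrow> 'a \<Rightarrow> ('k, 'a \<times> 'a) dg_alg" where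
  "koszul_dg A y =
     \<lparr>carrier = carrier A \<times> carrier A,
      monoid.mult = (\<lambda>(a, b) (a', b').
        (a \<otimes>\<^bsub>A\<^esub> a', cdg.twist A a \<otimes>\<^bsub>A\<^esub> b' \<oplus>\<^bsub>A\<^esub> b \<otimes>\<^bsub>A\<^esub> a')),
      one = (\<one>\<^bsub>A\<^esub>, \<zero>\<^bsub>A\<^esub>), ring.zero = (\<zero>\<^bsub>A\<^esub>, \<zero>\<^bsub>A\<^esub>),
      add = (\<lambda>(a, b) (a', b'). (a \<oplus>\<^bsub>A\<^esub> a', b \<oplus>\<^bsub>A\<^esub> b')),
      module.smult = (\<lambda>c (a, b). (c \<odot>\<^bsub>A\<^esub> a, c \<odot>\<^bsub>A\<^esub> b)),
      hpart = (\<lambda>n. hpart A n \<times> hpart A (n + 1)),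
      dif = (\<lambda>(a, b). (dif A a \<oplus>\<^bsub>A\<^esub> y \<otimes>\<^bsub>A\<^esub> b, \<ominus>\<^bsub>A\<^esub> dif A b))\<rparr>"

lemma (in cdg) cdga_koszul:
  assumes y: "y \<in> hpart A 0"
  shows "cdga (koszul_dg A y)"
proof -
  let ?K = "koszul_dg A y"
  note K_def = koszul_dg_def
  have yc [simp]: "y \<in> carrier A" using hpart_carrier[OF y] .
  have carr: "carrier ?K = carrier A \<times> carrier A" by (simp add: K_def)
  have mult: "(a, b) \<otimes>\<^bsub>?K\<^esub> (a', b') = (a \<otimes> a', twist a \<otimes> b' \<oplus> b \<otimes> a')" for a b a' b'
    by (simp add: K_def)
  have add: "(a, b) \<oplus>\<^bsub>?K\<^esub> (a', b') = (a \<oplus> a', b \<oplus> b')" for a b a' b'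
    by (simp add: K_def)
  have one: "\<one>\<^bsub>?K\<^esub> = (\<one>, \<zero>)" and zero: "\<zero>\<^bsub>?K\<^esub> = (\<zero>, \<zero>)" by (simp_all add: K_def)
  have smult: "c \<odot>\<^bsub>?K\<^esub> (a, b) = (c \<odot> a, c \<odot> b)" for c a b by (simp add: K_def)
  have hp: "hpart ?K n = hpart A n \<times> hpart A (n + 1)" for n by (simp add: K_def)
  have dif: "dif ?K (a, b) = (dif A a \<oplus> y \<otimes> b, \<ominus> dif A b)" for a b by (simp add: K_def)
  have R: "ring ?K"
  proof (rule ringI)
    show "abelian_group ?K"
    proof (rule abelian_groupI)
      fix x assume "x \<in> carrier ?K"
      then show "\<exists>z\<in>carrier ?K. z \<oplus>\<^bsub>?K\<^esub> x = \<zero>\<^bsub>?K\<^esub>"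
        by (intro bexI[of _ "(\<ominus> fst x, \<ominus> snd x)"]) (auto simp: carr add zero l_neg)
    qed (auto simp: carr add zero a_ac)
    show "monoid ?K"
      by (rule monoidI) (auto simp: carr mult one m_assoc twist_mult l_distr r_distr a_ac)
  qed (auto simp: carr mult add twist_add l_distr r_distr a_ac)
  interpret K: ring ?K by (rule R)
  have neg: "\<ominus>\<^bsub>?K\<^esub> (a, b) = (\<ominus> a, \<ominus> b)" if "a \<in> carrier A" "b \<in> carrier A" for a b
    using K.minus_equality[of "(\<ominus> a, \<ominus> b)" "(a, b)"] that by (auto simp: carr add zero l_neg)
  have sub: "additive_subgroup (hpart ?K n) ?K" for n
  proof
    show "hpart ?K n \<subseteq> carrier (add_monoid ?K)" using hpart_carrier by (auto simp: hp carr)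
    fix x assume x: "x \<in> hpart ?K n"
    have "\<ominus>\<^bsub>?K\<^esub> x \<in> hpart ?K n" using x hpart_carrier by (auto simp: hp neg hpart_neg)
    then show "inv\<^bsub>add_monoid ?K\<^esub> x \<in> hpart ?K n" by (simp add: a_inv_def)
  qed (use hpart_add in \<open>auto simp: hp add zero\<close>)
  have y_comm: "y \<otimes> z = z \<otimes> y" if "z \<in> carrier A" for z
    using hpart_0_comm[OF y that] .
  have twist_y: "twist y = y" using twist_hpart[OF y] by simp
  show ?thesis
  proof (rule cdgaI[where pr = "\<lambda>n (a, b). (comp n a, comp (n + 1) b)"], goal_cases)
    case (11 n x)
    then show ?case using comp_props(1) by (auto simp: carr hp)
  next
    case (13 n m x)
    then show ?case by (auto simp: hp comp_hpart zero)
  next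
    case (14 x)
    have "{n. (case x of (a, b) \<Rightarrow> (comp n a, comp (n + 1) b)) \<noteq> \<zero>\<^bsub>?K\<^esub>}
        \<subseteq> {n. comp n (fst x) \<noteq> \<zero>} \<union> (\<lambda>n. n - 1) ` {n. comp n (snd x) \<noteq> \<zero>}"
    proof
      fix n assume "n \<in> {n. (case x of (a, b) \<Rightarrow> (comp n a, comp (n + 1) b)) \<noteq> \<zero>\<^bsub>?K\<^esub>}"
      then have "comp n (fst x) \<noteq> \<zero> \<or> comp (n + 1) (snd x) \<noteq> \<zero>" by (auto simp: zero split: prod.splits)
      moreover have "n = (n + 1) - 1" by simp
      ultimately show "n \<in> {n. comp n (fst x) \<noteq> \<zero>} \<union> (\<lambda>n. n - 1) ` {n. comp n (snd x) \<noteq> \<zero>}"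
        by blast
    qed
    then show ?case using 14 comp_props(2) by (auto simp: carr elim!: finite_subset)
  next
    case (15 x)
    obtain a b where ab: "x = (a, b)" "a \<in> carrier A" "b \<in> carrier A"
      using 15(1) by (auto simp: carr)
    have "comp n a = \<zero>" for n using 15(2)[of n] ab by (simp add: zero)
    moreover have "comp n b = \<zero>" for n using 15(2)[of "n - 1"] ab by (simp add: zero)
    ultimately show ?case using ab comp_ext[of a \<zero>] comp_ext[of b \<zero>] by (simp add: zero)
  next
    case (16 n)
    then show ?case using hpart_nonpos by (auto simp: hp zero)
  next
    case (18 x z m n)
    then obtain a b a' b' where x: "x = (a, b)" "a \<in> hpart A m" "b \<in> hpart A (m + 1)"
      and z: "z = (a', b')" "a' \<in> hpart A n" "b' \<in> hpart A (n + 1)" by (auto simp: hp)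
    have "twist a \<otimes> b' \<in> hpart A (m + (n + 1))"
      using twist_hpart[OF x(2)] x z hpart_neg by (intro hpart_mult) auto
    moreover have "b \<otimes> a' \<in> hpart A ((m + 1) + n)" using x z by (intro hpart_mult) auto
    ultimately show ?case using x z hpart_mult by (auto simp: hp mult add.commute add.left_commute
      intro!: hpart_add)
  next
    case (19 x z m n)
    then obtain a b a' b' where x: "x = (a, b)" "a \<in> hpart A m" "b \<in> hpart A (m + 1)"
      and z: "z = (a', b')" "a' \<in> hpart A n" "b' \<in> hpart A (n + 1)" by (auto simp: hp)
    note c [simp] = x(2,3)[THEN hpart_carrier] z(2,3)[THEN hpart_carrier]
    note x(1) [simp] z(1) [simp]
    note h = graded_comm[OF x(2) z(2)] graded_comm[OF x(2) z(3)] graded_comm[OF x(3) z(2)]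
    show ?case
    proof (cases "odd m"; cases "odd n")
    qed (use h in \<open>simp_all add: mult neg twist_hpart[OF x(2)] twist_hpart[OF z(2)] l_minus r_minus
      minus_add a_comm\<close>)
  next
    case (20 x n)
    then obtain a b where x: "x = (a, b)" "a \<in> hpart A n" "b \<in> hpart A (n + 1)" by (auto simp: hp)
    have "y \<otimes> b \<in> hpart A (n + 1)" using hpart_mult[OF y x(3)] by simp
    then show ?case using x dif_hpart[OF x(2)] dif_hpart[OF x(3)]
      by (auto simp: hp dif intro!: hpart_add hpart_neg)
  next
    case (23 x)
    then show ?case
      by (auto simp: carr dif zero dif_add dif_neg dif_dif dif_hpart_0_mult[OF y] r_minus l_neg r_neg)
  next
    case (24 x z m n)
    then obtain a b a' b' where x: "x = (a, b)" "a \<in> hpart A m" "b \<in> hpart A (m + 1)"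
      and z: "z = (a', b')" "a' \<in> hpart A n" "b' \<in> hpart A (n + 1)" by (auto simp: hp)
    note c [simp] = x(2,3)[THEN hpart_carrier] z(2,3)[THEN hpart_carrier]
    note x(1) [simp] z(1) [simp]
    note l = leibniz[OF x(2) z(2)] leibniz[OF x(2) z(3)] leibniz[OF x(3) z(2)]
    have t: "twist (dif A a) = (if odd m then dif A a else \<ominus> dif A a)"
      using twist_hpart[OF dif_hpart[OF x(2)]] by simp
    have yb: "twist (y \<otimes> b) = (if odd m then y \<otimes> b else \<ominus> (y \<otimes> b))"
      using twist_hpart[OF hpart_mult[OF y x(3)]] by simp
    have ya: "a \<otimes> (y \<otimes> b') = y \<otimes> (a \<otimes> b')" "b \<otimes> (y \<otimes> b') = y \<otimes> (b \<otimes> b')"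
      using y_comm[of a] y_comm[of b] by (simp_all add: m_assoc[symmetric])
    \<comment> \<open>The product of the two \<open>eta\<close> parts is zero, so its differential
      must be zero as well: differentiating either factor gives \<open>y b b'\<close>, and the two
      terms come with opposite signs.\<close>
    have canc: "y \<otimes> (b \<otimes> b') \<oplus> (p \<oplus> (q \<oplus> (r \<oplus> \<ominus> (y \<otimes> (b \<otimes> b'))))) = p \<oplus> (q \<oplus> r)"
      if "p \<in> carrier A" "q \<in> carrier A" "r \<in> carrier A" for p q r
    proof -
      have "y \<otimes> (b \<otimes> b') \<oplus> (p \<oplus> (q \<oplus> (r \<oplus> \<ominus> (y \<otimes> (b \<otimes> b')))))
          = (p \<oplus> (q \<oplus> r)) \<oplus> (y \<otimes> (b \<otimes> b') \<oplus> \<ominus> (y \<otimes> (b \<otimes> b')))"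
        using that by (simp add: a_ac)
      then show ?thesis using that by (simp add: r_neg)
    qed
    show ?case
    proof (cases "odd m")
      case True
      then show ?thesis
        using l t yb ya twist_hpart[OF x(2)]
        by (simp add: mult add dif neg twist_add l_minus r_minus l_distr r_distr minus_add m_assoc
            a_ac dif_add dif_neg r_neg r_neg1 r_neg2) (simp add: canc)
    next
      case False
      then show ?thesis
        using l t yb ya twist_hpart[OF x(2)]
        by (simp add: mult add dif neg twist_add l_minus r_minus l_distr r_distr minus_add m_assoc
            a_ac dif_add dif_neg r_neg r_neg1 r_neg2) (simp add: canc)
    qed
  qed (use R sub y hpart_one hpart_smult comp_add in \<open>auto simp: carr mult add one zero smult hp dif
      smult_plus smult_add smult_times smult_mult_left smult_mult_right dif_add dif_smult
      twist_smult smult_neg r_distr minus_add a_ac\<close>)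
qed

text \<open>The algebra \<open>A[Y]\<close> with \<open>Y\<close> of degree 0 and
  \<open>d Y = 0\<close>, so that grading and differential are those of the coefficients.\<close>

definition poly_dg :: "('k::field_char_0, 'a) dg_alg \<Rightarrow> ('k, nat \<Rightarrow> 'a) dg_alg" where
  "poly_dg A =
     \<lparr>carrier = up A,
      monoid.mult = (\<lambda>p q n. finsum A (\<lambda>i. p i \<otimes>\<^bsub>A\<^esub> q (n - i)) {..n}),
      one = (\<lambda>i. if i = 0 then \<one>\<^bsub>A\<^esub> else \<zero>\<^bsub>A\<^esub>), ring.zero = (\<lambda>_. \<zero>\<^bsub>A\<^esub>),
      add = (\<lambda>p q i. p i \<oplus>\<^bsub>A\<^esub> q i), module.smult = (\<lambda>c p i. c \<odot>\<^bsub>A\<^esub> p i),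
      hpart = (\<lambda>n. {p \<in> up A. \<forall>i. p i \<in> hpart A n}), dif = (\<lambda>p i. dif A (p i))\<rparr>"

lemma (in abelian_group) finsum_neg:
  assumes "finite F" "\<And>i. i \<in> F \<Longrightarrow> f i \<in> carrier G"
  shows "\<ominus> finsum G f F = finsum G (\<lambda>i. \<ominus> f i) F"
  using assms by (intro hom_finsum_into) (auto simp: abelian_group_axioms minus_add)

lemma (in abelian_group) finsum_reflect:
  assumes "\<And>i. i \<le> n \<Longrightarrow> f i \<in> carrier G"
  shows "finsum G f {..n::nat} = finsum G (\<lambda>i. f (n - i)) {..n}"
proof -
  have eq: "(\<lambda>i. n - i) ` {..n} = {..n}"
  proof (intro subset_antisym subsetI)
    fix x assume "x \<in> {..n}"
    then show "x \<in> (\<lambda>i. n - i) ` {..n}" by (intro image_eqI[of _ _ "n - x"]) auto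
  qed auto
  have inj: "inj_on (\<lambda>i. n - i) {..n}" by (auto simp: inj_on_def)
  have "f \<in> (\<lambda>i. n - i) ` {..n} \<rightarrow> carrier G" using assms by auto
  from add.finprod_reindex[OF this inj] show ?thesis unfolding eq .
qed

lemma (in cdg) up_map_closed:
  assumes "p \<in> up A" "\<And>x. x \<in> carrier A \<Longrightarrow> f x \<in> carrier A" "f \<zero> = \<zero>"
  shows "(\<lambda>i. f (p i)) \<in> up A"
proof
  show "f (p n) \<in> carrier A" for n using assms mem_upD by blast
  obtain n where "bound \<zero> n p" using bound_upD assms by blast
  then have "bound \<zero> n (\<lambda>i. f (p i))" using assms by auto
  then show "\<exists>n. bound \<zero> n (\<lambda>i. f (p i))" by blast
qed

lemma (in cdg) cdga_poly: "cdga (poly_dg A)"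
proof -
  let ?P = "poly_dg A"
  have carr: "carrier ?P = up A" by (simp add: poly_dg_def)
  have mult: "p \<otimes>\<^bsub>?P\<^esub> q = (\<lambda>n. finsum A (\<lambda>i. p i \<otimes> q (n - i)) {..n})" for p q
    by (simp add: poly_dg_def)
  have add: "p \<oplus>\<^bsub>?P\<^esub> q = (\<lambda>i. p i \<oplus> q i)" for p q
    by (simp add: poly_dg_def)
  have one: "\<one>\<^bsub>?P\<^esub> = (\<lambda>i. if i = 0 then \<one> else \<zero>)" and zero: "\<zero>\<^bsub>?P\<^esub> = (\<lambda>_. \<zero>)"
    by (simp_all add: poly_dg_def)
  have smult: "c \<odot>\<^bsub>?P\<^esub> p = (\<lambda>i. c \<odot> p i)" for c p by (simp add: poly_dg_def)
  have hp: "hpart ?P n = {p \<in> up A. \<forall>i. p i \<in> hpart A n}" for n by (simp add: poly_dg_def)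
  have dif: "dif ?P p = (\<lambda>i. dif A (p i))" for p by (simp add: poly_dg_def)
  \<comment> \<open>The ring laws are inherited from \<open>UP A\<close>, whose operations agree
    with the present ones on \<open>up A\<close>.\<close>
  have Uc: "carrier (UP A) = up A" by (simp add: UP_def)
  have Um: "p \<otimes>\<^bsub>UP A\<^esub> q = p \<otimes>\<^bsub>?P\<^esub> q" if "p \<in> up A" "q \<in> up A" for p q
    using that by (simp add: UP_def mult)
  have Ua: "p \<oplus>\<^bsub>UP A\<^esub> q = p \<oplus>\<^bsub>?P\<^esub> q" if "p \<in> up A" "q \<in> up A" for p q
    using that by (simp add: UP_def add)
  have Uo: "\<one>\<^bsub>UP A\<^esub> = \<one>\<^bsub>?P\<^esub>" and Uz: "\<zero>\<^bsub>UP A\<^esub> = \<zero>\<^bsub>?P\<^esub>" by (simp_all add: UP_def one zero)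
  interpret U: ring "UP A"
    by (rule UP_ring.UP_ring[OF UP_ring.intro[OF ring_axioms]])
  have cl: "p \<otimes>\<^bsub>?P\<^esub> q \<in> up A" "p \<oplus>\<^bsub>?P\<^esub> q \<in> up A" if "p \<in> up A" "q \<in> up A" for p q
    using that up_mult_closed up_add_closed by (simp_all add: mult add)
  have cl0: "\<one>\<^bsub>?P\<^esub> \<in> up A" "\<zero>\<^bsub>?P\<^esub> \<in> up A"
    using U.one_closed U.zero_closed by (simp_all add: Uo Uz Uc)
  have R: "ring ?P"
  proof (rule ringI)
    show "abelian_group ?P"
    proof (rule abelian_groupI)
      fix x assume "x \<in> carrier ?P"
      then show "\<exists>z\<in>carrier ?P. z \<oplus>\<^bsub>?P\<^esub> x = \<zero>\<^bsub>?P\<^esub>"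
        using U.add.l_inv_ex[of x] by (auto simp: carr Uc Ua Uz)
    qed (use U.a_assoc U.a_comm U.l_zero cl cl0 in \<open>auto simp: carr Uc Ua Uz\<close>)
    show "monoid ?P"
      by (rule monoidI) (use U.m_assoc U.l_one U.r_one cl cl0 in \<open>auto simp: carr Uc Um Uo\<close>)
  qed (use U.l_distr U.r_distr cl in \<open>auto simp: carr Uc Um Ua\<close>)
  interpret P: ring ?P by (rule R)
  have neg: "\<ominus>\<^bsub>?P\<^esub> p = (\<lambda>i. \<ominus> p i)" if "p \<in> up A" for p
  proof -
    have "(\<lambda>i. \<ominus> p i) \<in> up A" using that by (rule up_a_inv_closed)
    then show ?thesis
      using P.minus_equality[of "\<lambda>i. \<ominus> p i" p] that mem_upD[OF that]
      by (auto simp: carr add zero l_neg)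
  qed
  have pc: "p i \<in> carrier A" if "p \<in> up A" for p i using mem_upD[OF that] .
  have sub: "additive_subgroup (hpart ?P n) ?P" for n
  proof
    show "hpart ?P n \<subseteq> carrier (add_monoid ?P)" by (auto simp: hp carr)
    fix x assume x: "x \<in> hpart ?P n"
    have "\<ominus>\<^bsub>?P\<^esub> x \<in> hpart ?P n" using x by (auto simp: hp neg hpart_neg up_a_inv_closed)
    then show "inv\<^bsub>add_monoid ?P\<^esub> x \<in> hpart ?P n" by (simp add: a_inv_def)
  qed (use hpart_add cl cl0 in \<open>auto simp: hp add zero\<close>)
  have dcl: "(\<lambda>i. dif A (p i)) \<in> up A" if "p \<in> up A" for p
    using up_map_closed[OF that, of "dif A"] by simp
  have scl: "(\<lambda>i. c \<odot> p i) \<in> up A" if "p \<in> up A" for p c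
    using up_map_closed[OF that, of "\<lambda>x. c \<odot> x"] by simp
  have smf: "c \<odot> finsum A f F = finsum A (\<lambda>i. c \<odot> f i) F"
    if "finite F" "\<And>i. i \<in> F \<Longrightarrow> f i \<in> carrier A" for c and f :: "nat \<Rightarrow> 'a" and F
    using that by (intro hom_finsum_into) (auto simp: abelian_group_axioms smult_add)
  have dsf: "dif A (finsum A f F) = finsum A (\<lambda>i. dif A (f i)) F"
    if "finite F" "\<And>i. i \<in> F \<Longrightarrow> f i \<in> carrier A" for f :: "nat \<Rightarrow> 'a" and F
    using that by (intro hom_finsum_into) (auto simp: abelian_group_axioms dif_add)
  show ?thesis
  proof (rule cdgaI[where pr = "\<lambda>n p i. comp n (p i)"], goal_cases)
    case (7 c x z)
    then show ?case
      by (auto simp: carr mult smult smf pc smult_mult_left intro!: finsum_cong')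
  next
    case (8 c x z)
    then show ?case
      by (auto simp: carr mult smult smf pc smult_mult_right intro!: finsum_cong')
  next
    case (11 n x)
    then show ?case using up_map_closed[of x "comp n"] comp_props(1) pc by (auto simp: carr hp)
  next
    case (13 n m x)
    then have "comp n (x i) = (if n = m then x i else \<zero>)" for i
      by (intro comp_hpart) (auto simp: hp)
    then show ?case by (auto simp: zero)
  next
    case (14 x)
    obtain N where N: "bound \<zero> N x" using 14 bound_upD by (auto simp: carr)
    \<comment> \<open>Only finitely many coefficients are nonzero, and each has finitely many
      nonzero components.\<close>
    have "{n. (\<lambda>i. comp n (x i)) \<noteq> \<zero>\<^bsub>?P\<^esub>} \<subseteq> (\<Union>i\<le>N. {n. comp n (x i) \<noteq> \<zero>})"
    proof
      fix n assume "n \<in> {n. (\<lambda>i. comp n (x i)) \<noteq> \<zero>\<^bsub>?P\<^esub>}"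
      then obtain i where i: "comp n (x i) \<noteq> \<zero>" by (auto simp: zero)
      then have "i \<le> N" using bound_below[OF N, of i] by (metis comp_zero)
      then show "n \<in> (\<Union>i\<le>N. {n. comp n (x i) \<noteq> \<zero>})" using i by auto
    qed
    then show ?case using 14 comp_props(2) pc by (auto simp: carr elim!: finite_subset)
  next
    case (15 x)
    have "x i = \<zero>" for i
      using 15(1) 15(2)[THEN fun_cong, of _ i] comp_ext[of "x i" \<zero>] pc by (auto simp: carr zero)
    then show ?case by (auto simp: zero)
  next
    case (16 n)
    then show ?case using hpart_nonpos cl0 by (auto simp: hp zero)
  next
    case (18 x z m n)
    then show ?case using cl(1)[of x z] hpart_mult by (auto simp: hp mult intro!: finsum_hpart)
  next
    case (19 x z m n)
    then have c [simp]: "x i \<in> carrier A" "z i \<in> carrier A" for i using pc by (auto simp: hp)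
    \<comment> \<open>Reversing the order of summation pairs the same two coefficients in both
      products, so graded commutativity can be applied term by term.\<close>
    have e: "finsum A (\<lambda>i. z i \<otimes> x (k - i)) {..k} = finsum A (\<lambda>i. z (k - i) \<otimes> x i) {..k}" for k
      by (subst finsum_reflect) (auto intro!: finsum_cong')
    have xz: "x i \<in> hpart A m" "z i \<in> hpart A n" for i using 19 by (auto simp: hp)
    show ?case
    proof (cases "odd m \<and> odd n")
      case True
      have "z \<otimes>\<^bsub>?P\<^esub> x \<in> up A" using 19 cl by (auto simp: hp)
      moreover have "x i \<otimes> z j = \<ominus> (z j \<otimes> x i)" for i j using graded_comm[OF xz] True by simp
      ultimately show ?thesis using True by (auto simp: neg mult e finsum_neg)
    next
      case False
      then have "x i \<otimes> z j = z j \<otimes> x i" for i j using graded_comm[OF xz] by auto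
      then show ?thesis using False by (auto simp: mult e)
    qed
  next
    case (20 x n)
    then show ?case by (auto simp: hp dif dcl dif_hpart)
  next
    case (22 c x)
    then show ?case by (auto simp: carr dif smult dif_smult pc)
  next
    case (23 x)
    then show ?case by (auto simp: carr dif zero dif_dif pc)
  next
    case (24 x z m n)
    then have c [simp]: "x i \<in> carrier A" "z i \<in> carrier A" for i using pc by (auto simp: hp)
    have xz: "x i \<in> hpart A m" "z i \<in> hpart A n" for i using 24 by (auto simp: hp)
    have "x \<otimes>\<^bsub>?P\<^esub> dif ?P z \<in> up A" using 24 cl dcl by (auto simp: hp dif)
    then have n: "\<ominus>\<^bsub>?P\<^esub> (x \<otimes>\<^bsub>?P\<^esub> dif ?P z) = (\<lambda>k. finsum A (\<lambda>i. \<ominus> (x i \<otimes> dif A (z (k - i)))) {..k})"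
      by (simp add: neg) (simp add: mult dif finsum_neg)
    have "dif A (finsum A (\<lambda>i. x i \<otimes> z (k - i)) {..k})
        = finsum A (\<lambda>i. dif A (x i) \<otimes> z (k - i)) {..k} \<oplus>
          finsum A (\<lambda>i. if odd m then \<ominus> (x i \<otimes> dif A (z (k - i))) else x i \<otimes> dif A (z (k - i))) {..k}"
      for k
    proof -
      have "dif A (finsum A (\<lambda>i. x i \<otimes> z (k - i)) {..k})
          = finsum A (\<lambda>i. dif A (x i \<otimes> z (k - i))) {..k}"
        by (intro dsf) auto
      also have "\<dots> = finsum A (\<lambda>i. dif A (x i) \<otimes> z (k - i) \<oplus>
          (if odd m then \<ominus> (x i \<otimes> dif A (z (k - i))) else x i \<otimes> dif A (z (k - i)))) {..k}"
        using leibniz[OF xz] by simp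
      also have "\<dots> = finsum A (\<lambda>i. dif A (x i) \<otimes> z (k - i)) {..k} \<oplus>
          finsum A (\<lambda>i. if odd m then \<ominus> (x i \<otimes> dif A (z (k - i))) else x i \<otimes> dif A (z (k - i))) {..k}"
        by (intro finsum_addf) auto
      finally show ?thesis .
    qed
    then show ?case
      by (cases "odd m") (simp_all add: n, simp_all add: mult dif add)
  qed (use R sub hpart_one hpart_smult cl0 in \<open>auto simp: carr mult add one zero smult hp dif scl pc
      smult_plus smult_add smult_times dif_add up_add_closed comp_add\<close>)
qed

section \<open>Encoding pairs and polynomials over an infinite type\<close>

lemma inj_pairing:
  assumes "infinite (UNIV :: 'u set)"
  obtains p :: "'u \<times> 'u \<Rightarrow> 'u" where "inj p"
proof -
  have "|UNIV \<times> UNIV :: ('u \<times> 'u) set| \<le>o |UNIV :: 'u set|"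
    using card_of_Times_same_infinite[OF assms] ordIso_imp_ordLeq by blast
  then obtain p :: "'u \<times> 'u \<Rightarrow> 'u" where "inj_on p (UNIV \<times> UNIV)"
    using card_of_ordLeq[of "UNIV \<times> UNIV :: ('u \<times> 'u) set" "UNIV :: 'u set"] by blast
  then show thesis using that by simp
qed

text \<open>A coefficient sequence is determined by a bound and the list of coefficients up to it;
  number and list are encoded by iterated pairing. The code \<open>l\<close> is compared only on
  lists of equal length, and the bound stored next to it supplies that length.\<close>

lemma inj_up:
  fixes R :: "('u, 'm) ring_scheme"
  assumes "infinite (UNIV :: 'u set)"
  obtains j :: "(nat \<Rightarrow> 'u) \<Rightarrow> 'u" where "inj_on j (up R)"
proof -
  obtain p :: "'u \<times> 'u \<Rightarrow> 'u" where p: "inj p" using inj_pairing[OF assms] by blast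
  obtain a :: "nat \<Rightarrow> 'u" where a: "inj a" using infinite_countable_subset[OF assms] by blast
  define l where "l xs = foldr (\<lambda>x y. p (x, y)) xs (a 0)" for xs
  have l: "xs = ys" if "l xs = l ys" "length xs = length ys" for xs ys
    using that(2,1)
  proof (induction xs ys rule: list_induct2)
    case (Cons x xs y ys)
    then show ?case using injD[OF p, of "(x, l xs)" "(y, l ys)"] by (simp add: l_def)
  qed simp
  define b where "b f = (SOME n. bound \<zero>\<^bsub>R\<^esub> n f)" for f
  define j where "j f = p (a (b f), l (map f [0..<Suc (b f)]))" for f
  have "inj_on j (up R)"
  proof (rule inj_onI)
    fix f g assume "f \<in> up R" "g \<in> up R" and j: "j f = j g"
    moreover have "bound \<zero>\<^bsub>R\<^esub> (b h) h" if "h \<in> up R" for h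
      unfolding b_def by (rule someI_ex) (use that in \<open>simp add: up_def\<close>)
    ultimately have B: "bound \<zero>\<^bsub>R\<^esub> (b f) f" "bound \<zero>\<^bsub>R\<^esub> (b g) g" by blast+
    have eq: "(a (b f), l (map f [0..<Suc (b f)])) = (a (b g), l (map g [0..<Suc (b g)]))"
      using injD[OF p] j by (simp only: j_def)
    have e: "b f = b g"
      using eq injD[OF a] by blast
    have el: "l (map f [0..<Suc (b f)]) = l (map g [0..<Suc (b f)])"
      using eq unfolding e by blast
    have m: "map f [0..<Suc (b f)] = map g [0..<Suc (b f)]" using l[OF el] by simp
    show "f = g"
    proof
      fix n
      show "f n = g n"
      proof (cases "n \<le> b f")
        case True
        then show ?thesis using m by (simp only: map_eq_conv) auto
      next
        case False
        then show ?thesis using B e by (simp add: bound_def)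
      qed
    qed
  qed
  then show thesis using that by blast
qed

section \<open>Adjoining a variable together with a primitive of it\<close>

context cdg
begin

definition poly_var :: "nat \<Rightarrow> 'a" where
  "poly_var = (\<lambda>i. if i = 1 then \<one> else \<zero>)"

text \<open>The algebra \<open>A[Y, eta]\<close> with \<open>d eta = Y\<close>. As \<open>Y\<close>
  is exact, it maps to \<open>A\<close> by a trivial fibration, while it leaves room to deform an
  element \<open>s\<close> of degree 0 into \<open>s + Y\<close>.\<close>

definition resolution :: "('k, (nat \<Rightarrow> 'a) \<times> (nat \<Rightarrow> 'a)) dg_alg" where
  "resolution = koszul_dg (poly_dg A) poly_var"

lemma up_bound_1: "(\<And>i. f i \<in> carrier A) \<Longrightarrow> (\<And>i. i > 1 \<Longrightarrow> f i = \<zero>) \<Longrightarrow> f \<in> up A"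
  by (rule mem_upI) (auto intro!: exI[of _ 1])

lemma poly_var_hpart: "poly_var \<in> hpart (poly_dg A) 0"
  using up_bound_1[of poly_var] by (auto simp: poly_var_def poly_dg_def hpart_one)

lemma cdga_resolution: "cdga resolution"
  unfolding resolution_def by (rule cdg.cdga_koszul[OF cdgI[OF cdga_poly] poly_var_hpart])

lemma poly_linear_mult:
  assumes "x \<in> carrier A" "f \<in> up A" "y \<in> carrier A"
  defines "g \<equiv> (\<lambda>i. if i = 0 then x else if i = 1 then y else \<zero>)"
  shows "(g \<otimes>\<^bsub>poly_dg A\<^esub> f) 0 = x \<otimes> f 0"
    and "(g \<otimes>\<^bsub>poly_dg A\<^esub> f) (Suc n) = x \<otimes> f (Suc n) \<oplus> y \<otimes> f n"
proof -
  have f [simp]: "f i \<in> carrier A" for i using assms(2) mem_upD by blast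
  show "(g \<otimes>\<^bsub>poly_dg A\<^esub> f) 0 = x \<otimes> f 0" using assms by (simp add: poly_dg_def)
  have "finsum A (\<lambda>i. g i \<otimes> f (Suc n - i)) {..Suc n} = finsum A (\<lambda>i. g i \<otimes> f (Suc n - i)) {0, 1}"
    using assms by (intro add.finprod_mono_neutral_cong_right) (auto simp: g_def)
  also have "\<dots> = x \<otimes> f (Suc n) \<oplus> y \<otimes> f n" using assms by simp
  finally show "(g \<otimes>\<^bsub>poly_dg A\<^esub> f) (Suc n) = x \<otimes> f (Suc n) \<oplus> y \<otimes> f n"
    by (simp add: poly_dg_def)
qed

text \<open>The factor \<open>x + Y\<close> is monic in \<open>Y\<close>, so the top coefficient of
  \<open>f\<close> reappears in the product; no assumption on zero divisors in \<open>A\<close>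
  enters.\<close>

lemma poly_linear_torsion_free:
  assumes x: "x \<in> carrier A" and f: "f \<in> up A"
    and 0: "(\<lambda>i. if i = 0 then x else if i = 1 then \<one> else \<zero>) \<otimes>\<^bsub>poly_dg A\<^esub> f = (\<lambda>_. \<zero>)"
  shows "f = (\<lambda>_. \<zero>)"
proof -
  have c [simp]: "f i \<in> carrier A" for i using f mem_upD by blast
  have step: "f (Suc n) = \<zero> \<Longrightarrow> f n = \<zero>" for n
    using poly_linear_mult(2)[OF x f one_closed, of n] fun_cong[OF 0, of "Suc n"] x by simp
  obtain N where N: "bound \<zero> N f" using f bound_upD by blast
  \<comment> \<open>The descent starts at \<open>N + 1\<close>, the first index covered by the
    bound; once \<open>k\<close> exceeds \<open>N + 1\<close>, truncated subtraction stays at index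
    0.\<close>
  have vanish: "f (N + 1 - k) = \<zero>" for k
  proof (induction k)
    case 0
    then show ?case using N by auto
  next
    case (Suc k)
    then show ?case using step[of "N - k"] by (cases "k \<le> N") (auto simp: Suc_diff_le)
  qed
  have "f n = \<zero>" for n
  proof (cases "n \<le> N")
    case True
    then show ?thesis using vanish[of "N + 1 - n"] by simp
  next
    case False
    then show ?thesis using N by (simp add: bound_def)
  qed
  then show ?thesis by auto
qed

text \<open>The map sets \<open>Y\<close> and \<open>eta\<close> to zero, and constants provide
  preimages. If the constant coefficient of a cocycle \<open>f + eta g\<close> is
  \<open>d a\<close>, write \<open>f = f 0 + Y f'\<close>; then the cocycle is the differential of
  \<open>a + eta f'\<close>.\<close>

lemma resolution_proj:
  "(\<lambda>z. fst z 0) \<in> dg_hom resolution A" (is "?p \<in> _")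
  "fibration resolution A (\<lambda>z. fst z 0)"
  "quasi_iso resolution A (\<lambda>z. fst z 0)"
proof -
  let ?P = "poly_dg A"
  have up0: "f \<in> up A \<Longrightarrow> f i \<in> carrier A" for f i by (rule mem_upD)
  have vm0: "(poly_var \<otimes>\<^bsub>?P\<^esub> f) 0 = \<zero>" if "f \<in> up A" for f
    using that up0[OF that] by (simp add: poly_dg_def poly_var_def)
  have vmS: "(poly_var \<otimes>\<^bsub>?P\<^esub> f) (Suc n) = f n" if "f \<in> up A" for f n
  proof -
    have "poly_var = (\<lambda>i::nat. if i = 0 then \<zero> else if i = 1 then \<one> else \<zero>)"
      by (auto simp: poly_var_def)
    then show ?thesis
      using poly_linear_mult(2)[OF zero_closed that one_closed, of n] up0[OF that] by simp
  qed
  show hom: "?p \<in> dg_hom resolution A"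
    by (rule dg_homI)
      (auto simp: resolution_def koszul_dg_def, auto simp: poly_dg_def up0 poly_var_def)
  define emb where "emb = (\<lambda>a i. if i = (0::nat) then a else \<zero>)"
  have emb_up: "emb a \<in> up A" if "a \<in> carrier A" for a
    using that by (intro up_bound_1) (auto simp: emb_def)
  have z_up: "(\<lambda>_. \<zero>) \<in> up A" by (rule up_bound_1) auto
  have emb_hp: "(emb a, \<lambda>_. \<zero>) \<in> hpart resolution n" if "a \<in> hpart A n" for a n
    using that emb_up[of a] z_up hpart_carrier[OF that]
      by (auto simp: resolution_def koszul_dg_def poly_dg_def emb_def)
  have surj: "?p ` hpart resolution n = hpart A n" for n
  proof (intro subset_antisym subsetI)
    fix a assume "a \<in> hpart A n"
    then show "a \<in> ?p ` hpart resolution n"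
      by (intro image_eqI[OF _ emb_hp]) (auto simp: emb_def)
  qed (use dg_homD(6)[OF hom] in auto)
  show "fibration resolution A ?p" using hom surj by (simp add: fibration_def)
  interpret R: cdg resolution by (rule cdgI[OF cdga_resolution])
  have dR: "dif resolution (f, g) = (\<lambda>i. dif A (f i) \<oplus> (poly_var \<otimes>\<^bsub>?P\<^esub> g) i, \<ominus>\<^bsub>?P\<^esub> (\<lambda>i. dif A (g i)))"
    for f g by (simp add: resolution_def koszul_dg_def poly_dg_def)
  have cR: "carrier resolution = up A \<times> up A" by (simp add: resolution_def koszul_dg_def poly_dg_def)
  have hR: "hpart resolution n = {f \<in> up A. \<forall>i. f i \<in> hpart A n} \<times> {f \<in> up
    A. \<forall>i. f i \<in> hpart A (n + 1)}"
    for n by (simp add: resolution_def koszul_dg_def poly_dg_def)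
  have zR: "\<zero>\<^bsub>resolution\<^esub> = (\<lambda>_. \<zero>, \<lambda>_. \<zero>)" by (simp add: resolution_def koszul_dg_def poly_dg_def)
  have aR: "(f, g) \<oplus>\<^bsub>resolution\<^esub> (f', g') = (\<lambda>i. f i \<oplus> f' i, \<lambda>i. g i \<oplus> g' i)" for f g f' g'
    by (simp add: resolution_def koszul_dg_def poly_dg_def)
  interpret P: cdg ?P by (rule cdgI[OF cdga_poly])
  have cP: "carrier ?P = up A" by (simp add: poly_dg_def)
  have negP: "\<ominus>\<^bsub>?P\<^esub> f = (\<lambda>i. \<ominus> f i)" if "f \<in> up A" for f
    using P.minus_equality[of "\<lambda>i. \<ominus> f i" f] that up_a_inv_closed[OF that] up0[OF that]
    by (auto simp: poly_dg_def l_neg)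
  show "quasi_iso resolution A ?p"
  proof (subst quasi_iso_iff[OF cdga_resolution cdga hom], intro conjI allI ballI impI)
    fix n y assume y: "y \<in> cocycles A n"
    have e: "(\<lambda>i. dif A (emb y i)) = (\<lambda>_. \<zero>)"
      using y by (auto simp: emb_def cocycles_def)
    have "poly_var \<otimes>\<^bsub>?P\<^esub> (\<lambda>_. \<zero>) = (\<lambda>_. \<zero>)"
      by (simp add: poly_dg_def poly_var_def)
    moreover have "\<ominus>\<^bsub>?P\<^esub> (\<lambda>_. \<zero>) = (\<lambda>_. \<zero>)" using negP[OF z_up] by simp
    ultimately have "(emb y, \<lambda>_. \<zero>) \<in> cocycles resolution n"
      using y emb_hp[of y n] fun_cong[OF e] by (simp add: cocycles_def dR zR)
    moreover have "y \<ominus> ?p (emb y, \<lambda>_. \<zero>) \<in> boundaries A n"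
      using cocycles_carrier[OF y] zero_boundaries by (simp add: emb_def a_minus_def r_neg)
    ultimately show "\<exists>x\<in>cocycles resolution n. y \<ominus> ?p x \<in> boundaries A n" by blast
  next
    fix n x assume x: "x \<in> cocycles resolution n" "?p x \<in> boundaries A n"
    obtain f g where fg: "x = (f, g)" "f \<in> up A" "g \<in> up A" "\<And>i. f i \<in> hpart A n"
      "\<And>i. g i \<in> hpart A (n + 1)"
      using x(1) by (auto simp: cocycles_def hR)
    have dz: "(\<lambda>i. dif A (f i) \<oplus> (poly_var \<otimes>\<^bsub>?P\<^esub> g) i) = (\<lambda>_. \<zero>)"
      using x(1) by (simp add: fg(1) cocycles_def dR zR)
    \<comment> \<open>Coefficients of the cocycle equation \<open>d f + Y g = 0\<close>:
      multiplication by \<open>Y\<close> shifts the index by one.\<close>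
    have g_eq: "\<ominus> dif A (f (Suc i)) = g i" for i
      using fun_cong[OF dz, of "Suc i"] up0[OF fg(2)] up0[OF fg(3)] minus_equality[of "g i" "dif A
        (f (Suc i))"]
      by (simp add: vmS[OF fg(3)] a_comm)
    obtain a where a: "a \<in> hpart A (n - 1)" "f 0 = dif A a"
      using x(2) by (auto simp: fg(1) boundaries_def)
    define f' where "f' = (\<lambda>i. f (Suc i))"
    obtain N where "bound \<zero> N f" using fg(2) bound_upD by blast
    then have "bound \<zero> N f'" by (auto simp: f'_def bound_def)
    then have f': "f' \<in> up A" using fg(2) up0 by (auto simp: f'_def)
    have ac: "a \<in> carrier A" using a hpart_carrier by blast
    have "(emb a, f') \<in> hpart resolution (n - 1)"
      using emb_up[OF ac] f' a fg(4) by (auto simp: hR emb_def f'_def)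
    moreover have "x = dif resolution (emb a, f')"
    proof -
      have "f i = dif A (emb a i) \<oplus> (poly_var \<otimes>\<^bsub>?P\<^esub> f') i" for i
        by (cases i) (simp_all add: vm0[OF f'] vmS[OF f'] a(2) ac emb_def, simp add: f'_def up0[OF
          fg(2)])
      moreover have "\<ominus>\<^bsub>?P\<^esub> (\<lambda>i. dif A (f' i)) = g"
        using up_map_closed[OF f', of "dif A"] g_eq by (simp add: negP) (simp add: f'_def)
      ultimately show ?thesis by (simp add: fg(1) dR) auto
    qed
    ultimately show "x \<in> boundaries resolution n" by (auto simp: boundaries_def)
  qed
qed

end

text \<open>With the zero ideal, \<open>dg_quotient\<close> turns into transport of structure along
  an injection.\<close>

lemma dg_quotient_transport:
  fixes A :: "('k::field_char_0, 'a) dg_alg"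
  assumes A: "cdga A" and j: "inj_on j (carrier A)"
  shows "dg_quotient A {\<zero>\<^bsub>A\<^esub>} j"
proof -
  interpret A: cdg A by (rule cdgI[OF A])
  interpret I: ideal "{\<zero>\<^bsub>A\<^esub>}" A by (rule A.zeroideal)
  show ?thesis
    by unfold_locales (use inj_onD[OF j] in auto)
qed

text \<open>The lifting property is tested against \<open>A[Y, \<eta>] \<rightarrow> A\<close> with \<open>d \<eta> = Y\<close>, through which \<open>s\<close> acts as
  multiplication by \<open>c s + Y\<close>.\<close>

lemma cofibration_torsion_free:
  fixes S A :: "('k::field_char_0, 'u) dg_alg"
  assumes A: "cdga A" and inf: "infinite (UNIV :: 'u set)" and c: "cofibration S A c"
    and u: "u \<in> dg_hom S (poly_dg A)" and u0: "\<And>s. s \<in> carrier S \<Longrightarrow> u s 0 = c s"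
    and s: "s \<in> carrier S" "u s = (\<lambda>i. if i = 0 then c s else if i = 1 then \<one>\<^bsub>A\<^esub> else \<zero>\<^bsub>A\<^esub>)"
    and b: "b \<in> carrier A" "c s \<otimes>\<^bsub>A\<^esub> b = \<zero>\<^bsub>A\<^esub>"
  shows "b = \<zero>\<^bsub>A\<^esub>"
proof -
  interpret A: cdg A by (rule cdgI[OF A])
  interpret K: cdg A.resolution by (rule cdgI[OF A.cdga_resolution])
  interpret P: cdg "poly_dg A" by (rule cdgI[OF A.cdga_poly])
  let ?K = "A.resolution"
  have cK: "carrier ?K = up A \<times> up A" by (simp add: A.resolution_def koszul_dg_def poly_dg_def)
  have cP: "carrier (poly_dg A) = up A" by (simp add: poly_dg_def)
  \<comment> \<open>Cofibrations lift only against algebras on \<open>'u\<close>, so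
    \<open>A[Y, eta]\<close> is copied into \<open>'u\<close> along an injection
    \<open>j\<close>.\<close>
  obtain j0 :: "(nat \<Rightarrow> 'u) \<Rightarrow> 'u" where j0: "inj_on j0 (up A)" using inj_up[OF inf] by blast
  obtain p :: "'u \<times> 'u \<Rightarrow> 'u" where p: "inj p" using inj_pairing[OF inf] by blast
  define j where "j = (\<lambda>(f, g). p (j0 f, j0 g))"
  have j: "inj_on j (carrier ?K)"
    unfolding cK
  proof (rule inj_onI)
    fix x y assume "x \<in> up A \<times> up A" "y \<in> up A \<times> up A" "j x = j y"
    moreover obtain f g f' g' where "x = (f, g)" "y = (f', g')" by fastforce
    ultimately show "x = y"
      using injD[OF p, of "(j0 f, j0 g)" "(j0 f', j0 g')"] inj_onD[OF j0, of f f'] inj_onD[OF j0, of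
        g g']
      by (simp add: j_def)
  qed
  interpret Q: dg_quotient ?K "{\<zero>\<^bsub>?K\<^esub>}" j
    by (rule dg_quotient_transport[OF A.cdga_resolution j])
  let ?\<pi> = "\<lambda>z. fst z 0"
  note \<pi> = A.resolution_proj
  obtain q where q: "q \<in> dg_hom Q.B A" "\<And>z. z \<in> carrier ?K \<Longrightarrow> q (j z) = ?\<pi> z"
    using Q.factor[OF A \<pi>(1)] dg_hom_zero[OF A.cdga_resolution A \<pi>(1)] by blast
  obtain r where r: "r \<in> dg_hom Q.B ?K" "\<And>z. z \<in> carrier ?K \<Longrightarrow> r (j z) = z"
    using Q.factor[OF A.cdga_resolution dg_hom_id] by blast
  have qr: "q z = ?\<pi> (r z)" if "z \<in> carrier Q.B" for z
    using that q(2) r(2) by (auto simp: Q.B_carrier)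
  have jr: "j (r z) = z" if "z \<in> carrier Q.B" for z
    using that r(2) by (auto simp: Q.B_carrier)
  interpret QB: cdg Q.B by (rule cdgI[OF Q.cdga_B])
  have "fibration Q.B A q"
    unfolding fibration_def
  proof (intro conjI allI impI q(1))
    fix n :: int assume "n < 0"
    then show "q ` hpart Q.B n = hpart A n"
      using \<pi>(2) q(2) K.hpart_carrier by (simp add: fibration_def
        Q.B_hpart image_image cong: image_cong_simp)
  qed
  moreover have "quasi_iso Q.B A q"
  proof -
    note qi = \<pi>(3)[unfolded quasi_iso_iff[OF A.cdga_resolution A \<pi>(1)]]
    show ?thesis
    proof (subst quasi_iso_iff[OF Q.cdga_B A q(1)], intro conjI allI ballI impI)
      fix n x assume x: "x \<in> cocycles Q.B n" "q x \<in> boundaries A n"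
      have "r x \<in> cocycles ?K n" by (rule dg_hom_cocycles[OF Q.cdga_B A.cdga_resolution r(1) x(1)])
      then have "r x \<in> boundaries ?K n" using qi x qr[OF QB.cocycles_carrier[OF x(1)]] by auto
      from dg_hom_boundaries[OF A.cdga_resolution Q.dg_hom_\<phi> this]
      show "x \<in> boundaries Q.B n" using jr QB.cocycles_carrier[OF x(1)] by simp
    next
      fix n y assume y: "y \<in> cocycles A n"
      then obtain x where x: "x \<in> cocycles ?K n" "y \<ominus>\<^bsub>A\<^esub> ?\<pi> x \<in> boundaries A n" using qi by blast
      show "\<exists>x\<in>cocycles Q.B n. y \<ominus>\<^bsub>A\<^esub> q x \<in> boundaries A n"
        by (rule bexI[OF _ dg_hom_cocycles[OF A.cdga_resolution Q.cdga_B Q.dg_hom_\<phi> x(1)]])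
          (use x q(2)[OF K.cocycles_carrier[OF x(1)]] in simp)
    qed
  qed
  \<comment> \<open>\<open>A[Y]\<close> is the part of \<open>A[Y, eta]\<close> without
    \<open>eta\<close>; composed with \<open>u\<close> and \<open>j\<close> it gives the top side of
    the lifting square.\<close>
  moreover have emb: "(\<lambda>f. (f, \<zero>\<^bsub>poly_dg A\<^esub>)) \<in> dg_hom (poly_dg A) ?K"
    by (rule dg_homI) (use P.hpart_carrier[OF A.poly_var_hpart] in \<open>auto simp:
      A.resolution_def koszul_dg_def\<close>)
  then have ju: "(\<lambda>s. j (u s, \<zero>\<^bsub>poly_dg A\<^esub>)) \<in> dg_hom S Q.B"
    using dg_hom_compose[OF u dg_hom_compose[OF emb Q.dg_hom_\<phi>]] by simp
  moreover have uK: "(u s, \<zero>\<^bsub>poly_dg A\<^esub>) \<in> carrier ?K" if "s \<in> carrier S" for s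
    using dg_homD(1)[OF u that] P.zero_closed by (simp add: cK cP)
  then have "\<forall>s\<in>carrier S. q (j (u s, \<zero>\<^bsub>poly_dg A\<^esub>)) = c s"
    using q(2) u0 by simp
  \<comment> \<open>The bottom side of the square is the identity of \<open>A\<close>, so the lift
    \<open>h\<close> is a section of \<open>q\<close>; it sends \<open>c s\<close> to the copy of
    \<open>c s + Y\<close>.\<close>
  ultimately obtain h where h: "h \<in> dg_hom A Q.B" "\<And>s. s \<in> carrier S \<Longrightarrow> h (c s) = j (u s, \<zero>\<^bsub>poly_dg A\<^esub>)"
    "\<And>y. y \<in> carrier A \<Longrightarrow> q (h y) = y"
    using c Q.cdga_B A dg_hom_id[of A] unfolding cofibration_def by (smt (verit, best))
  have c_hom: "c \<in> dg_hom S A" using c by (simp add: cofibration_def)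
  obtain f g where fg: "r (h b) = (f, g)" "f \<in> up A" "g \<in> up A"
    using dg_homD(1)[OF r(1) dg_homD(1)[OF h(1) b(1)]] by (auto simp: cK)
  have cs: "c s \<in> carrier A" using dg_homD(1)[OF c_hom s(1)] .
  have hb: "h b = j (f, g)" using jr[OF dg_homD(1)[OF h(1) b(1)]] fg(1) by simp
  \<comment> \<open>Since \<open>c s\<close> kills \<open>b\<close>, the monic
    \<open>c s + Y\<close> kills the part \<open>f\<close> of \<open>h b\<close> without
    \<open>eta\<close>. Hence \<open>f\<close> is zero, and \<open>b\<close> is its constant
    coefficient.\<close>
  have "r (h (c s) \<otimes>\<^bsub>Q.B\<^esub> h b) = \<zero>\<^bsub>?K\<^esub>"
    using dg_homD(2)[OF h(1) cs b(1)] b(2) dg_hom_zero[OF A Q.cdga_B h(1)]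
      dg_hom_zero[OF Q.cdga_B A.cdga_resolution r(1)] by simp
  moreover have "r (h (c s) \<otimes>\<^bsub>Q.B\<^esub> h b) = (u s, \<zero>\<^bsub>poly_dg A\<^esub>) \<otimes>\<^bsub>?K\<^esub> (f, g)"
    using dg_homD(2)[OF r(1) dg_homD(1)[OF h(1) cs] dg_homD(1)[OF h(1) b(1)]] fg(1)
      h(2)[OF s(1)] r(2)[OF uK[OF s(1)]] by simp
  moreover have "fst ((u s, \<zero>\<^bsub>poly_dg A\<^esub>) \<otimes>\<^bsub>?K\<^esub> (f, g)) = u s \<otimes>\<^bsub>poly_dg A\<^esub> f"
    by (simp add: A.resolution_def koszul_dg_def)
  ultimately have "u s \<otimes>\<^bsub>poly_dg A\<^esub> f = \<zero>\<^bsub>poly_dg A\<^esub>"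
    by (simp add: A.resolution_def koszul_dg_def)
  then have "f = (\<lambda>_. \<zero>\<^bsub>A\<^esub>)"
    using A.poly_linear_torsion_free[OF cs fg(2)] by (simp add: s(2)) (simp add: poly_dg_def)
  then show "b = \<zero>\<^bsub>A\<^esub>"
    using h(3)[OF b(1)] qr[OF dg_homD(1)[OF h(1) b(1)]] fg(1) by simp
qed

section \<open>The derived join with the zero locus of a function\<close>

lemma (in abelian_group) add_minus_cancel:
  "a \<in> carrier G \<Longrightarrow> b \<in> carrier G \<Longrightarrow> a \<oplus> (b \<ominus> a) = b"
  using a_lcomm[of a b "\<ominus> a"] by (simp add: a_minus_def r_neg)

lemma (in cdg) ideal_multiples:
  assumes x: "x \<in> hpart A 0"
  shows "ideal ((\<lambda>m. x \<otimes> m) ` carrier A) A"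
proof (rule idealI)
  have xc [simp]: "x \<in> carrier A" using hpart_carrier[OF x] .
  have comm: "x \<otimes> m = m \<otimes> x" if "m \<in> carrier A" for m using hpart_0_comm[OF x that] .
  show "subgroup ((\<lambda>m. x \<otimes> m) ` carrier A) (add_monoid A)"
  proof
    show "\<one>\<^bsub>add_monoid A\<^esub> \<in> (\<lambda>m. x \<otimes> m) ` carrier A" by (auto intro!: image_eqI[of _ _ \<zero>])
    fix a assume "a \<in> (\<lambda>m. x \<otimes> m) ` carrier A"
    then obtain m where m: "m \<in> carrier A" "a = x \<otimes> m" by blast
    have "\<ominus> a = x \<otimes> (\<ominus> m)" using m by (simp add: r_minus)
    then show "inv\<^bsub>add_monoid A\<^esub> a \<in> (\<lambda>m. x \<otimes> m) ` carrier A" using m by (auto simp: a_inv_def)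
    fix b assume "b \<in> (\<lambda>m. x \<otimes> m) ` carrier A"
    then obtain m' where m': "m' \<in> carrier A" "b = x \<otimes> m'" by blast
    show "a \<otimes>\<^bsub>add_monoid A\<^esub> b \<in> (\<lambda>m. x \<otimes> m) ` carrier A"
      using m m' by (auto intro!: image_eqI[of _ _ "m \<oplus> m'"] simp: r_distr)
  qed auto
next
  fix a z assume "a \<in> (\<lambda>m. x \<otimes> m) ` carrier A" and z: "z \<in> carrier A"
  then obtain m where m: "m \<in> carrier A" "a = x \<otimes> m" by blast
  have xc: "x \<in> carrier A" using hpart_carrier[OF x] .
  show "a \<otimes> z \<in> (\<lambda>m. x \<otimes> m) ` carrier A"
    using m z xc by (auto intro!: image_eqI[of _ _ "m \<otimes> z"] simp: m_assoc)
  have "z \<otimes> a = x \<otimes> (z \<otimes> m)"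
    using m z xc hpart_0_comm[OF x z] by (simp add: m_assoc[symmetric])
  then show "z \<otimes> a \<in> (\<lambda>m. x \<otimes> m) ` carrier A" using m z by auto
qed (rule ring_axioms)

text \<open>The universal property of a pushout applies only to targets on \<open>'u\<close>.
  Therefore the quotient is not formed from cosets as sets: \<open>\<phi>\<close> selects one
  representative of each coset, again an element of \<open>'u\<close>.\<close>

lemma dg_quotient_multiples:
  fixes A :: "('k::field_char_0, 'u) dg_alg"
  assumes A: "cdga A" and x: "x \<in> hpart A 0"
  obtains \<phi> :: "'u \<Rightarrow> 'u" where "dg_quotient A ((\<lambda>m. x \<otimes>\<^bsub>A\<^esub> m) ` carrier A) \<phi>"
proof -
  interpret A: cdg A by (rule cdgI[OF A])
  let ?I = "(\<lambda>m. x \<otimes>\<^bsub>A\<^esub> m) ` carrier A"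
  interpret I: ideal ?I A by (rule A.ideal_multiples[OF x])
  define \<phi> where "\<phi> a = (SOME b. b \<in> carrier A \<and> a \<ominus>\<^bsub>A\<^esub> b \<in> ?I)" for a
  have \<phi>: "\<phi> a \<in> carrier A \<and> a \<ominus>\<^bsub>A\<^esub> \<phi> a \<in> ?I" if "a \<in> carrier A" for a
    unfolding \<phi>_def
    by (rule someI[of _ a]) (use that I.zero_closed in \<open>simp add: a_minus_def A.r_neg\<close>)
  have sym: "b \<ominus>\<^bsub>A\<^esub> a \<in> ?I" if "a \<ominus>\<^bsub>A\<^esub> b \<in> ?I" "a \<in> carrier A" "b \<in> carrier A" for a b
    using I.a_inv_closed[OF that(1)] that by (simp add: a_minus_def A.minus_add A.a_comm)
  have trans: "a \<ominus>\<^bsub>A\<^esub> c \<in> ?I" if "a \<ominus>\<^bsub>A\<^esub> b \<in> ?I" "b \<ominus>\<^bsub>A\<^esub> c \<in> ?I"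
    "a \<in> carrier A" "b \<in> carrier A" "c \<in> carrier A" for a b c
  proof -
    have "(a \<ominus>\<^bsub>A\<^esub> b) \<oplus>\<^bsub>A\<^esub> (b \<ominus>\<^bsub>A\<^esub> c) = a \<ominus>\<^bsub>A\<^esub> c"
      using that(3-5) by (simp add: a_minus_def A.a_assoc A.r_neg1)
    then show ?thesis using I.a_closed[OF that(1,2)] by simp
  qed
  have "dg_quotient A ?I \<phi>"
  proof unfold_locales
    fix y assume "y \<in> ?I"
    then obtain m where m: "m \<in> carrier A" "y = x \<otimes>\<^bsub>A\<^esub> m" by blast
    show "dif A y \<in> ?I" using m A.dif_hpart_0_mult[OF x m(1)] by auto
    show "A.comp n y \<in> ?I" for n using m A.comp_hpart_0_mult[OF x m(1)] by auto
  next
    fix a b assume ab: "a \<in> carrier A" "b \<in> carrier A"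
    show "\<phi> a = \<phi> b \<longleftrightarrow> a \<ominus>\<^bsub>A\<^esub> b \<in> ?I"
    proof
      assume "\<phi> a = \<phi> b"
      then show "a \<ominus>\<^bsub>A\<^esub> b \<in> ?I"
        using \<phi>[OF ab(1)] \<phi>[OF ab(2)] sym[of b "\<phi> b"] trans[of a "\<phi> b" b] ab by simp
    next
      assume i: "a \<ominus>\<^bsub>A\<^esub> b \<in> ?I"
      have "(c \<in> carrier A \<and> a \<ominus>\<^bsub>A\<^esub> c \<in> ?I) \<longleftrightarrow> (c \<in> carrier A \<and> b \<ominus>\<^bsub>A\<^esub> c \<in> ?I)" for c
        using trans[OF i] trans[OF sym[OF i]] ab by blast
      then show "\<phi> a = \<phi> b" unfolding \<phi>_def by simp
    qed
  qed
  then show thesis using that by blast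
qed

text \<open>As \<open>N\<close> is \<open>S\<close> modulo \<open>s0\<close>, base change turns it
  into \<open>M\<close> modulo \<open>f s0\<close>. The pushout \<open>Z\<close> is known only
  through its universal property, so the quotient \<open>Q.B\<close> of \<open>M\<close> is compared
  with it: \<open>h\<close> from \<open>Z\<close> to \<open>Q.B\<close> and \<open>k\<close> back
  satisfy \<open>k (h z) = z\<close>, and all three claims are read off from the quotient.\<close>

lemma pushout_along_quotient:
  fixes S M N Z :: "('k::field_char_0, 'u) dg_alg"
  assumes S: "cdga S" and M: "cdga M" and N: "cdga N"
    and f: "f \<in> dg_hom S M" and g: "g \<in> dg_hom S N"
    and po: "is_pushout S M N f g Z zM zN"
    and s0: "s0 \<in> hpart S 0" "g s0 = \<zero>\<^bsub>N\<^esub>"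
    and surj: "\<And>n y. y \<in> hpart N n \<Longrightarrow> \<exists>s\<in>hpart S n. g s = y"
    and ker: "\<And>s. s \<in> carrier S \<Longrightarrow> g s = \<zero>\<^bsub>N\<^esub> \<Longrightarrow> \<exists>t\<in>carrier S. s = s0 \<otimes>\<^bsub>S\<^esub> t"
  shows "zM ` hpart M n = hpart Z n"
    and "b \<in> hpart M n \<Longrightarrow> zM b = \<zero>\<^bsub>Z\<^esub> \<Longrightarrow> \<exists>b'\<in>hpart M n. b = f s0 \<otimes>\<^bsub>M\<^esub> b'"
    and "b \<in> carrier M \<Longrightarrow> zM (f s0 \<otimes>\<^bsub>M\<^esub> b) = \<zero>\<^bsub>Z\<^esub>"
proof -
  interpret S: cdg S by (rule cdgI[OF S])
  interpret M: cdg M by (rule cdgI[OF M])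
  interpret N: cdg N by (rule cdgI[OF N])
  have Z: "cdga Z" and zM: "zM \<in> dg_hom M Z" and zN: "zN \<in> dg_hom N Z"
    and sq: "\<And>s. s \<in> carrier S \<Longrightarrow> zM (f s) = zN (g s)"
    using po unfolding is_pushout_def by blast+
  interpret Z: cdg Z by (rule cdgI[OF Z])
  let ?x = "f s0"
  have x: "?x \<in> hpart M 0" using dg_homD(6)[OF f s0(1)] .
  have xc: "?x \<in> carrier M" using M.hpart_carrier[OF x] .
  have s0c: "s0 \<in> carrier S" using S.hpart_carrier[OF s0(1)] .
  show kill: "zM (?x \<otimes>\<^bsub>M\<^esub> b) = \<zero>\<^bsub>Z\<^esub>" if "b \<in> carrier M" for b
    using dg_homD(2)[OF zM xc that] sq[OF s0c] dg_hom_zero[OF N Z zN] dg_homD(1)[OF zM that]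
    by (simp add: s0(2))
  obtain \<phi> :: "'u \<Rightarrow> 'u" where "dg_quotient M ((\<lambda>m. ?x \<otimes>\<^bsub>M\<^esub> m) ` carrier M) \<phi>"
    using dg_quotient_multiples[OF M x] by blast
  then interpret Q: dg_quotient M "(\<lambda>m. ?x \<otimes>\<^bsub>M\<^esub> m) ` carrier M" \<phi> .
  interpret B: cdg Q.B by (rule cdgI[OF Q.cdga_B])
  note comp_f = dg_hom_compose[OF f Q.dg_hom_\<phi>]
  \<comment> \<open>In the quotient the image of \<open>s\<close> depends only on
    \<open>g s\<close>, so it descends to a map \<open>v\<close> on \<open>N\<close>, computed on
    chosen preimages \<open>\<sigma> y\<close>.\<close>
  have f_ker: "\<phi> (f s) = \<phi> (f s')" if ss: "s \<in> carrier S" "s' \<in> carrier S" "g s = g s'" for s s'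
  proof -
    have "g (s \<ominus>\<^bsub>S\<^esub> s') = \<zero>\<^bsub>N\<^esub>"
      using dg_hom_minus[OF S N g ss(1,2)] ss dg_homD(1)[OF g] by (simp add: a_minus_def N.r_neg)
    then obtain t where t: "t \<in> carrier S" "s \<ominus>\<^bsub>S\<^esub> s' = s0 \<otimes>\<^bsub>S\<^esub> t"
      using ker[of "s \<ominus>\<^bsub>S\<^esub> s'"] ss by auto
    have "f s \<ominus>\<^bsub>M\<^esub> f s' = ?x \<otimes>\<^bsub>M\<^esub> f t"
      using dg_hom_minus[OF S M f ss(1,2)] t dg_homD(2)[OF f s0c t(1)] by simp
    then show ?thesis using dg_homD(1)[OF f] ss t(1) by (intro Q.eqI) auto
  qed
  have surj_c: "\<exists>s\<in>carrier S. g s = y" if "y \<in> carrier N" for y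
    using that
  proof (induction y rule: N.homogeneous_induct)
    case zero
    then show ?case using dg_hom_zero[OF S N g] by blast
  next
    case (add y z)
    then obtain s t where "s \<in> carrier S" "g s = y" "t \<in> carrier S" "g t = z" by blast
    then show ?case using dg_homD(3)[OF g, of s t] by (intro bexI[of _ "s \<oplus>\<^bsub>S\<^esub> t"]) auto
  next
    case (homogeneous y n)
    then show ?case using surj S.hpart_carrier by blast
  qed
  define \<sigma> where "\<sigma> y = (SOME s. s \<in> carrier S \<and> g s = y)" for y
  have \<sigma>: "\<sigma> y \<in> carrier S \<and> g (\<sigma> y) = y" if "y \<in> carrier N" for y
    unfolding \<sigma>_def using someI_ex[of "\<lambda>s. s \<in> carrier S \<and> g s = y"] surj_c[OF that] by blast
  define v where "v y = \<phi> (f (\<sigma> y))" for y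
  have v: "v (g s) = \<phi> (f s)" if "s \<in> carrier S" for s
    unfolding v_def using \<sigma>[OF dg_homD(1)[OF g that]] that by (intro f_ker) auto
  have "v \<in> dg_hom N Q.B"
  proof (rule dg_homI)
    fix y assume "y \<in> carrier N"
    then obtain s where s: "s \<in> carrier S" "y = g s" using surj_c by blast
    show "v y \<in> carrier Q.B" using s v dg_homD(1)[OF comp_f] by simp
    show "v (dif N y) = dif Q.B (v y)"
      using s v[OF s(1)] v[of "dif S s"] dg_homD(7)[OF comp_f] dg_homD(7)[OF g, symmetric] by simp
    show "v (c \<odot>\<^bsub>N\<^esub> y) = c \<odot>\<^bsub>Q.B\<^esub> v y" for c
      using s v[OF s(1)] v[of "c \<odot>\<^bsub>S\<^esub> s"] dg_homD(5)[OF comp_f] dg_homD(5)[OF g, symmetric] by simp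
    fix z assume "z \<in> carrier N"
    then obtain t where t: "t \<in> carrier S" "z = g t" using surj_c by blast
    show "v (y \<otimes>\<^bsub>N\<^esub> z) = v y \<otimes>\<^bsub>Q.B\<^esub> v z"
      using s t v[OF s(1)] v[OF t(1)] v[of "s \<otimes>\<^bsub>S\<^esub> t"] dg_homD(2)[OF comp_f]
        dg_homD(2)[OF g, symmetric] by simp
    show "v (y \<oplus>\<^bsub>N\<^esub> z) = v y \<oplus>\<^bsub>Q.B\<^esub> v z"
      using s t v[OF s(1)] v[OF t(1)] v[of "s \<oplus>\<^bsub>S\<^esub> t"] dg_homD(3)[OF comp_f]
        dg_homD(3)[OF g, symmetric] by simp
  next
    show "v \<one>\<^bsub>N\<^esub> = \<one>\<^bsub>Q.B\<^esub>" using v[of "\<one>\<^bsub>S\<^esub>"] dg_homD(4)[OF comp_f] dg_homD(4)[OF g] by simp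
    fix n y assume "y \<in> hpart N n"
    then obtain s where "s \<in> hpart S n" "y = g s" using surj by blast
    then show "v y \<in> hpart Q.B n" using v S.hpart_carrier dg_homD(6)[OF comp_f] by auto
  qed
  then obtain h where h: "h \<in> dg_hom Z Q.B" "\<And>m. m \<in> carrier M \<Longrightarrow> h (zM m) = \<phi> m"
    "\<And>y. y \<in> carrier N \<Longrightarrow> h (zN y) = v y"
    using po Q.cdga_B Q.dg_hom_\<phi> v unfolding is_pushout_def by (smt (verit, best))
  obtain k where k: "k \<in> dg_hom Q.B Z" "\<And>m. m \<in> carrier M \<Longrightarrow> k (\<phi> m) = zM m"
    using Q.factor[OF Z zM] kill by (metis (no_types, lifting) imageE)
  have kv: "k (v y) = zN y" if "y \<in> carrier N" for y
    using surj_c[OF that] v k(2) dg_homD(1)[OF f] sq by auto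
  \<comment> \<open>Uniqueness for the cocone formed by \<open>zM\<close> and \<open>zN\<close>
    themselves: both the identity and \<open>k\<close> after \<open>h\<close> mediate it.\<close>
  obtain h0 where h0: "\<And>h'. h' \<in> dg_hom Z Z \<Longrightarrow> (\<forall>m\<in>carrier M. h' (zM m) = zM m) \<Longrightarrow>
      (\<forall>y\<in>carrier N. h' (zN y) = zN y) \<Longrightarrow> \<forall>z\<in>carrier Z. h' z = h0 z"
    using po Z zM zN sq unfolding is_pushout_def by (smt (verit, best))
  have "\<forall>z\<in>carrier Z. k (h z) = h0 z"
    using h0[OF dg_hom_compose[OF h(1) k(1)]] h k(2) kv by simp
  moreover have "\<forall>z\<in>carrier Z. z = h0 z"
    using h0[OF dg_hom_id] by simp
  ultimately have kh: "k (h z) = z" if "z \<in> carrier Z" for z using that by metis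
  show "zM ` hpart M n = hpart Z n"
  proof (intro subset_antisym subsetI)
    fix z assume z: "z \<in> hpart Z n"
    then obtain m where m: "m \<in> hpart M n" "h z = \<phi> m"
      using dg_homD(6)[OF h(1) z] by (auto simp: Q.B_hpart)
    then have "z = zM m" using kh[OF Z.hpart_carrier[OF z]] k(2) M.hpart_carrier by metis
    then show "z \<in> zM ` hpart M n" using m by blast
  qed (use dg_homD(6)[OF zM] in auto)
  show "\<exists>b'\<in>hpart M n. b = ?x \<otimes>\<^bsub>M\<^esub> b'" if b: "b \<in> hpart M n" "zM b = \<zero>\<^bsub>Z\<^esub>"
  proof -
    have bc: "b \<in> carrier M" using M.hpart_carrier b by blast
    have "\<phi> b = \<phi> \<zero>\<^bsub>M\<^esub>"
      using h(2)[OF bc] h(2)[OF M.zero_closed] b(2) dg_hom_zero[OF M Z zM] by simp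
    then obtain m where m: "m \<in> carrier M" "b = ?x \<otimes>\<^bsub>M\<^esub> m"
      using Q.eq_iff[OF bc M.zero_closed] bc by (auto simp: a_minus_def)
    \<comment> \<open>The cofactor \<open>m\<close> may be inhomogeneous. As \<open>f s0\<close> has
      degree 0, the degree \<open>n\<close> component of \<open>m\<close> is a cofactor too.\<close>
    have "b = M.comp n b" using M.comp_hpart[OF b(1)] by simp
    also have "\<dots> = ?x \<otimes>\<^bsub>M\<^esub> M.comp n m" using M.comp_hpart_0_mult[OF x m(1)] m(2) by simp
    finally show ?thesis using M.comp_props(1)[OF m(1)] by blast
  qed
qed

text \<open>The situation of the join of \<open>Spec M\<close> with the zero locus \<open>Spec N\<close> of \<open>s\<^sub>0 \<in> S\<close>, when \<open>M\<close>
  resolves a subalgebra of \<open>R\<close>.\<close>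

locale join_step =
  fixes S M N Z N' J R :: "('k::field_char_0, 'u) dg_alg"
    and c g zM zN w p rM rN \<psi> i :: "'u \<Rightarrow> 'u" and s0 :: 'u
  assumes S: "cdga S" and M: "cdga M" and N: "cdga N" and N': "cdga N'" and R: "cdga R"
    and c: "c \<in> dg_hom S M" and g: "g \<in> dg_hom S N" and \<psi>: "\<psi> \<in> dg_hom M R" and i: "i \<in> dg_hom S R"
    and po: "is_pushout S M N c g Z zM zN"
    and w: "quasi_iso N N' w" and p: "fibration N' Z p" and pw: "\<And>y. y \<in> carrier N \<Longrightarrow> p (w y) = zN y"
    and pb: "is_pullback M N' Z zM p J rM rN"
    and \<psi>c: "\<And>s. s \<in> carrier S \<Longrightarrow> \<psi> (c s) = i s"
    and s0: "s0 \<in> hpart S 0" "g s0 = \<zero>\<^bsub>N\<^esub>"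
    and surj: "\<And>n y. y \<in> hpart N n \<Longrightarrow> \<exists>s\<in>hpart S n. g s = y"
    and ker: "\<And>s. s \<in> carrier S \<Longrightarrow> g s = \<zero>\<^bsub>N\<^esub> \<Longrightarrow> \<exists>t\<in>carrier S. s = s0 \<otimes>\<^bsub>S\<^esub> t"
    and torsion_free: "\<And>b. b \<in> carrier M \<Longrightarrow> c s0 \<otimes>\<^bsub>M\<^esub> b = \<zero>\<^bsub>M\<^esub> \<Longrightarrow> b = \<zero>\<^bsub>M\<^esub>"
    and M_acyclic: "\<And>n m. n < 0 \<Longrightarrow> m \<in> cocycles M n \<Longrightarrow> m \<in> boundaries M n"
    and M_inj: "\<And>m. m \<in> hpart M 0 \<Longrightarrow> \<psi> m = \<zero>\<^bsub>R\<^esub> \<Longrightarrow> m \<in> boundaries M 0"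
    and N_deg0: "\<And>n. n \<noteq> 0 \<Longrightarrow> hpart N n = {\<zero>\<^bsub>N\<^esub>}"
    and R_deg0: "\<And>n. n \<noteq> 0 \<Longrightarrow> hpart R n = {\<zero>\<^bsub>R\<^esub>}"
    and R_reg: "\<And>r. r \<in> carrier R \<Longrightarrow> i s0 \<otimes>\<^bsub>R\<^esub> r = \<zero>\<^bsub>R\<^esub> \<Longrightarrow> r = \<zero>\<^bsub>R\<^esub>"
    and R_div: "\<And>s r. s \<in> carrier S \<Longrightarrow> r \<in> carrier R \<Longrightarrow> i s = i s0 \<otimes>\<^bsub>R\<^esub> r \<Longrightarrow> g s = \<zero>\<^bsub>N\<^esub>"
begin

sublocale S: cdg S by (rule cdgI[OF S])
sublocale M: cdg M by (rule cdgI[OF M])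
sublocale N: cdg N by (rule cdgI[OF N])
sublocale N': cdg N' by (rule cdgI[OF N'])
sublocale R: cdg R by (rule cdgI[OF R])

lemma Z: "cdga Z" and zM: "zM \<in> dg_hom M Z" and zN: "zN \<in> dg_hom N Z"
  and sq: "s \<in> carrier S \<Longrightarrow> zM (c s) = zN (g s)"
  using po unfolding is_pushout_def by blast+

lemma J: "cdga J" and rM: "rM \<in> dg_hom J M" and rN: "rN \<in> dg_hom J N'"
  using pb unfolding is_pullback_def by blast+

sublocale Z: cdg Z by (rule cdgI[OF Z])
sublocale J: cdg J by (rule cdgI[OF J])

lemma w_hom: "w \<in> dg_hom N N'" and p_hom: "p \<in> dg_hom N' Z"
  using w p by (simp_all add: quasi_iso_def fibration_def)

lemma Z_surj: "zM ` hpart M n = hpart Z n"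
  and Z_ker: "b \<in> hpart M n \<Longrightarrow> zM b = \<zero>\<^bsub>Z\<^esub> \<Longrightarrow> \<exists>b'\<in>hpart M n. b = c s0 \<otimes>\<^bsub>M\<^esub> b'"
  and Z_kill: "b \<in> carrier M \<Longrightarrow> zM (c s0 \<otimes>\<^bsub>M\<^esub> b) = \<zero>\<^bsub>Z\<^esub>"
  using pushout_along_quotient[OF S M N c g po s0] surj ker by blast+

lemmas w_iff = w[unfolded quasi_iso_iff[OF N N' w_hom]]

abbreviation x where "x \<equiv> c s0"

lemma x: "x \<in> hpart M 0" "x \<in> carrier M"
  using dg_homD(6)[OF c s0(1)] M.hpart_carrier by blast+

lemma R_boundaries: "r \<in> boundaries R n \<Longrightarrow> r = \<zero>\<^bsub>R\<^esub>"
proof -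
  assume "r \<in> boundaries R n"
  then obtain y where y: "y \<in> hpart R (n - 1)" "r = dif R y" by (auto simp: boundaries_def)
  then show ?thesis
    using R_deg0[of "n - 1"] R.dif_hpart_0[of y] by (cases "n - 1 = 0") auto
qed

text \<open>Multiplication by \<open>x\<close> is injective on \<open>M\<close> with cokernel
  \<open>Z\<close>, and this is the resulting long exact sequence on elements. If \<open>m\<close>
  lifts \<open>z\<close>, then \<open>d m = x b\<close>, and \<open>b\<close> is a cocycle because
  \<open>x\<close> is torsion free; it remains to see that \<open>b\<close> is a boundary.\<close>

lemma Z_acyclic:
  assumes "n < 0" "z \<in> cocycles Z n"
  shows "z \<in> boundaries Z n"
proof -
  have z: "z \<in> hpart Z n" "dif Z z = \<zero>\<^bsub>Z\<^esub>" using assms by (auto simp: cocycles_def)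
  obtain m where m: "m \<in> hpart M n" "z = zM m" using z(1) unfolding Z_surj[of n, symmetric] by blast
  have mc: "m \<in> carrier M" using M.hpart_carrier[OF m(1)] .
  have "zM (dif M m) = \<zero>\<^bsub>Z\<^esub>" using dg_homD(7)[OF zM mc] m z by simp
  then obtain b where b: "b \<in> hpart M (n + 1)" "dif M m = x \<otimes>\<^bsub>M\<^esub> b"
    using Z_ker[OF M.dif_hpart[OF m(1)]] by blast
  have bc: "b \<in> carrier M" using M.hpart_carrier[OF b(1)] .
  have "x \<otimes>\<^bsub>M\<^esub> dif M b = \<zero>\<^bsub>M\<^esub>"
    using M.dif_hpart_0_mult[OF x(1) bc] b(2) M.dif_dif[OF mc] by simp
  then have db: "dif M b = \<zero>\<^bsub>M\<^esub>" using torsion_free bc by simp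
  have "b \<in> boundaries M (n + 1)"
  proof (cases "n + 1 < 0")
    case True
    then show ?thesis using M_acyclic b(1) db by (auto simp: cocycles_def)
  next
    case False
    \<comment> \<open>Here \<open>b\<close> has degree 0, where \<open>M\<close> does have
      cohomology. That cohomology is detected in \<open>R\<close>, in which \<open>i s0\<close> is
      regular.\<close>
    then have n: "n + 1 = 0" using assms by simp
    have "\<psi> (dif M m) = \<zero>\<^bsub>R\<^esub>"
      using R_boundaries[OF dg_hom_boundaries[OF M \<psi>, of "dif M m" "n + 1"]] m(1)
      by (auto simp: boundaries_def)
    then have "i s0 \<otimes>\<^bsub>R\<^esub> \<psi> b = \<zero>\<^bsub>R\<^esub>"
      using b(2) dg_homD(2)[OF \<psi> x(2) bc] \<psi>c[OF S.hpart_carrier[OF s0(1)]] by simp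
    then have "\<psi> b = \<zero>\<^bsub>R\<^esub>" using R_reg dg_homD(1)[OF \<psi> bc] by blast
    then show ?thesis using M_inj b(1) n by simp
  qed
  then obtain b' where b': "b' \<in> hpart M n" "b = dif M b'" by (auto simp: boundaries_def)
  have b'c: "b' \<in> carrier M" using M.hpart_carrier[OF b'(1)] .
  \<comment> \<open>Subtracting \<open>x b'\<close> leaves the image in \<open>Z\<close> unchanged
    and turns the lift \<open>m\<close> into a cocycle.\<close>
  have xb': "x \<otimes>\<^bsub>M\<^esub> b' \<in> hpart M n" using M.hpart_mult[OF x(1) b'(1)] by simp
  have "m \<ominus>\<^bsub>M\<^esub> x \<otimes>\<^bsub>M\<^esub> b' \<in> cocycles M n"
    using M.hpart_minus[OF m(1) xb'] mc x(2) b'c b(2) b'(2) M.dif_hpart_0_mult[OF x(1) b'c]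
    by (simp add: cocycles_def M.dif_minus)
  then have "zM (m \<ominus>\<^bsub>M\<^esub> x \<otimes>\<^bsub>M\<^esub> b') \<in> boundaries Z n"
    using M_acyclic assms(1) dg_hom_boundaries[OF M zM] by blast
  moreover have "zM (m \<ominus>\<^bsub>M\<^esub> x \<otimes>\<^bsub>M\<^esub> b') = z"
    using dg_hom_minus[OF M Z zM mc, of "x \<otimes>\<^bsub>M\<^esub> b'"] Z_kill[OF b'c] x(2) b'c m(2)
      dg_homD(1)[OF zM mc] by (simp add: a_minus_def)
  ultimately show ?thesis by simp
qed

lemma J_pair: "a \<in> hpart J n \<Longrightarrow> rM a \<in> hpart M n \<and> rN a \<in> hpart N' n \<and> zM (rM a) = p (rN a)"
  using pb unfolding is_pullback_def bij_betw_def by blast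

lemma J_ex:
  assumes "m \<in> hpart M n" "y \<in> hpart N' n" "zM m = p y"
  shows "\<exists>a\<in>hpart J n. rM a = m \<and> rN a = y"
proof -
  have "(m, y) \<in> (\<lambda>a. (rM a, rN a)) ` hpart J n"
    using pb assms unfolding is_pullback_def bij_betw_def by blast
  then show ?thesis by auto
qed

lemma J_eq:
  assumes "a \<in> hpart J n" "b \<in> hpart J n" "rM a = rM b" "rN a = rN b"
  shows "a = b"
  using pb assms unfolding is_pullback_def bij_betw_def inj_on_def by auto

text \<open>Exactness of Mayer-Vietoris. The primitives \<open>m\<close> and \<open>y\<close> of the
  two components may disagree in \<open>Z\<close>, but their difference is a cocycle of negative
  degree, hence some \<open>d z\<close>. As \<open>p\<close> is onto in negative degrees,
  \<open>z\<close> lifts to \<open>N'\<close>, and \<open>y\<close> is corrected by the differential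
  of the lift. Both degrees \<open>n - 1\<close> and \<open>n - 2\<close> are negative because
  \<open>n \<le> 0\<close>.\<close>

lemma J_boundary:
  assumes n: "n \<le> 0" and a: "a \<in> hpart J n" "rM a \<in> boundaries M n" "rN a \<in> boundaries N' n"
  shows "a \<in> boundaries J n"
proof -
  obtain m where m: "m \<in> hpart M (n - 1)" "rM a = dif M m" using a by (auto simp: boundaries_def)
  obtain y where y: "y \<in> hpart N' (n - 1)" "rN a = dif N' y" using a by (auto simp: boundaries_def)
  have mc: "m \<in> carrier M" and yc: "y \<in> carrier N'"
    using M.hpart_carrier[OF m(1)] N'.hpart_carrier[OF y(1)] by auto
  have zc: "zM m \<in> hpart Z (n - 1)" "p y \<in> hpart Z (n - 1)"
    using dg_homD(6)[OF zM m(1)] dg_homD(6)[OF p_hom y(1)] .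
  have "dif Z (zM m) = dif Z (p y)"
    using J_pair[OF a(1)] m y dg_homD(7)[OF zM mc] dg_homD(7)[OF p_hom yc] by simp
  then have "zM m \<ominus>\<^bsub>Z\<^esub> p y \<in> cocycles Z (n - 1)"
    using Z.hpart_minus[OF zc] Z.hpart_carrier[OF zc(1)] Z.hpart_carrier[OF zc(2)]
    by (simp add: cocycles_def Z.dif_minus)
  then have "zM m \<ominus>\<^bsub>Z\<^esub> p y \<in> boundaries Z (n - 1)" using n by (intro Z_acyclic) auto
  then obtain z where z: "z \<in> hpart Z (n - 1 - 1)" "zM m \<ominus>\<^bsub>Z\<^esub> p y = dif Z z"
    by (auto simp: boundaries_def)
  have "p ` hpart N' (n - 1 - 1) = hpart Z (n - 1 - 1)" using p n by (simp add: fibration_def)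
  then obtain y' where y': "y' \<in> hpart N' (n - 1 - 1)" "z = p y'" using z(1) by auto
  have y'c: "y' \<in> carrier N'" using N'.hpart_carrier[OF y'(1)] .
  have dy': "dif N' y' \<in> hpart N' (n - 1)" using N'.dif_hpart[OF y'(1)] by simp
  have "p (y \<oplus>\<^bsub>N'\<^esub> dif N' y') = p y \<oplus>\<^bsub>Z\<^esub> (zM m \<ominus>\<^bsub>Z\<^esub> p y)"
    using dg_homD(3)[OF p_hom yc, of "dif N' y'"] y'c dg_homD(7)[OF p_hom y'c] z(2) y'(2) by simp
  also have "\<dots> = zM m"
    by (rule Z.add_minus_cancel[OF Z.hpart_carrier[OF zc(2)] Z.hpart_carrier[OF zc(1)]])
  finally obtain b where b: "b \<in> hpart J (n - 1)" "rM b = m" "rN b = y \<oplus>\<^bsub>N'\<^esub> dif N' y'"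
    using J_ex[OF m(1) N'.hpart_add[OF y(1) dy']] by auto
  have bc: "b \<in> carrier J" using J.hpart_carrier[OF b(1)] .
  have "a = dif J b"
  proof (rule J_eq[OF a(1)])
    show "dif J b \<in> hpart J n" using J.dif_hpart[OF b(1)] by simp
    show "rM a = rM (dif J b)" using dg_homD(7)[OF rM bc] b m by simp
    show "rN a = rN (dif J b)"
      using dg_homD(7)[OF rN bc] b y yc y'c by (simp add: N'.dif_add N'.dif_dif)
  qed
  then show ?thesis using b by (auto simp: boundaries_def)
qed

lemma N'_acyclic:
  assumes "n < 0" "y \<in> cocycles N' n"
  shows "y \<in> boundaries N' n"
proof -
  obtain v where v: "v \<in> cocycles N n" "y \<ominus>\<^bsub>N'\<^esub> w v \<in> boundaries N' n"
    using w_iff assms by blast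
  have "v = \<zero>\<^bsub>N\<^esub>" using v(1) N_deg0[of n] assms(1) by (auto simp: cocycles_def)
  then show ?thesis
    using v(2) dg_hom_zero[OF N N' w_hom] N'.cocycles_carrier[OF assms(2)] by (simp add: a_minus_def)
qed

lemma J_acyclic:
  assumes "n < 0" "a \<in> cocycles J n"
  shows "a \<in> boundaries J n"
  using assms J_boundary[of n a] M_acyclic[OF assms(1)] N'_acyclic[OF assms(1)]
    dg_hom_cocycles[OF J M rM assms(2)] dg_hom_cocycles[OF J N' rN assms(2)]
  by (auto simp: cocycles_def)

text \<open>Degree 0 of the fibre product: \<open>rN a\<close> is cohomologous to some \<open>g s\<close>, so \<open>rM a\<close> is congruent
  to \<open>c s\<close> modulo \<open>x\<close> and boundaries.\<close>

lemma J_decomp: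
  assumes a: "a \<in> hpart J 0"
  obtains s b where "s \<in> hpart S 0" "b \<in> hpart M 0"
    "\<psi> (rM a) = i s \<oplus>\<^bsub>R\<^esub> i s0 \<otimes>\<^bsub>R\<^esub> \<psi> b" "rN a \<ominus>\<^bsub>N'\<^esub> w (g s) \<in> boundaries N' 0"
proof -
  have rNa: "rN a \<in> hpart N' 0" and rMa: "rM a \<in> hpart M 0" and e: "zM (rM a) = p (rN a)"
    using J_pair[OF a] by auto
  obtain v where v: "v \<in> cocycles N 0" "rN a \<ominus>\<^bsub>N'\<^esub> w v \<in> boundaries N' 0"
    using w_iff N'.hpart_0_cocycles[OF rNa] by blast
  obtain s where s: "s \<in> hpart S 0" "g s = v" using surj[of v 0] v(1) by (auto simp: cocycles_def)
  obtain y where y: "y \<in> hpart N' (- 1)" "rN a \<ominus>\<^bsub>N'\<^esub> w v = dif N' y" using v(2)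
    by (auto simp: boundaries_def)
  obtain m where m: "m \<in> hpart M (- 1)" "p y = zM m"
    using dg_homD(6)[OF p_hom y(1)] unfolding Z_surj[of "- 1", symmetric] by blast
  have sc: "s \<in> carrier S" and yc: "y \<in> carrier N'" and mc: "m \<in> carrier M" and vc: "v \<in> carrier N"
    and ac: "rN a \<in> carrier N'" and amc: "rM a \<in> carrier M"
    using S.hpart_carrier[OF s(1)] N'.hpart_carrier[OF y(1)] M.hpart_carrier[OF m(1)]
      N.cocycles_carrier[OF v(1)]
      N'.hpart_carrier[OF rNa] M.hpart_carrier[OF rMa] .
  have csc: "c s \<in> carrier M" "c s \<in> hpart M 0" and wc: "w v \<in> carrier N'"
    using dg_homD(1)[OF c sc] dg_homD(6)[OF c s(1)] dg_homD(1)[OF w_hom vc] .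
  have dm: "dif M m \<in> hpart M 0" using M.dif_hpart[OF m(1)] by simp
  have zc: "zM (rM a) \<in> carrier Z" "zM (c s) \<in> carrier Z" "zM (dif M m) \<in> carrier Z"
    using dg_homD(1)[OF zM] amc csc mc by auto
  \<comment> \<open>With \<open>m\<close> lifting \<open>p y\<close>, the element
    \<open>rM a - c s - d m\<close> dies in \<open>Z\<close> and so is a multiple of
    \<open>x\<close>; applying \<open>\<psi>\<close> removes \<open>d m\<close>, since
    \<open>R\<close> has no nonzero boundaries.\<close>
  have "zM (dif M m) = p (rN a \<ominus>\<^bsub>N'\<^esub> w v)"
    using y(2) dg_homD(7)[OF p_hom yc] dg_homD(7)[OF zM mc] m(2) by simp
  also have "\<dots> = zM (rM a) \<ominus>\<^bsub>Z\<^esub> zM (c s)"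
    using dg_hom_minus[OF N' Z p_hom ac wc] e pw[OF vc] sq[OF sc] s(2) by simp
  finally have "zM ((rM a \<ominus>\<^bsub>M\<^esub> c s) \<ominus>\<^bsub>M\<^esub> dif M m) = \<zero>\<^bsub>Z\<^esub>"
    using dg_hom_minus[OF M Z zM] amc csc mc zc by (simp add: a_minus_def Z.r_neg)
  then obtain b where b: "b \<in> hpart M 0" "(rM a \<ominus>\<^bsub>M\<^esub> c s) \<ominus>\<^bsub>M\<^esub> dif M m = x \<otimes>\<^bsub>M\<^esub> b"
    using Z_ker[OF M.hpart_minus[OF M.hpart_minus[OF rMa csc(2)] dm]] by blast
  have bc: "b \<in> carrier M" using M.hpart_carrier[OF b(1)] .
  have "\<psi> (dif M m) = \<zero>\<^bsub>R\<^esub>"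
    using R_boundaries[OF dg_hom_boundaries[OF M \<psi>, of "dif M m" 0]] m(1) by (auto simp: boundaries_def)
  then have "(\<psi> (rM a) \<ominus>\<^bsub>R\<^esub> i s) = i s0 \<otimes>\<^bsub>R\<^esub> \<psi> b"
    using arg_cong[OF b(2), of \<psi>] dg_hom_minus[OF M R \<psi>] amc csc mc x bc dg_homD(1,2)[OF \<psi>]
      dg_homD(1)[OF \<psi> amc] dg_homD(1)[OF i sc]
      \<psi>c[OF sc] \<psi>c[OF S.hpart_carrier[OF s0(1)]] by (simp add: a_minus_def)
  then have "i s \<oplus>\<^bsub>R\<^esub> (\<psi> (rM a) \<ominus>\<^bsub>R\<^esub> i s) = i s \<oplus>\<^bsub>R\<^esub> i s0 \<otimes>\<^bsub>R\<^esub> \<psi> b" by simp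
  then have "\<psi> (rM a) = i s \<oplus>\<^bsub>R\<^esub> i s0 \<otimes>\<^bsub>R\<^esub> \<psi> b"
    using R.add_minus_cancel[OF dg_homD(1)[OF i sc] dg_homD(1)[OF \<psi> amc]] by simp
  then show thesis using that[OF s(1) b(1)] v(2) s(2) by simp
qed

text \<open>By \<open>J_decomp\<close> a vanishing image makes \<open>i s\<close> divisible by
  \<open>i s0\<close>, so \<open>R_div\<close> gives \<open>g s = 0\<close>. Thus the component in
  \<open>N'\<close> is a boundary along with the one in \<open>M\<close>: the second factor of the
  fibre product contributes no kernel.\<close>

lemma J_inj:
  assumes a: "a \<in> hpart J 0" "\<psi> (rM a) = \<zero>\<^bsub>R\<^esub>"
  shows "a \<in> boundaries J 0"
proof -
  obtain s b where s: "s \<in> hpart S 0" and sb': "b \<in> hpart M 0"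
    "\<psi> (rM a) = i s \<oplus>\<^bsub>R\<^esub> i s0 \<otimes>\<^bsub>R\<^esub> \<psi> b" "rN a \<ominus>\<^bsub>N'\<^esub> w (g s) \<in> boundaries N' 0"
    using J_decomp[OF a(1)] by blast
  note sb = S.hpart_carrier[OF s] sb'
  have c: "i s \<in> carrier R" "i s0 \<in> carrier R" "\<psi> b \<in> carrier R"
    using dg_homD(1)[OF i] sb(1) S.hpart_carrier[OF s0(1)] dg_homD(1)[OF \<psi>
      M.hpart_carrier[OF sb(2)]] by auto
  have "i s = \<ominus>\<^bsub>R\<^esub> (i s0 \<otimes>\<^bsub>R\<^esub> \<psi> b)"
    using R.minus_equality[of "i s" "i s0 \<otimes>\<^bsub>R\<^esub> \<psi> b"] sb(3) a(2) c by simp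
  then have "i s = i s0 \<otimes>\<^bsub>R\<^esub> (\<ominus>\<^bsub>R\<^esub> \<psi> b)" using c by (simp add: R.r_minus)
  then have "g s = \<zero>\<^bsub>N\<^esub>" using R_div[OF sb(1) R.a_inv_closed[OF c(3)]] by simp
  then have "rN a \<in> boundaries N' 0"
    using sb(4) dg_hom_zero[OF N N' w_hom] J_pair[OF a(1)] N'.hpart_carrier by (auto simp: a_minus_def)
  moreover have "rM a \<in> boundaries M 0" using M_inj J_pair[OF a(1)] a(2) by blast
  ultimately show ?thesis using J_boundary[OF _ a(1)] by simp
qed

text \<open>Degree 0 of Mayer-Vietoris: what survives are the classes congruent modulo
  \<open>i s0\<close> to an element of \<open>S\<close>. Conversely \<open>c s + x b\<close> and
  \<open>w (g s)\<close> agree in \<open>Z\<close>, where \<open>x b\<close> dies, so they form a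
  point of the fibre product.\<close>

lemma J_image:
  "(\<lambda>a. \<psi> (rM a)) ` hpart J 0 = {i s \<oplus>\<^bsub>R\<^esub> i s0 \<otimes>\<^bsub>R\<^esub> r | s r. s \<in> hpart S 0 \<and> r \<in> \<psi> ` hpart M 0}"
proof (intro subset_antisym subsetI)
  fix y assume "y \<in> (\<lambda>a. \<psi> (rM a)) ` hpart J 0"
  then obtain a where a: "a \<in> hpart J 0" "y = \<psi> (rM a)" by blast
  obtain s b where sb: "s \<in> hpart S 0" "b \<in> hpart M 0"
    "\<psi> (rM a) = i s \<oplus>\<^bsub>R\<^esub> i s0 \<otimes>\<^bsub>R\<^esub> \<psi> b"
    by (rule J_decomp[OF a(1)])
  show "y \<in> {i s \<oplus>\<^bsub>R\<^esub> i s0 \<otimes>\<^bsub>R\<^esub> r | s r. s \<in> hpart S 0 \<and> r \<in> \<psi> ` hpart M 0}"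
    unfolding a(2) sb(3) using sb(1,2) by blast
next
  fix y assume "y \<in> {i s \<oplus>\<^bsub>R\<^esub> i s0 \<otimes>\<^bsub>R\<^esub> r | s r. s \<in> hpart S 0 \<and> r \<in> \<psi> ` hpart M 0}"
  then obtain s b where sb: "s \<in> hpart S 0" "b \<in> hpart M 0" "y = i s \<oplus>\<^bsub>R\<^esub> i s0 \<otimes>\<^bsub>R\<^esub> \<psi> b" by blast
  have sc: "s \<in> carrier S" and bc: "b \<in> carrier M"
    using S.hpart_carrier[OF sb(1)] M.hpart_carrier[OF sb(2)] .
  have csc: "c s \<in> carrier M" using dg_homD(1)[OF c sc] .
  have m: "c s \<oplus>\<^bsub>M\<^esub> x \<otimes>\<^bsub>M\<^esub> b \<in> hpart M 0"
    using dg_homD(6)[OF c sb(1)] M.hpart_mult[OF x(1) sb(2)] by (simp add: M.hpart_add)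
  have g0: "g s \<in> hpart N 0" using dg_homD(6)[OF g sb(1)] .
  have v: "w (g s) \<in> hpart N' 0" using dg_homD(6)[OF w_hom g0] .
  have "zM (c s \<oplus>\<^bsub>M\<^esub> x \<otimes>\<^bsub>M\<^esub> b) = zM (c s)"
    using dg_homD(3)[OF zM csc, of "x \<otimes>\<^bsub>M\<^esub> b"] Z_kill[OF bc] x(2) bc dg_homD(1)[OF zM csc] by simp
  also have "\<dots> = p (w (g s))" using sq[OF sc] pw[OF N.hpart_carrier[OF g0]] by simp
  finally obtain a where a: "a \<in> hpart J 0" "rM a = c s \<oplus>\<^bsub>M\<^esub> x \<otimes>\<^bsub>M\<^esub> b"
    using J_ex[OF m v] by blast
  have "\<psi> (rM a) = y"
    using a(2) sb(3) dg_homD(3)[OF \<psi> csc, of "x \<otimes>\<^bsub>M\<^esub> b"] dg_homD(2)[OF \<psi> x(2) bc] x(2) bc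
      \<psi>c[OF sc] \<psi>c[OF S.hpart_carrier[OF s0(1)]] by simp
  then show "y \<in> (\<lambda>a. \<psi> (rM a)) ` hpart J 0" using a(1) by blast
qed

end

section \<open>Algebras of functions\<close>

text \<open>The unit is the indicator of \<open>D\<close>, because functions on \<open>D\<close> are
  extended by zero. Zero and negatives arise as scalar multiples.\<close>

definition function_subalgebra :: "'v set \<Rightarrow> ('v \<Rightarrow> 'k::field_char_0) set \<Rightarrow> bool" where
  "function_subalgebra D F \<longleftrightarrow> restr D (\<lambda>_. 1) \<in> F \<and>
     (\<forall>f\<in>F. \<forall>g\<in>F. (\<lambda>v. f v + g v) \<in> F \<and> (\<lambda>v. f v * g v) \<in> F) \<and>
     (\<forall>c. \<forall>f\<in>F. (\<lambda>v. c * f v) \<in> F) \<and> (\<forall>f\<in>F. \<forall>v. v \<notin> D \<longrightarrow> f v = 0)"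

abbreviation RS :: "(('v \<Rightarrow> 'k) \<Rightarrow> 'u) \<Rightarrow> 'v set \<Rightarrow> ('v \<Rightarrow> 'k::field_char_0) set \<Rightarrow> ('k, 'u) dg_alg" where
  "RS \<epsilon> D F \<equiv> RSpec \<epsilon> (function_algebra D F)"

lemma RS_simps:
  "carrier (RS \<epsilon> D F) = \<epsilon> ` F"
  "\<one>\<^bsub>RS \<epsilon> D F\<^esub> = \<epsilon> (restr D (\<lambda>_. 1))"
  "\<zero>\<^bsub>RS \<epsilon> D F\<^esub> = \<epsilon> (\<lambda>_. 0)"
  "hpart (RS \<epsilon> D F) n = (if n = 0 then \<epsilon> ` F else {\<epsilon> (\<lambda>_. 0)})"
  "dif (RS \<epsilon> D F) x = \<epsilon> (\<lambda>_. 0)"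
  by (simp_all add: RSpec_def function_algebra_def)

lemma RS_ops:
  assumes "inj \<epsilon>"
  shows "\<epsilon> f \<otimes>\<^bsub>RS \<epsilon> D F\<^esub> \<epsilon> g = \<epsilon> (\<lambda>v. f v * g v)"
    "\<epsilon> f \<oplus>\<^bsub>RS \<epsilon> D F\<^esub> \<epsilon> g = \<epsilon> (\<lambda>v. f v + g v)"
    "k \<odot>\<^bsub>RS \<epsilon> D F\<^esub> \<epsilon> f = \<epsilon> (\<lambda>v. k * f v)"
  by (simp_all add: RSpec_def function_algebra_def the_inv_f_f[OF assms])

lemma ring_RS:
  assumes \<epsilon>: "inj \<epsilon>" and F: "function_subalgebra D F"
  shows "ring (RS \<epsilon> D F)"
proof -
  note ops = RS_ops[OF \<epsilon>]
  have F1: "restr D (\<lambda>_. 1) \<in> F" "\<And>f g. f \<in> F \<Longrightarrow> g \<in> F \<Longrightarrow> (\<lambda>v. f v + g v) \<in> F"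
    "\<And>f g. f \<in> F \<Longrightarrow> g \<in> F \<Longrightarrow> (\<lambda>v. f v * g v) \<in> F" "\<And>c f. f \<in> F \<Longrightarrow> (\<lambda>v. c * f v) \<in> F"
    and van: "\<And>f v. f \<in> F \<Longrightarrow> v \<notin> D \<Longrightarrow> f v = 0"
    using F by (auto simp: function_subalgebra_def)
  have F0: "(\<lambda>_. 0) \<in> F" using F1(4)[OF F1(1), of 0] by simp
  have one: "(\<lambda>v. restr D (\<lambda>_. 1) v * f v) = f" "(\<lambda>v. f v * restr D (\<lambda>_. 1) v) = f" if "f \<in> F" for f
    using van[OF that] by (auto simp: restr_def)
  show ?thesis
  proof (rule ringI)
    show "abelian_group (RS \<epsilon> D F)"
    proof (rule abelian_groupI)
      fix x assume "x \<in> carrier (RS \<epsilon> D F)"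
      then obtain f where f: "f \<in> F" "x = \<epsilon> f" by (auto simp: RS_simps)
      then show "\<exists>y\<in>carrier (RS \<epsilon> D F). y \<oplus>\<^bsub>RS \<epsilon> D F\<^esub> x = \<zero>\<^bsub>RS \<epsilon> D F\<^esub>"
        using F1(4)[OF f(1), of "-1"] by (intro bexI[of _ "\<epsilon> (\<lambda>v. - 1 * f v)"]) (auto simp: RS_simps
          ops)
    qed (auto simp: RS_simps ops F1 F0 ac_simps)
    show "monoid (RS \<epsilon> D F)"
      by (rule monoidI) (auto simp: RS_simps ops F1 one ac_simps)
  qed (auto simp: RS_simps ops algebra_simps)
qed

lemma cdga_RS:
  assumes \<epsilon>: "inj \<epsilon>" and F: "function_subalgebra D F"
  shows "cdga (RS \<epsilon> D F)"
proof -
  note ops = RS_ops[OF \<epsilon>]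
  have F1: "restr D (\<lambda>_. 1) \<in> F" "\<And>f g. f \<in> F \<Longrightarrow> g \<in> F \<Longrightarrow> (\<lambda>v. f v + g v) \<in> F"
    "\<And>f g. f \<in> F \<Longrightarrow> g \<in> F \<Longrightarrow> (\<lambda>v. f v * g v) \<in> F" "\<And>c f. f \<in> F \<Longrightarrow> (\<lambda>v. c * f v) \<in> F"
    using F by (auto simp: function_subalgebra_def)
  have F0: "(\<lambda>_. 0) \<in> F" using F1(4)[OF F1(1), of 0] by simp
  interpret R: ring "RS \<epsilon> D F" by (rule ring_RS[OF assms])
  have neg: "\<ominus>\<^bsub>RS \<epsilon> D F\<^esub> \<epsilon> f = \<epsilon> (\<lambda>v. - f v)" if "f \<in> F" for f
    using R.minus_equality[of "\<epsilon> (\<lambda>v. - f v)" "\<epsilon> f"] that F1(4)[OF that, of "-1"]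
    by (auto simp: RS_simps ops)
  have negF: "(\<lambda>v. - f v) \<in> F" if "f \<in> F" for f using F1(4)[OF that, of "-1"] by simp
  have sub: "additive_subgroup (hpart (RS \<epsilon> D F) n) (RS \<epsilon> D F)" for n
  proof
    show "hpart (RS \<epsilon> D F) n \<subseteq> carrier (add_monoid (RS \<epsilon> D F))" using F0 by (auto simp: RS_simps)
    fix x assume x: "x \<in> hpart (RS \<epsilon> D F) n"
    have "\<ominus>\<^bsub>RS \<epsilon> D F\<^esub> x \<in> hpart (RS \<epsilon> D F) n"
      using x neg[OF F0] by (auto simp: RS_simps neg negF split: if_splits)
    then show "inv\<^bsub>add_monoid (RS \<epsilon> D F)\<^esub> x \<in> hpart (RS \<epsilon> D F) n" by (simp add: a_inv_def)
  qed (use F0 F1 in \<open>auto simp: RS_simps ops split: if_splits\<close>)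
  show ?thesis
  proof (rule cdgaI[where pr = "\<lambda>n x. if n = 0 then x else \<zero>\<^bsub>RS \<epsilon> D F\<^esub>"], goal_cases)
    case (14 x)
    have "{n. (if n = 0 then x else \<zero>\<^bsub>RS \<epsilon> D F\<^esub>) \<noteq> \<zero>\<^bsub>RS \<epsilon> D F\<^esub>} \<subseteq> {0::int}" by auto
    then show ?case using finite_subset by blast
  next
    case (15 x)
    from 15(2)[of 0] show ?case by simp
  next
    case (19 x y m n)
    show ?case
    proof (cases "m = 0 \<or> n = 0")
      case True
      then show ?thesis using 19 F0 by (auto simp: RS_simps ops ac_simps split: if_splits)
    next
      case False
      then have "x = \<zero>\<^bsub>RS \<epsilon> D F\<^esub>" "y = \<zero>\<^bsub>RS \<epsilon> D F\<^esub>" using 19 by (auto simp: RS_simps)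
      then show ?thesis by simp
    qed
  next
    case (24 x y m n)
    have "x \<in> carrier (RS \<epsilon> D F)" "y \<in> carrier (RS \<epsilon> D F)"
      using 24 F0 by (auto simp: RS_simps split: if_splits)
    moreover have "dif (RS \<epsilon> D F) z = \<zero>\<^bsub>RS \<epsilon> D F\<^esub>" for z by (simp add: RS_simps)
    ultimately show ?case by simp
  qed (use R.ring_axioms sub F0 F1 in \<open>auto simp: RS_simps ops algebra_simps split: if_splits\<close>)
qed

lemma RS_finsum:
  assumes \<epsilon>: "inj \<epsilon>" and F: "function_subalgebra D F" and "finite I" "\<And>i. i \<in> I \<Longrightarrow> f i \<in> F"
  shows "finsum (RS \<epsilon> D F) (\<lambda>i. \<epsilon> (f i)) I = \<epsilon> (\<lambda>v. \<Sum>i\<in>I. f i v)"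
  using assms(3,4)
proof (induction I rule: finite_induct)
  case empty
  interpret ring "RS \<epsilon> D F" by (rule ring_RS[OF \<epsilon> F])
  show ?case by (simp add: RS_simps)
next
  case (insert a I)
  interpret ring "RS \<epsilon> D F" by (rule ring_RS[OF \<epsilon> F])
  show ?case using insert by (subst finsum_insert) (auto simp: RS_simps RS_ops[OF \<epsilon>])
qed

section \<open>Polynomial functions and a reflection\<close>

lemma linear_formD:
  assumes "Vector_Spaces.linear scale (*) l"
  shows "l (x + y) = l x + l y" "l (x - y) = l x - l y" "l (scale r x) = r * l x"
proof -
  interpret l: Vector_Spaces.linear scale "(*)" l by fact
  show "l (x + y) = l x + l y" "l (x - y) = l x - l y" "l (scale r x) = r * l x"
    by (simp_all only: l.add l.diff l.scale)
qed

locale vector_space_char_0 = vector_space scale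
  for scale :: "'k::field_char_0 \<Rightarrow> 'v::ab_group_add \<Rightarrow> 'v"
begin

lemma polynomials_scale: "p \<in> polynomials scale \<Longrightarrow> (\<lambda>v. c * p v) \<in> polynomials scale"
  by (rule polynomials.mult[OF polynomials.const])

lemma polynomials_diff:
  assumes "p \<in> polynomials scale" "q \<in> polynomials scale"
  shows "(\<lambda>v. p v - q v) \<in> polynomials scale"
  using polynomials.add[OF assms(1) polynomials_scale[OF assms(2), of "-1"]] by simp

lemma polynomials_power: "p \<in> polynomials scale \<Longrightarrow> (\<lambda>v. p v ^ n) \<in> polynomials scale"
  by (induction n) (auto intro: polynomials.const polynomials.mult)

lemma polynomials_compose:
  assumes "p \<in> polynomials scale" "Vector_Spaces.linear scale scale L"
  shows "(\<lambda>v. p (L v)) \<in> polynomials scale"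
  using assms(1)
proof induction
  case (form l)
  then show ?case
    using polynomials.form[OF Vector_Spaces.linear_compose[OF assms(2) form]] by (simp add: o_def)
qed (auto intro: polynomials.intros)

end

text \<open>Polynomials on \<open>V\<close> are functions here, not formal expressions. On a line
  they become values of a formal polynomial in one variable, for which the number of roots is
  finite.\<close>

lemma (in vector_space_char_0) polynomial_on_line:
  assumes "p \<in> polynomials scale"
  obtains P where "\<And>t. poly P t = p (v + scale t w)"
  using assms
proof (induction arbitrary: thesis)
  case (const c)
  then show ?case by (metis poly_const_conv)
next
  case (form l)
  show ?case by (rule form(2)[of "[:l v, l w:]"]) (simp add: linear_formD[OF form(1)])
next
  case (add p q)
  obtain P Q where "\<And>t. poly P t = p (v + scale t w)" "\<And>t. poly Q t = q (v + scale t w)"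
    using add.IH by metis
  then show ?case by (intro add.prems[of "P + Q"]) simp
next
  case (mult p q)
  obtain P Q where "\<And>t. poly P t = p (v + scale t w)" "\<And>t. poly Q t = q (v + scale t w)"
    using mult.IH by metis
  then show ?case by (intro mult.prems[of "P * Q"]) simp
qed

text \<open>The vector \<open>u\<close> spans the eigenspace of -1 and is normalised against the
  form, so that \<open>V\<close> is the kernel of \<open>a\<close> plus the line of
  \<open>u\<close>.\<close>

locale reflection_form = vector_space_char_0 scale
  for scale :: "'k::field_char_0 \<Rightarrow> 'v::ab_group_add \<Rightarrow> 'v" +
  fixes s :: "'v \<Rightarrow> 'v" and a :: "'v \<Rightarrow> 'k" and u :: 'v
  assumes a: "Vector_Spaces.linear scale (*) a" and a_u: "a u = 1"
    and s_eq: "s v = v - scale (2 * a v) u"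
begin

lemmas a_add = linear_formD(1)[OF a] and a_diff = linear_formD(2)[OF a] and a_scale
  = linear_formD(3)[OF a]

text \<open>Projection onto the hyperplane along \<open>u\<close>; together with \<open>a\<close> it
  serves as a coordinate system.\<close>

definition pr :: "'v \<Rightarrow> 'v" where "pr v = v - scale (a v) u"

definition inv_polys :: "('v \<Rightarrow> 'k) set" where
  "inv_polys = {p \<in> polynomials scale. \<forall>v. p (s v) = p v}"

lemma a_s: "a (s v) = - a v"
  by (simp add: s_eq a_diff a_scale a_u)

lemma a_pr: "a (pr v) = 0"
  by (simp add: pr_def a_diff a_scale a_u)

lemma pr_s: "pr (s v) = pr v"
proof -
  have "pr (s v) = s v + scale (a v) u" by (simp add: pr_def a_s)
  also have "\<dots> = v - (scale (a v + a v) u - scale (a v) u)" by (simp add: s_eq)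
  finally show ?thesis by (simp only: scale_left_distrib pr_def) simp
qed

lemma pr_line: "pr (pr v + scale t u) = pr v" "a (pr v + scale t u) = t"
  by (simp_all add: a_add a_scale a_u a_pr pr_def[of "_ + _"])

lemma pr_add: "pr v + scale (a v) u = v"
  by (simp add: pr_def)

lemma s_s: "s (s v) = v"
  using pr_add[of "s (s v)"] pr_add[of v] by (simp add: a_s pr_s)

lemma linear_pr: "Vector_Spaces.linear scale scale pr"
proof unfold_locales
  show "pr (x + y) = pr x + pr y" for x y
    by (simp add: pr_def a_add scale_left_distrib)
  show "pr (scale r x) = scale r (pr x)" for r x
    by (simp add: pr_def a_scale scale_right_diff_distrib)
qed

lemma linear_s: "Vector_Spaces.linear scale scale s"
proof unfold_locales
  show "s (x + y) = s x + s y" for x y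
    by (simp add: s_eq a_add distrib_left scale_left_distrib)
  show "s (scale r x) = scale r (s x)" for r x
    by (simp add: s_eq a_scale scale_right_diff_distrib mult.left_commute)
qed

text \<open>On the line through \<open>v\<close> in direction \<open>u\<close> the form vanishes at
  a single parameter. Everywhere else \<open>p\<close> must vanish, and infinitely many roots make
  it zero on the whole line.\<close>

lemma form_cancel:
  assumes "p \<in> polynomials scale" "\<And>v. a v * p v = 0"
  shows "p v = 0"
proof -
  obtain P where P: "\<And>t. poly P t = p (v + scale t u)" using polynomial_on_line[OF assms(1)] by blast
  have "poly P t = 0" if "t \<noteq> - a v" for t
    using assms(2)[of "v + scale t u"] that by (auto simp: P a_add a_scale a_u add_eq_0_iff)
  then have "- {- a v} \<subseteq> {t. poly P t = 0}" by auto
  moreover have "infinite (- {- a v})" by (simp add: Compl_eq_Diff_UNIV infinite_UNIV_char_0)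
  ultimately have "P = 0" using poly_roots_finite finite_subset by blast
  then show ?thesis using P[of 0] by simp
qed

lemma form_power_cancel:
  assumes "p \<in> polynomials scale" "\<And>v. a v ^ n * p v = 0"
  shows "p v = 0"
  using assms(2)
proof (induction n arbitrary: v)
  case (Suc n)
  have "(\<lambda>v. a v ^ n * p v) \<in> polynomials scale"
    by (rule polynomials.mult[OF polynomials_power[OF polynomials.form[OF a]] assms(1)])
  from form_cancel[OF this] have "a v ^ n * p v = 0" for v using Suc.prems by (simp add: mult.assoc)
  then show ?case by (rule Suc.IH)
qed simp

lemma inv_polysI [intro]: "p \<in> polynomials scale \<Longrightarrow> (\<And>v. p (s v) = p v) \<Longrightarrow> p \<in> inv_polys"
  by (simp add: inv_polys_def)

lemma inv_polysD: "p \<in> inv_polys \<Longrightarrow> p \<in> polynomials scale" "p \<in> inv_polys \<Longrightarrow> p (s v) = p v"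
  by (simp_all add: inv_polys_def)

lemma inv_polys_add: "p \<in> inv_polys \<Longrightarrow> q \<in> inv_polys \<Longrightarrow> (\<lambda>v. p v + q v) \<in> inv_polys"
  by (intro inv_polysI polynomials.add) (auto simp: inv_polysD)

lemma inv_polys_mult: "p \<in> inv_polys \<Longrightarrow> q \<in> inv_polys \<Longrightarrow> (\<lambda>v. p v * q v) \<in> inv_polys"
  by (intro inv_polysI polynomials.mult) (auto simp: inv_polysD)

lemma inv_polys_const: "(\<lambda>_. c) \<in> inv_polys"
  by (intro inv_polysI polynomials.const) simp

lemma inv_polys_pr: "p \<in> polynomials scale \<Longrightarrow> (\<lambda>v. p (pr v)) \<in> inv_polys"
  by (rule inv_polysI[OF polynomials_compose[OF _ linear_pr]]) (auto simp: pr_s)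

lemma inv_polys_square: "(\<lambda>v. a v ^ 2) \<in> inv_polys"
  using a by (intro inv_polysI polynomials_power polynomials.form) (auto simp: a_s)

lemma inv_polys_sum:
  "finite I \<Longrightarrow> (\<And>i. i \<in> I \<Longrightarrow> f i \<in> inv_polys) \<Longrightarrow> (\<lambda>v. \<Sum>i\<in>I. f i v) \<in> inv_polys"
  by (induction I rule: finite_induct) (auto intro: inv_polys_add inv_polys_const)

text \<open>Every polynomial is \<open>p + a q\<close> with \<open>p\<close> and \<open>q\<close> in the algebra generated by \<open>a\<^sup>2\<close> and the
  pull-backs along \<open>pr\<close>; if it is invariant, then \<open>a q = 0\<close>.\<close>

lemma inv_polys_induct [consumes 1, case_names pr square add mult]:
  assumes p: "p \<in> inv_polys"
    and pr: "\<And>q. q \<in> polynomials scale \<Longrightarrow> P (\<lambda>v. q (pr v))"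
    and square: "P (\<lambda>v. a v ^ 2)"
    and add: "\<And>p q. p \<in> inv_polys \<Longrightarrow> q \<in> inv_polys \<Longrightarrow> P p \<Longrightarrow> P q \<Longrightarrow> P (\<lambda>v. p v + q v)"
    and mult: "\<And>p q. p \<in> inv_polys \<Longrightarrow> q \<in> inv_polys \<Longrightarrow> P p \<Longrightarrow> P q \<Longrightarrow> P (\<lambda>v. p v * q v)"
  shows "P p"
proof -
  define S where "S = {q \<in> inv_polys. P q}"
  have S_add: "(\<lambda>v. f v + g v) \<in> S" and S_mult: "(\<lambda>v. f v * g v) \<in> S" if "f \<in> S" "g \<in> S" for f g
    using that add mult inv_polys_add inv_polys_mult by (auto simp: S_def)
  have S_pr: "(\<lambda>v. q (pr v)) \<in> S" if "q \<in> polynomials scale" for q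
    using that pr inv_polys_pr by (auto simp: S_def)
  have S_const: "(\<lambda>_. c) \<in> S" for c using S_pr[OF polynomials.const] .
  have S_sq: "(\<lambda>v. a v ^ 2) \<in> S" using square inv_polys_square by (simp add: S_def)
  have "\<exists>f\<in>S. \<exists>g\<in>S. \<forall>v. q v = f v + a v * g v" if "q \<in> polynomials scale" for q
    using that
  proof induction
    case (const c)
    show ?case by (rule bexI[OF _ S_const[of c]], rule bexI[OF _ S_const[of 0]]) simp
  next
    case (form l)
    show ?case
      by (rule bexI[OF _ S_pr[OF polynomials.form[OF form]]], rule bexI[OF _ S_const[of "l u"]])
        (simp add: pr_def linear_formD[OF form])
  next
    case (add p q)
    then obtain f g f' g' where *: "f \<in> S" "g \<in> S" "f' \<in> S" "g' \<in> S"
      "\<forall>v. p v = f v + a v * g v" "\<forall>v. q v = f' v + a v * g' v" by blast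
    show ?case
      by (rule bexI[OF _ S_add[OF *(1,3)]], rule bexI[OF _ S_add[OF *(2,4)]])
        (simp add: * distrib_left add_ac)
  next
    case (mult p q)
    then obtain f g f' g' where *: "f \<in> S" "g \<in> S" "f' \<in> S" "g' \<in> S"
      "\<forall>v. p v = f v + a v * g v" "\<forall>v. q v = f' v + a v * g' v" by blast
    show ?case
    \<comment> \<open>Expand \<open>(f + a g) (f' + a g')\<close>: the product of the two odd parts
      carries \<open>a^2\<close>, which belongs to the even part.\<close>
    proof (rule bexI[of _ "\<lambda>v. f v * f' v + a v ^ 2 * (g v * g' v)"],
        rule bexI[of _ "\<lambda>v. f v * g' v + g v * f' v"], rule allI)
      show "(\<lambda>v. f v * f' v + a v ^ 2 * (g v * g' v)) \<in> S"
        using S_add[OF S_mult[OF *(1,3)] S_mult[OF S_sq S_mult[OF *(2,4)]]] .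
      show "(\<lambda>v. f v * g' v + g v * f' v) \<in> S"
        using S_add[OF S_mult[OF *(1,4)] S_mult[OF *(2,3)]] .
      show "p v * q v = f v * f' v + a v ^ 2 * (g v * g' v) + a v * (f v * g' v + g v * f' v)"
        for v
        unfolding *(5)[rule_format, of v] *(6)[rule_format, of v]
        by (simp add: algebra_simps power2_eq_square)
    qed
  qed
  then obtain f g where fg: "f \<in> S" "g \<in> S" "\<And>v. p v = f v + a v * g v"
    using inv_polysD(1)[OF p] by blast
  have "f (s v) = f v" "g (s v) = g v" for v using fg inv_polysD(2) by (auto simp: S_def)
  then have "2 * (a v * g v) = 0" for v
    using inv_polysD(2)[OF p, of v] fg(3)[of v] fg(3)[of "s v"] by (simp add: a_s)
  then have "p = f" using fg(3) by auto
  then show ?thesis using fg(1) by (simp add: S_def)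
qed

text \<open>The induction proves more: within the invariants, \<open>p\<close> minus its pull-back
  along \<open>pr\<close> is always a multiple of \<open>a^2\<close>. If \<open>p\<close> vanishes
  on the hyperplane, that pull-back is zero. This identifies the kernel of restriction to the
  hyperplane.\<close>

lemma inv_polys_vanishing:
  assumes "p \<in> inv_polys" "\<And>v. a v = 0 \<Longrightarrow> p v = 0"
  obtains q where "q \<in> inv_polys" "\<And>v. p v = a v ^ 2 * q v"
proof -
  have "\<exists>q\<in>inv_polys. \<forall>v. p v = p (pr v) + a v ^ 2 * q v"
    using assms(1)
  proof (induction rule: inv_polys_induct)
    case (pr q)
    show ?case by (rule bexI[OF _ inv_polys_const[of 0]]) (use pr_line(1)[of _ 0] in auto)
  next
    case square
    show ?case by (rule bexI[OF _ inv_polys_const[of 1]]) (simp add: a_pr)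
  next
    case (add p q)
    then obtain f g where *: "f \<in> inv_polys" "g \<in> inv_polys"
      "\<forall>v. p v = p (pr v) + a v ^ 2 * f v" "\<forall>v. q v = q (pr v) + a v ^ 2 * g v" by blast
    show ?case
    proof (rule bexI[OF _ inv_polys_add[OF *(1,2)]], intro allI)
      fix v
      show "p v + q v = p (pr v) + q (pr v) + (a v)\<^sup>2 * (f v + g v)"
        unfolding *(3)[rule_format, of v] *(4)[rule_format, of v]
        by (simp add: algebra_simps pr_line(1)[of v 0, simplified])
    qed
  next
    case (mult p q)
    then obtain f g where *: "f \<in> inv_polys" "g \<in> inv_polys"
      "\<forall>v. p v = p (pr v) + a v ^ 2 * f v" "\<forall>v. q v = q (pr v) + a v ^ 2 * g v" by blast
    have P: "(\<lambda>v. p (pr v)) \<in> inv_polys" using mult inv_polysD inv_polys_pr by blast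
    show ?case
    proof (rule bexI[OF _ inv_polys_add[OF inv_polys_mult[OF *(1) mult.hyps(2)] inv_polys_mult[OF P
      *(2)]]], intro allI)
      fix v
      \<comment> \<open>The factors are replaced by their pull-backs one at a time.\<close>
      have "p v * q v = (p (pr v) + a v ^ 2 * f v) * q v"
        using *(3)[rule_format, of v] by simp
      also have "\<dots> = p (pr v) * (q (pr v) + a v ^ 2 * g v) + a v ^ 2 * (f v * q v)"
        using *(4)[rule_format, of v] by (simp add: algebra_simps)
      finally show "p v * q v = p (pr v) * q (pr v) + (a v)\<^sup>2 * (f v * q v + p (pr v) * g v)"
        by (simp add: algebra_simps)
    qed
  qed
  then show thesis using that assms(2) a_pr by auto
qed

text \<open>With \<open>X = a\<^sup>2\<close>, this is \<open>p(X + Y)\<close> as a polynomial in \<open>Y\<close>.\<close>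

definition taylor :: "('v \<Rightarrow> 'k) \<Rightarrow> 'v \<Rightarrow> 'k poly" where
  "taylor p v = (THE P. \<forall>t. poly P (t ^ 2 - a v ^ 2) = p (pr v + scale t u))"

lemma taylor_unique:
  assumes "\<And>t. poly P (t ^ 2 - a v ^ 2) = p (pr v + scale t u)"
  shows "taylor p v = P"
  unfolding taylor_def
proof (rule the_equality)
  show "\<forall>t. poly P (t ^ 2 - a v ^ 2) = p (pr v + scale t u)" using assms by blast
  fix Q assume Q: "\<forall>t. poly Q (t ^ 2 - a v ^ 2) = p (pr v + scale t u)"
  have "poly ((Q - P) \<circ>\<^sub>p [:- (a v ^ 2), 0, 1:]) t = 0" for t
    using Q assms[of t] by (simp add: poly_pcompose power2_eq_square)
  then have "(Q - P) \<circ>\<^sub>p [:- (a v ^ 2), 0, 1:] = 0" using poly_all_0_iff_0 by blast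
  then have "Q - P = 0" by (subst (asm) pcompose_eq_0_iff) auto
  then show "Q = P" by simp
qed

text \<open>On generators the expansion is explicit: a pull-back along \<open>pr\<close> is constant
  in \<open>Y\<close>, and \<open>a^2\<close> becomes \<open>a^2 + Y\<close>; uniqueness then
  handles sums and products. The degree bound has to be uniform in \<open>v\<close> in order that
  the coefficients form an element of \<open>S[Y]\<close>.\<close>

lemma taylor_exists:
  assumes "p \<in> inv_polys"
  shows "(\<forall>v t. poly (taylor p v) (t ^ 2 - a v ^ 2) = p (pr v + scale t u)) \<and>
    (\<forall>m. (\<lambda>v. poly.coeff (taylor p v) m) \<in> inv_polys) \<and>
    (\<exists>N. \<forall>m>N. \<forall>v. poly.coeff (taylor p v) m = 0)"
  using assms
proof (induction rule: inv_polys_induct)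
  case (pr q)
  have "taylor (\<lambda>v. q (pr v)) = (\<lambda>v. [:q (pr v):])"
    by (intro ext taylor_unique) (simp add: pr_line)
  moreover have "(\<lambda>v. poly.coeff [:q (pr v):] m) \<in> inv_polys" for m
    using inv_polys_pr[OF pr] inv_polys_const[of 0] by (cases m) simp_all
  ultimately show ?case
    by (auto simp: pr_line coeff_pCons split: nat.splits intro!: exI[of _ 0])
next
  case square
  have "taylor (\<lambda>v. a v ^ 2) = (\<lambda>v. [:a v ^ 2, 1:])"
    by (intro ext taylor_unique) (simp add: pr_line)
  moreover have "(\<lambda>v. poly.coeff [:a v ^ 2, 1:] m) \<in> inv_polys" for m
    using inv_polys_square inv_polys_const[of 0] inv_polys_const[of 1]
    by (cases m) (auto simp: coeff_pCons split: nat.splits)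
  ultimately show ?case
    by (auto simp: pr_line coeff_pCons split: nat.splits intro!: exI[of _ 1])
next
  case (add p q)
  have t: "taylor (\<lambda>v. p v + q v) = (\<lambda>v. taylor p v + taylor q v)"
    using add by (intro ext taylor_unique) simp
  obtain N M where "\<forall>m>N. \<forall>v. poly.coeff (taylor p v) m = 0" "\<forall>m>M. \<forall>v. poly.coeff (taylor q v) m = 0"
    using add by blast
  then have "\<forall>m>max N M. \<forall>v. poly.coeff (taylor p v + taylor q v) m = 0" by simp
  then have "\<exists>N. \<forall>m>N. \<forall>v. poly.coeff (taylor p v + taylor q v) m = 0" by blast
  moreover have "(\<lambda>v. poly.coeff (taylor p v + taylor q v) m) \<in> inv_polys" for m
    using add inv_polys_add by simp
  ultimately show ?case using add unfolding t by simp
next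
  case (mult p q)
  have t: "taylor (\<lambda>v. p v * q v) = (\<lambda>v. taylor p v * taylor q v)"
    using mult by (intro ext taylor_unique) simp
  obtain N M where NM: "\<forall>m>N. \<forall>v. poly.coeff (taylor p v) m
    = 0" "\<forall>m>M. \<forall>v. poly.coeff (taylor q v) m = 0"
    using mult by blast
  have "poly.coeff (taylor p v * taylor q v) m = 0" if "m > N + M" for m v
  proof -
    \<comment> \<open>Beyond \<open>N + M\<close> every term of the convolution has one factor past
      its own bound.\<close>
    have "poly.coeff (taylor p v) i * poly.coeff (taylor q v) (m - i) = 0" for i
    proof (cases "i \<le> N")
      case True
      then have "m - i > M" using that by simp
      then show ?thesis using NM by simp
    qed (use NM in simp)
    then show ?thesis unfolding coeff_mult by (intro sum.neutral) blast
  qed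
  moreover have "(\<lambda>v. poly.coeff (taylor p v * taylor q v) m) \<in> inv_polys" for m
    unfolding coeff_mult using mult by (intro inv_polys_sum inv_polys_mult) auto
  ultimately show ?case using mult unfolding t by auto
qed

lemma poly_taylor: "p \<in> inv_polys \<Longrightarrow> poly (taylor p v) (t ^ 2 - a v ^ 2) = p (pr v + scale t u)"
  and coeff_taylor: "p \<in> inv_polys \<Longrightarrow> (\<lambda>v. poly.coeff (taylor p v) m) \<in> inv_polys"
  and taylor_bound: "p \<in> inv_polys \<Longrightarrow> \<exists>N. \<forall>m>N. \<forall>v. poly.coeff (taylor p v) m = 0"
  using taylor_exists by blast+

lemma taylor_add: "p \<in> inv_polys \<Longrightarrow> q \<in> inv_polys \<Longrightarrow> taylor (\<lambda>v. p v + q v) v = taylor p v + taylor q v"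
  by (rule taylor_unique) (simp add: poly_taylor)

lemma taylor_mult: "p \<in> inv_polys \<Longrightarrow> q \<in> inv_polys \<Longrightarrow> taylor (\<lambda>v. p v * q v) v = taylor p v * taylor q v"
  by (rule taylor_unique) (simp add: poly_taylor)

lemma taylor_const: "taylor (\<lambda>_. c) v = [:c:]"
  by (rule taylor_unique) simp

lemma taylor_square: "taylor (\<lambda>v. a v ^ 2) v = [:a v ^ 2, 1:]"
  by (rule taylor_unique) (simp add: pr_line)

lemma coeff_taylor_0: "p \<in> inv_polys \<Longrightarrow> poly.coeff (taylor p v) 0 = p v"
  using poly_taylor[of p v "a v"] by (simp add: pr_add poly_0_coeff_0)

lemma subalgebra_inv_polys: "function_subalgebra UNIV inv_polys"
  using inv_polys_mult[OF inv_polys_const] inv_polys_const[of 1]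
  by (auto simp: function_subalgebra_def restr_def inv_polys_add inv_polys_mult)

text \<open>The substitution \<open>x -> x + Y\<close> from \<open>S\<close> to \<open>S[Y]\<close>,
  followed by \<open>c\<close> on coefficients. It deforms \<open>c\<close> over
  \<open>A[Y]\<close>, as the torsion argument requires.\<close>

lemma taylor_hom:
  assumes \<epsilon>: "inj \<epsilon>" and A: "cdga A" and c: "c \<in> dg_hom (RS \<epsilon> UNIV inv_polys) A"
  shows "(\<lambda>y m. c (\<epsilon> (\<lambda>v. poly.coeff (taylor (the_inv \<epsilon> y) v) m)))
    \<in> dg_hom (RS \<epsilon> UNIV inv_polys) (poly_dg A)" (is "?u \<in> dg_hom ?S _")
proof -
  interpret A: cdg A by (rule cdgI[OF A])
  note sub = subalgebra_inv_polys
  have S: "cdga ?S" by (rule cdga_RS[OF \<epsilon> sub])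
  interpret S: cdg ?S by (rule cdgI[OF S])
  note ops = RS_ops[OF \<epsilon>] and [simp] = the_inv_f_f[OF \<epsilon>]
  have c_in: "c (\<epsilon> p) \<in> hpart A 0" if "p \<in> inv_polys" for p
    using dg_homD(6)[OF c, of "\<epsilon> p" 0] that by (simp add: RS_simps)
  have c0: "c (\<epsilon> (\<lambda>_. 0)) = \<zero>\<^bsub>A\<^esub>" using dg_hom_zero[OF S A c] by (simp add: RS_simps)
  have c1: "c (\<epsilon> (\<lambda>_. 1)) = \<one>\<^bsub>A\<^esub>" using dg_homD(4)[OF c] by (simp add: RS_simps restr_def)
  have c_add: "c (\<epsilon> (\<lambda>v. p v + q v)) = c (\<epsilon> p) \<oplus>\<^bsub>A\<^esub> c (\<epsilon> q)" if "p \<in> inv_polys" "q \<in> inv_polys" for p q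
    using dg_homD(3)[OF c, of "\<epsilon> p" "\<epsilon> q"] that by (simp add: RS_simps ops)
  have c_mult: "c (\<epsilon> (\<lambda>v. p v * q v)) = c (\<epsilon> p) \<otimes>\<^bsub>A\<^esub> c (\<epsilon> q)" if "p \<in> inv_polys" "q \<in> inv_polys" for p q
    using dg_homD(2)[OF c, of "\<epsilon> p" "\<epsilon> q"] that by (simp add: RS_simps ops)
  have c_sum: "c (\<epsilon> (\<lambda>v. \<Sum>i\<in>I. f i v)) = finsum A (\<lambda>i. c (\<epsilon> (f i))) I"
    if "finite I" "\<And>i. i \<in> I \<Longrightarrow> f i \<in> inv_polys" for I and f :: "nat \<Rightarrow> 'v \<Rightarrow> 'k"
  proof -
    have "c (finsum ?S (\<lambda>i. \<epsilon> (f i)) I) = finsum A (\<lambda>i. c (\<epsilon> (f i))) I"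
      using that dg_homD(1,3)[OF c] dg_hom_zero[OF S A c]
      by (intro S.hom_finsum_into) (auto simp: RS_simps A.abelian_group_axioms)
    then show ?thesis using RS_finsum[OF \<epsilon> sub that] by simp
  qed
  have u_up: "?u (\<epsilon> p) \<in> up A" if p: "p \<in> inv_polys" for p
  proof
    show "?u (\<epsilon> p) m \<in> carrier A" for m
      using A.hpart_carrier[OF c_in[OF coeff_taylor[OF p]]] by simp
    obtain N where N: "\<forall>m>N. \<forall>v. poly.coeff (taylor p v) m = 0" using taylor_bound[OF p] by blast
    have "bound \<zero>\<^bsub>A\<^esub> N (?u (\<epsilon> p))" using N c0 by (auto simp: bound_def)
    then show "\<exists>n. bound \<zero>\<^bsub>A\<^esub> n (?u (\<epsilon> p))" by blast
  qed
  show ?thesis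
  proof (rule dg_homI)
    fix x assume "x \<in> carrier ?S"
    then obtain p where p: "p \<in> inv_polys" "x = \<epsilon> p" by (auto simp: RS_simps)
    show "?u x \<in> carrier (poly_dg A)" using u_up p by (simp add: poly_dg_def)
    have z: "dif A (c (\<epsilon> q)) = \<zero>\<^bsub>A\<^esub>" if "q \<in> inv_polys" for q using A.dif_hpart_0[OF c_in[OF that]] .
    show "?u (dif ?S x) = dif (poly_dg A) (?u x)"
      using z[OF coeff_taylor[OF p(1)]] c0 by (simp add: p(2) RS_simps taylor_const poly_dg_def
        coeff_pCons split: nat.splits)
    show "?u (k \<odot>\<^bsub>?S\<^esub> x) = k \<odot>\<^bsub>poly_dg A\<^esub> ?u x" for k
    proof
      fix m
      have "taylor (\<lambda>v. k * p v) v = smult k (taylor p v)" for v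
        using taylor_mult[OF inv_polys_const p(1), of k] by (simp add: taylor_const)
      then show "?u (k \<odot>\<^bsub>?S\<^esub> x) m = (k \<odot>\<^bsub>poly_dg A\<^esub> ?u x) m"
        using dg_homD(5)[OF c, of "\<epsilon> (\<lambda>v. poly.coeff (taylor p v) m)" k] coeff_taylor[OF p(1)]
        by (simp add: p(2) ops RS_simps poly_dg_def)
    qed
    fix y assume "y \<in> carrier ?S"
    then obtain q where q: "q \<in> inv_polys" "y = \<epsilon> q" by (auto simp: RS_simps)
    show "?u (x \<oplus>\<^bsub>?S\<^esub> y) = ?u x \<oplus>\<^bsub>poly_dg A\<^esub> ?u y"
      by (simp add: p(2) q(2) ops poly_dg_def taylor_add[OF p(1) q(1)]
          c_add[OF coeff_taylor[OF p(1)] coeff_taylor[OF q(1)]])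
    show "?u (x \<otimes>\<^bsub>?S\<^esub> y) = ?u x \<otimes>\<^bsub>poly_dg A\<^esub> ?u y"
    proof
      fix m
      have "?u (x \<otimes>\<^bsub>?S\<^esub> y) m
          = c (\<epsilon> (\<lambda>v. \<Sum>i\<le>m. poly.coeff (taylor p v) i * poly.coeff (taylor q v) (m - i)))"
        by (simp add: p(2) q(2) ops taylor_mult[OF p(1) q(1)] coeff_mult)
      also have "\<dots> = finsum A (\<lambda>i. c (\<epsilon> (\<lambda>v. poly.coeff (taylor p v) i * poly.coeff (taylor q v) (m
        - i)))) {..m}"
        by (intro c_sum inv_polys_mult coeff_taylor p q) auto
      also have "\<dots> = (?u x \<otimes>\<^bsub>poly_dg A\<^esub> ?u y) m"
        by (simp add: p(2) q(2) poly_dg_def c_mult[OF coeff_taylor[OF p(1)] coeff_taylor[OF q(1)]])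
      finally show "?u (x \<otimes>\<^bsub>?S\<^esub> y) m = (?u x \<otimes>\<^bsub>poly_dg A\<^esub> ?u y) m" .
    qed
  next
    show "?u \<one>\<^bsub>?S\<^esub> = \<one>\<^bsub>poly_dg A\<^esub>"
      by (auto simp: RS_simps restr_def taylor_const poly_dg_def fun_eq_iff coeff_pCons c0 c1 split:
        nat.splits)
    fix n x assume x: "x \<in> hpart ?S n"
    show "?u x \<in> hpart (poly_dg A) n"
    proof (cases "n = 0")
      case True
      then show ?thesis using x u_up c_in[OF coeff_taylor] by (auto simp: RS_simps poly_dg_def)
    next
      case False
      then have "x = \<epsilon> (\<lambda>_. 0)" using x by (simp add: RS_simps)
      then show ?thesis using u_up[OF inv_polys_const[of 0]] c0
        by (auto simp: poly_dg_def taylor_const)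
    qed
  qed
qed

text \<open>An application of \<open>cofibration_torsion_free\<close> to this deformation: its
  constant coefficient is \<open>c\<close>, and \<open>a^2\<close> goes to
  \<open>c(a^2) + Y\<close>. The type \<open>'u\<close> is infinite because constant functions embed
  the ground field into it.\<close>

lemma square_torsion_free:
  fixes \<epsilon> :: "('v \<Rightarrow> 'k) \<Rightarrow> 'u" and A :: "('k, 'u) dg_alg"
  assumes \<epsilon>: "inj \<epsilon>" and A: "cdga A" and c: "cofibration (RS \<epsilon> UNIV inv_polys) A c"
    and b: "b \<in> carrier A" "c (\<epsilon> (\<lambda>v. a v ^ 2)) \<otimes>\<^bsub>A\<^esub> b = \<zero>\<^bsub>A\<^esub>"
  shows "b = \<zero>\<^bsub>A\<^esub>"
proof (rule cofibration_torsion_free[OF A _ c taylor_hom[OF \<epsilon> A] _ _ _ b])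
  have ch: "c \<in> dg_hom (RS \<epsilon> UNIV inv_polys) A" using c by (simp add: cofibration_def)
  then show "c \<in> dg_hom (RS \<epsilon> UNIV inv_polys) A" .
  have "inj (\<lambda>k::'k. \<epsilon> (\<lambda>_. k))" using \<epsilon> by (auto simp: inj_def fun_eq_iff)
  then show "infinite (UNIV :: 'u set)"
    using infinite_UNIV_char_0[where 'a = 'k] finite_subset[OF subset_UNIV] finite_imageD by blast
  have S: "cdga (RS \<epsilon> UNIV inv_polys)" by (rule cdga_RS[OF \<epsilon> subalgebra_inv_polys])
  show "\<epsilon> (\<lambda>v. a v ^ 2) \<in> carrier (RS \<epsilon> UNIV inv_polys)"
    using inv_polys_square by (simp add: RS_simps)
  have "c (\<epsilon> (\<lambda>_. 0)) = \<zero>\<^bsub>A\<^esub>" using dg_hom_zero[OF S A ch] by (simp add: RS_simps)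
  moreover have "c (\<epsilon> (\<lambda>_. 1)) = \<one>\<^bsub>A\<^esub>" using dg_homD(4)[OF ch] by (simp add: RS_simps restr_def)
  moreover have "poly.coeff [:x, 1:] i = (if i = 0 then x else if i = 1 then 1 else 0)" for x :: 'k
    and i
    by (auto simp: coeff_pCons split: nat.split)
  ultimately show "(\<lambda>m. c (\<epsilon> (\<lambda>v. poly.coeff (taylor (the_inv \<epsilon> (\<epsilon> (\<lambda>v. a v ^ 2))) v) m))) =
      (\<lambda>i. if i = 0 then c (\<epsilon> (\<lambda>v. a v ^ 2)) else if i = 1 then \<one>\<^bsub>A\<^esub> else \<zero>\<^bsub>A\<^esub>)"
    by (auto simp: the_inv_f_f[OF \<epsilon>] taylor_square fun_eq_iff)
  show "c (\<epsilon> (\<lambda>v. poly.coeff (taylor (the_inv \<epsilon> y) v) 0)) = c y"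
    if "y \<in> carrier (RS \<epsilon> UNIV inv_polys)" for y
    using that by (auto simp: RS_simps the_inv_f_f[OF \<epsilon>] coeff_taylor_0)
qed

end

section \<open>Quasi-invariants of a single reflection\<close>

context reflection_form
begin

definition qi_polys :: "nat \<Rightarrow> ('v \<Rightarrow> 'k) set" where
  "qi_polys j = {p \<in> polynomials scale. \<exists>q\<in>polynomials scale. \<forall>v. p (s v) - p v = a v ^ (2 * j) * q v}"

lemma polynomials_s: "p \<in> polynomials scale \<Longrightarrow> (\<lambda>v. p (s v)) \<in> polynomials scale"
  by (rule polynomials_compose[OF _ linear_s])

lemma qi_polys_0: "qi_polys 0 = polynomials scale"
  using polynomials_diff[OF polynomials_s] by (auto simp: qi_polys_def)

text \<open>This matches the recursion produced by the join. Applying \<open>s\<close> to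
  \<open>p + a^2 q\<close> changes it by \<open>a^2\<close> times the change of \<open>q\<close>,
  which raises the order of divisibility by two; the converse splits \<open>f\<close> into its even
  and odd parts.\<close>

lemma qi_polys_Suc:
  "qi_polys (Suc j) = {\<lambda>v. p v + a v ^ 2 * q v | p q. p \<in> inv_polys \<and> q \<in> qi_polys j}" (is "_ = ?R")
proof (intro subset_antisym subsetI)
  fix f assume "f \<in> qi_polys (Suc j)"
  then obtain r where r: "f \<in> polynomials scale" "r \<in> polynomials scale"
    "\<And>v. f (s v) - f v = a v ^ (2 * Suc j) * r v"
    by (auto simp: qi_polys_def)
  \<comment> \<open>\<open>p\<close> is the even part of \<open>f\<close>. The odd part is
    \<open>- a^(2j+2) r / 2\<close>, and \<open>q\<close> is what is left of it after division by
    \<open>a^2\<close>.\<close>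
  define p where "p v = (1/2) * (f v + f (s v))" for v
  define q where "q v = (- 1/2) * (a v ^ (2 * j) * r v)" for v
  have q_pol: "q \<in> polynomials scale"
    unfolding q_def
    by (rule polynomials_scale[OF polynomials.mult[OF polynomials_power[OF polynomials.form[OF a]]
      r(2)]])
  have p_inv: "p \<in> inv_polys"
  proof
    show "p \<in> polynomials scale"
      unfolding p_def by (intro polynomials_scale polynomials.add r(1) polynomials_s)
    show "p (s v) = p v" for v by (simp add: p_def s_s add.commute)
  qed
  have "(\<lambda>v. (- 1/2) * (r (s v) - r v)) \<in> polynomials scale"
    by (intro polynomials_scale polynomials_diff polynomials_s r(2))
  moreover have "q (s v) - q v = a v ^ (2 * j) * ((- 1/2) * (r (s v) - r v))" for v
    by (simp add: q_def a_s uminus_power_if algebra_simps)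
  ultimately have "q \<in> qi_polys j"
    using q_pol unfolding qi_polys_def
    by (intro CollectI conjI bexI[of _ "\<lambda>v. (- 1/2) * (r (s v) - r v)"] allI)
  moreover have "f v = p v + a v ^ 2 * q v" for v
  proof -
    have "f v = (1/2) * (f v + f (s v)) - (1/2) * (f (s v) - f v)" by (simp add: field_simps)
    also have "\<dots> = p v + a v ^ 2 * q v"
      unfolding r(3) p_def q_def by (simp add: power2_eq_square)
    finally show ?thesis .
  qed
  then have "f = (\<lambda>v. p v + a v ^ 2 * q v)" by blast
  ultimately show "f \<in> ?R" using p_inv by blast
next
  fix f assume "f \<in> ?R"
  then obtain p q r where p: "p \<in> inv_polys" and q: "q \<in> polynomials scale"
    and r: "r \<in> polynomials scale" "\<And>v. q (s v) - q v = a v ^ (2 * j) * r v"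
    and f: "f = (\<lambda>v. p v + a v ^ 2 * q v)"
    by (auto simp: qi_polys_def)
  have "f \<in> polynomials scale"
    unfolding f by (rule polynomials.add[OF inv_polysD(1)[OF p]
      polynomials.mult[OF polynomials_power[OF polynomials.form[OF a]] q]])
  moreover have "f (s v) - f v = a v ^ (2 * Suc j) * r v" for v
  proof -
    have "f (s v) - f v = a v ^ 2 * (q (s v) - q v)"
      by (simp add: f inv_polysD(2)[OF p] a_s algebra_simps)
    then show ?thesis by (simp add: r(2) power2_eq_square)
  qed
  ultimately show "f \<in> qi_polys (Suc j)" using r(1) unfolding qi_polys_def by blast
qed

end

section \<open>Reflections in a finite group\<close>

locale reflection_rep =
  fixes scale :: "'k::field_char_0 \<Rightarrow> 'v::ab_group_add \<Rightarrow> 'v" and Basis :: "'v set"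
    and G :: "'g monoid" and S :: "'g set" and \<rho> :: "'g \<Rightarrow> 'v \<Rightarrow> 'v" and \<alpha> :: "'v set \<Rightarrow> 'v \<Rightarrow> 'k"
  assumes rep: "coxeter_reflection_rep scale Basis G S \<rho>"
    and forms: "hyperplane_forms scale (reflection_hyperplanes scale G \<rho>) \<alpha>"
begin

abbreviation \<A> where "\<A> \<equiv> reflection_hyperplanes scale G \<rho>"
abbreviation refl where "refl \<equiv> refl_at scale G \<rho>"

lemma group: "group G" and finite_G: "finite (carrier G)"
  and \<rho>_linear: "g \<in> carrier G \<Longrightarrow> Vector_Spaces.linear scale scale (\<rho> g)"
  and \<rho>_one [simp]: "\<rho> \<one>\<^bsub>G\<^esub> v = v"
  and \<rho>_mult: "g \<in> carrier G \<Longrightarrow> h \<in> carrier G \<Longrightarrow> \<rho> (g \<otimes>\<^bsub>G\<^esub> h) v = \<rho> g (\<rho> h v)"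
  and \<rho>_inj: "inj_on \<rho> (carrier G)"
  and fin_dim: "finite_dimensional_vector_space scale Basis"
  using rep unfolding coxeter_reflection_rep_def coxeter_system_def by auto

sublocale G: group G by (rule group)

sublocale V: vector_space_char_0 scale
  using fin_dim by (simp add: finite_dimensional_vector_space_def vector_space_char_0_def)

lemma \<alpha>_linear: "H \<in> \<A> \<Longrightarrow> Vector_Spaces.linear scale (*) (\<alpha> H)"
  and \<alpha>_zero: "H \<in> \<A> \<Longrightarrow> \<alpha> H v = 0 \<longleftrightarrow> v \<in> H"
  using forms unfolding hyperplane_forms_def by auto

lemma \<rho>_linearD:
  assumes "g \<in> carrier G"
  shows "\<rho> g (v + w) = \<rho> g v + \<rho> g w" "\<rho> g (v - w) = \<rho> g v - \<rho> g w" "\<rho> g (scale c v) = scale c (\<rho> g v)"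
proof -
  interpret l: Vector_Spaces.linear scale scale "\<rho> g" by (rule \<rho>_linear[OF assms])
  show "\<rho> g (v + w) = \<rho> g v + \<rho> g w" "\<rho> g (v - w) = \<rho> g v - \<rho> g w" "\<rho> g (scale c v) = scale c (\<rho> g v)"
    by (simp_all only: l.add l.diff l.scale)
qed

lemma \<rho>_inv [simp]: "g \<in> carrier G \<Longrightarrow> \<rho> (inv\<^bsub>G\<^esub> g) (\<rho> g v) = v" "g \<in> carrier G \<Longrightarrow> \<rho> g (\<rho> (inv\<^bsub>G\<^esub> g) v)
  = v"
  by (simp_all add: \<rho>_mult[symmetric])

text \<open>The reflection fixes the kernel of the form, so it adds \<open>\<alpha> H v\<close>
  times a fixed vector \<open>w\<close> to each \<open>v\<close>. Being an involution, it forces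
  \<open>\<alpha> H w = -2\<close>, so \<open>- w / 2\<close> is the normalised eigenvector.\<close>

lemma reflection_form_exists:
  assumes H: "H \<in> \<A>" and s: "s \<in> carrier G" "is_reflection scale (\<rho> s)" "fixed_space \<rho> {s} = H"
  obtains u where "reflection_form scale (\<rho> s) (\<alpha> H) u"
proof -
  note a = linear_formD[OF \<alpha>_linear[OF H]]
  have fix_iff: "\<rho> s v = v \<longleftrightarrow> \<alpha> H v = 0" for v
    using s(3) \<alpha>_zero[OF H] by (auto simp: fixed_space_def)
  have "{v. \<rho> s v = v} \<noteq> UNIV" using s(2) by (auto simp: is_reflection_def)
  then obtain v0 where v0: "\<alpha> H v0 \<noteq> 0" using fix_iff by auto
  define v1 where "v1 = scale (1 / \<alpha> H v0) v0"
  have v1: "\<alpha> H v1 = 1" using v0 by (simp add: v1_def a)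
  define w where "w = \<rho> s v1 - v1"
  have eq: "\<rho> s v = v + scale (\<alpha> H v) w" for v
  proof -
    have "\<alpha> H (v - scale (\<alpha> H v) v1) = 0" by (simp add: a v1)
    then have "\<rho> s (v - scale (\<alpha> H v) v1) = v - scale (\<alpha> H v) v1" using fix_iff by blast
    then have "\<rho> s v - scale (\<alpha> H v) (\<rho> s v1) = v - scale (\<alpha> H v) v1"
      by (simp only: \<rho>_linearD[OF s(1)])
    then show ?thesis by (simp add: w_def V.scale_right_diff_distrib algebra_simps)
  qed
  have "w \<noteq> 0" using fix_iff[of v1] v1 by (simp add: w_def)
  moreover have "scale (2 + \<alpha> H w) w = 0"
  proof -
    have "v1 = \<rho> s (\<rho> s v1)" using s(2) by (simp add: is_reflection_def o_def id_def fun_eq_iff)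
    also have "\<dots> = v1 + w + scale (1 + \<alpha> H w) w" by (simp add: eq a v1)
    finally have "w + scale (1 + \<alpha> H w) w = 0" by (simp add: add.assoc)
    moreover have "2 + \<alpha> H w = 1 + (1 + \<alpha> H w)" by simp
    ultimately show ?thesis by (simp only: V.scale_left_distrib[of 1] V.scale_one)
  qed
  ultimately have aw: "\<alpha> H w = - 2" by (simp add: add_eq_0_iff)
  have "reflection_form scale (\<rho> s) (\<alpha> H) (scale (- 1 / 2) w)"
  proof (intro reflection_form.intro[OF V.vector_space_char_0_axioms] reflection_form_axioms.intro)
    show "Vector_Spaces.linear scale (*) (\<alpha> H)" by (rule \<alpha>_linear[OF H])
    show "\<alpha> H (scale (- 1 / 2) w) = 1" by (simp only: a aw) simp
    show "\<rho> s v = v - scale (2 * \<alpha> H v) (scale (- 1 / 2) w)" for v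
      by (subst eq) simp
  qed
  then show thesis using that by blast
qed

text \<open>Two reflections in the same hyperplane differ by a transvection, which has infinite order in
  characteristic 0 unless it is trivial.\<close>

lemma reflection_unique:
  assumes H: "H \<in> \<A>" and s: "s \<in> carrier G" "is_reflection scale (\<rho> s)" "fixed_space \<rho> {s} = H"
    and t: "t \<in> carrier G" "is_reflection scale (\<rho> t)" "fixed_space \<rho> {t} = H"
  shows "s = t"
proof -
  obtain u where "reflection_form scale (\<rho> s) (\<alpha> H) u" using reflection_form_exists[OF H s] .
  then interpret s: reflection_form scale "\<rho> s" "\<alpha> H" u .
  obtain u' where "reflection_form scale (\<rho> t) (\<alpha> H) u'" using reflection_form_exists[OF H t] .
  then interpret t: reflection_form scale "\<rho> t" "\<alpha> H" u' .
  define d where "d = u - u'"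
  have ad: "\<alpha> H d = 0" by (simp add: d_def s.a_diff s.a_u t.a_u)
  have st: "\<rho> (s \<otimes>\<^bsub>G\<^esub> t) v = v + scale (2 * \<alpha> H v) d" for v
  proof -
    have "\<rho> (s \<otimes>\<^bsub>G\<^esub> t) v = \<rho> t v - scale (2 * \<alpha> H (\<rho> t v)) u"
      using \<rho>_mult[OF s(1) t(1)] s.s_eq by simp
    also have "\<dots> = v - scale (2 * \<alpha> H v) u' + scale (2 * \<alpha> H v) u"
      unfolding t.a_s by (simp add: t.s_eq)
    finally show ?thesis by (simp add: d_def V.scale_right_diff_distrib)
  qed
  have pow: "\<rho> ((s \<otimes>\<^bsub>G\<^esub> t) [^]\<^bsub>G\<^esub> n) v = v + scale (of_nat n * (2 * \<alpha> H v)) d" for n :: nat and v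
  proof (induction n arbitrary: v)
    case (Suc n)
    have "\<rho> ((s \<otimes>\<^bsub>G\<^esub> t) [^]\<^bsub>G\<^esub> Suc n) v = \<rho> ((s \<otimes>\<^bsub>G\<^esub> t) [^]\<^bsub>G\<^esub> n) (\<rho> (s \<otimes>\<^bsub>G\<^esub> t) v)"
      using s(1) t(1) \<rho>_mult[of "(s \<otimes>\<^bsub>G\<^esub> t) [^]\<^bsub>G\<^esub> n" "s \<otimes>\<^bsub>G\<^esub> t"] by simp
    also have "\<dots> = v + scale (2 * \<alpha> H v) d + scale (of_nat n * (2 * \<alpha> H v)) d"
      by (simp add: Suc st s.a_add s.a_scale ad)
    finally show ?case by (simp add: V.scale_left_distrib[symmetric] add.assoc distrib_right)
  qed simp
  \<comment> \<open>The form is 1 at \<open>u\<close>, so the group order yields a nonzero multiple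
    of \<open>d\<close> that vanishes.\<close>
  have "u + scale (of_nat (Coset.order G) * (2 * \<alpha> H u)) d = u"
    using pow[of "Coset.order G" u] G.pow_order_eq_1[of "s \<otimes>\<^bsub>G\<^esub> t"] s(1) t(1) by simp
  moreover have "Coset.order G > 0" using finite_G G.order_gt_0_iff_finite by simp
  ultimately have "d = 0" by (simp add: s.a_u)
  then have "\<rho> s = \<rho> t" using s.s_eq t.s_eq by (auto simp: d_def)
  then show ?thesis using inj_onD[OF \<rho>_inj] s(1) t(1) by blast
qed

lemma refl_props:
  assumes "H \<in> \<A>"
  shows "refl H \<in> carrier G" "is_reflection scale (\<rho> (refl H))" "fixed_space \<rho> {refl H} = H"
proof -
  have "\<exists>!s. s \<in> carrier G \<and> is_reflection scale (\<rho> s) \<and> fixed_space \<rho> {s} = H"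
    using assms reflection_unique[OF assms] unfolding reflection_hyperplanes_def by blast
  from theI'[OF this] show "refl H \<in> carrier G" "is_reflection scale (\<rho> (refl H))" "fixed_space \<rho>
    {refl H} = H"
    unfolding refl_at_def by auto
qed

lemma refl_eqI:
  "H \<in> \<A> \<Longrightarrow> s \<in> carrier G \<Longrightarrow> is_reflection scale (\<rho> s) \<Longrightarrow> fixed_space \<rho> {s} = H \<Longrightarrow> refl H = s"
  using reflection_unique refl_props by blast

lemma refl_form:
  assumes "H \<in> \<A>"
  obtains u where "reflection_form scale (\<rho> (refl H)) (\<alpha> H) u"
  using reflection_form_exists[OF assms refl_props[OF assms]] .

lemma refl_inv:
  assumes "H \<in> \<A>"
  shows "inv\<^bsub>G\<^esub> (refl H) = refl H"
proof -
  have "\<rho> (refl H \<otimes>\<^bsub>G\<^esub> refl H) = \<rho> \<one>\<^bsub>G\<^esub>"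
    using refl_props[OF assms] by (auto simp: \<rho>_mult is_reflection_def o_def id_def fun_eq_iff)
  then have "refl H \<otimes>\<^bsub>G\<^esub> refl H = \<one>\<^bsub>G\<^esub>"
    using inj_onD[OF \<rho>_inj] refl_props(1)[OF assms] by blast
  then show ?thesis using refl_props(1)[OF assms] G.inv_equality by blast
qed

lemma refl_not_one:
  assumes "H \<in> \<A>"
  shows "refl H \<noteq> \<one>\<^bsub>G\<^esub>"
proof
  assume "refl H = \<one>\<^bsub>G\<^esub>"
  then show False using refl_props(2)[OF assms] by (simp add: is_reflection_def)
qed

lemma fixed_space_refl_subgroup: "H \<in> \<A> \<Longrightarrow> fixed_space \<rho> (refl_subgroup scale G \<rho> H) = H"
  using refl_props(3)[of H] by (auto simp: fixed_space_def refl_subgroup_def)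

lemma translate_refl: "H \<in> \<A> \<Longrightarrow> translate G \<rho> (refl H) p v = p (\<rho> (refl H) v)"
  by (simp add: translate_def refl_inv)

lemma invariants_eq:
  assumes "H \<in> \<A>" "reflection_form scale (\<rho> (refl H)) (\<alpha> H) u"
  shows "invariants scale G \<rho> (refl_subgroup scale G \<rho> H)
    = reflection_form.inv_polys scale (\<rho> (refl H))"
proof -
  interpret r: reflection_form scale "\<rho> (refl H)" "\<alpha> H" u by fact
  have "translate G \<rho> \<one>\<^bsub>G\<^esub> p = p" for p :: "'v \<Rightarrow> 'k"
    by (simp add: translate_def fun_eq_iff)
  moreover have "translate G \<rho> (refl H) p = p \<longleftrightarrow> (\<forall>v. p (\<rho> (refl H) v) = p v)" for p :: "'v \<Rightarrow> 'k"
    using translate_refl[OF assms(1), of p] by (auto simp: fun_eq_iff)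
  ultimately show ?thesis
    by (auto simp: invariants_def refl_subgroup_def r.inv_polys_def)
qed

lemma quasi_invariants_eq:
  "quasi_invariants scale G \<rho> \<alpha> k =
    {p \<in> polynomials scale. \<forall>H\<in>\<A>. \<exists>q\<in>polynomials scale. \<forall>v. p (\<rho> (refl H) v) - p v
      = \<alpha> H v ^ (2 * k H) * q v}"
  by (auto simp: quasi_invariants_def translate_refl)

end

section \<open>The tower of derived joins\<close>

lemma (in vector_space_char_0) subalgebra_polynomials: "function_subalgebra UNIV (polynomials scale)"
  using polynomials.const[of 1 scale] polynomials_scale
  by (auto simp: function_subalgebra_def restr_def intro: polynomials.intros)

lemma (in vector_space_char_0) subalgebra_restr: "function_subalgebra H (restr H ` polynomials scale)"
proof -
  have "(\<lambda>v. restr H p v + restr H q v) = restr H (\<lambda>v. p v + q v)"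
    "(\<lambda>v. restr H p v * restr H q v) = restr H (\<lambda>v. p v * q v)"
    "(\<lambda>v. c * restr H p v) = restr H (\<lambda>v. c * p v)" for p q :: "'v \<Rightarrow> 'k" and c
    by (auto simp: restr_def)
  then show ?thesis
    using polynomials.const[of 1 scale]
    by (auto simp: function_subalgebra_def intro: polynomials.intros polynomials_scale) (simp add:
      restr_def)
qed

text \<open>For \<open>R\<close> concentrated in degree 0, this says that \<open>\<phi>\<close> maps
  the degree 0 cohomology of \<open>A\<close> isomorphically onto \<open>Q\<close> inside
  \<open>R\<close> and that all other cohomology vanishes. Every element of degree 0 is a cocycle,
  so the conditions there refer to \<open>hpart A 0\<close>.\<close>

definition resolves :: "('k, 'u) dg_alg \<Rightarrow> ('k, 'u) dg_alg \<Rightarrow> ('u \<Rightarrow> 'u) \<Rightarrow> 'u set \<Rightarrow> bool" where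
  "resolves A R \<phi> Q \<longleftrightarrow> \<phi> \<in> dg_hom A R \<and> (\<forall>n<0. \<forall>a\<in>cocycles A n. a \<in> boundaries A n) \<and>
     (\<forall>a\<in>hpart A 0. \<phi> a = \<zero>\<^bsub>R\<^esub> \<longrightarrow> a \<in> boundaries A 0) \<and> \<phi> ` hpart A 0 = Q"

context reflection_rep
begin

text \<open>An instance of \<open>join_step\<close> with \<open>s0\<close> the square of the form
  and \<open>R = k[V]\<close>. Cohomological hypotheses on \<open>M\<close> pass to its replacement
  \<open>M'\<close> through the quasi-isomorphism \<open>q\<close>, whereas freeness from torsion
  holds for \<open>M'\<close> because \<open>c\<close> is a cofibration.\<close>

lemma join_step_resolves:
  fixes \<epsilon> :: "('v \<Rightarrow> 'k) \<Rightarrow> 'u"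
  assumes H: "H \<in> \<A>" and form: "reflection_form scale (\<rho> (refl H)) (\<alpha> H) u" and \<epsilon>: "inj \<epsilon>"
    and M: "cdga M" and M': "cdga M'" and N': "cdga N'"
    and \<phi>: "resolves M (RS \<epsilon> UNIV (polynomials scale)) \<phi>
      (\<epsilon> ` reflection_form.qi_polys scale (\<rho> (refl H)) (\<alpha> H) j)"
    and \<phi>c: "\<And>x. x \<in> carrier (RS \<epsilon> UNIV (reflection_form.inv_polys scale (\<rho> (refl H))))
      \<Longrightarrow> \<phi> (q (c x)) = x"
    and q: "quasi_iso M' M q"
    and c: "cofibration (RS \<epsilon> UNIV (reflection_form.inv_polys scale (\<rho> (refl H)))) M' c"
    and po: "is_pushout (RS \<epsilon> UNIV (reflection_form.inv_polys scale (\<rho> (refl H)))) M'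
      (RS \<epsilon> H (restr H ` polynomials scale)) c (lift \<epsilon> (restr H)) Z zM zN"
    and w: "quasi_iso (RS \<epsilon> H (restr H ` polynomials scale)) N' w"
    and p: "fibration N' Z p"
    and pw: "\<And>y. y \<in> carrier (RS \<epsilon> H (restr H ` polynomials scale)) \<Longrightarrow> p (w y) = zN y"
    and pb: "is_pullback M' N' Z zM p J rM rN"
  shows "resolves J (RS \<epsilon> UNIV (polynomials scale)) (\<lambda>a. \<phi> (q (rM a)))
      (\<epsilon> ` reflection_form.qi_polys scale (\<rho> (refl H)) (\<alpha> H) (Suc j))"
proof -
  interpret r: reflection_form scale "\<rho> (refl H)" "\<alpha> H" u by fact
  let ?S = "RS \<epsilon> UNIV r.inv_polys" and ?N = "RS \<epsilon> H (restr H ` polynomials scale)"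
  let ?R = "RS \<epsilon> UNIV (polynomials scale)"
  note ops = RS_ops[OF \<epsilon>] and [simp] = the_inv_f_f[OF \<epsilon>]
  have S: "cdga ?S" by (rule cdga_RS[OF \<epsilon> r.subalgebra_inv_polys])
  have N: "cdga ?N" by (rule cdga_RS[OF \<epsilon> V.subalgebra_restr])
  have R: "cdga ?R" by (rule cdga_RS[OF \<epsilon> V.subalgebra_polynomials])
  have lift: "lift \<epsilon> (restr H) (\<epsilon> f) = \<epsilon> (restr H f)" for f by (simp add: lift_def)
  have eps: "\<epsilon> f = \<epsilon> g \<longleftrightarrow> f = g" for f g using \<epsilon> by (auto simp: inj_def)
  have sq: "(\<lambda>v. \<alpha> H v ^ 2) \<in> r.inv_polys" by (rule r.inv_polys_square)
  have restr0: "restr H (\<lambda>_. 0) = (\<lambda>_. 0)" by (auto simp: restr_def)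
  have g: "lift \<epsilon> (restr H) \<in> dg_hom ?S ?N"
  proof -
    have "restr H (\<lambda>v. p v + q v) = (\<lambda>v. restr H p v + restr H q v)"
      "restr H (\<lambda>v. p v * q v) = (\<lambda>v. restr H p v * restr H q v)"
      "restr H (\<lambda>v. c * p v) = (\<lambda>v. c * restr H p v)"
      "restr H (restr UNIV p) = restr H p" for p q :: "'v \<Rightarrow> 'k" and c
      by (auto simp: restr_def)
    then show ?thesis
      by (intro dg_homI) (auto simp: RS_simps ops lift restr0 r.inv_polysD(1) split: if_splits)
  qed
  have q_hom: "q \<in> dg_hom M' M" using q by (simp add: quasi_iso_def)
  have \<phi>_hom: "\<phi> \<in> dg_hom M ?R" using \<phi> by (simp add: resolves_def)
  have \<psi>: "(\<lambda>m. \<phi> (q m)) \<in> dg_hom M' ?R" by (rule dg_hom_compose[OF q_hom \<phi>_hom])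
  have i: "(\<lambda>x. x) \<in> dg_hom ?S ?R"
    by (rule dg_homI) (auto simp: RS_simps RSpec_def function_algebra_def r.inv_polysD)
  have c_hom: "c \<in> dg_hom ?S M'" using c by (simp add: cofibration_def)
  note q_iff = q[unfolded quasi_iso_iff[OF M' M q_hom]]
  interpret M': cdg M' by (rule cdgI[OF M'])
  interpret M: cdg M by (rule cdgI[OF M])
  interpret st: join_step ?S M' ?N Z N' J ?R c "lift \<epsilon> (restr H)" zM zN w p rM rN
    "\<lambda>m. \<phi> (q m)" "\<lambda>x. x" "\<epsilon> (\<lambda>v. \<alpha> H v ^ 2)"
  proof (rule join_step.intro[OF S M' N N' R c_hom g \<psi> i po w p pw pb \<phi>c], goal_cases)
    case 3
    then show ?case using sq by (simp add: RS_simps)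
  next
    case 4
    have "restr H (\<lambda>v. (\<alpha> H v)\<^sup>2) = (\<lambda>_. 0)" by (auto simp: restr_def \<alpha>_zero[OF H, symmetric])
    then show ?case by (simp add: lift RS_simps)
  next
    case (5 n y)
    show ?case
    proof (cases "n = 0")
      case True
      then obtain p where p: "p \<in> polynomials scale" "y = \<epsilon> (restr H p)" using 5
        by (auto simp: RS_simps)
      \<comment> \<open>The pull-back of \<open>p\<close> along the projection is invariant and
        agrees with \<open>p\<close> on \<open>H\<close>, so restriction is onto already from the
        invariants.\<close>
      have "r.pr v = v" if "v \<in> H" for v using that \<alpha>_zero[OF H] by (simp add: r.pr_def)
      then have "restr H (\<lambda>v. p (r.pr v)) = restr H p" by (auto simp: restr_def)
      then show ?thesis using p True r.inv_polys_pr[OF p(1)]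
        by (intro bexI[of _ "\<epsilon> (\<lambda>v. p (r.pr v))"]) (auto simp: RS_simps lift)
    next
      case False
      then show ?thesis using 5 by (auto simp: RS_simps lift restr0)
    qed
  next
    case (6 s)
    then obtain p where p: "p \<in> r.inv_polys" "s = \<epsilon> p" by (auto simp: RS_simps)
    have "restr H p = (\<lambda>_. 0)" using 6(2) by (simp add: p(2) lift RS_simps eps)
    from fun_cong[OF this] have "p v = 0" if "\<alpha> H v = 0" for v
      using that \<alpha>_zero[OF H, of v] unfolding restr_def by (metis (full_types))
    then obtain f where "f \<in> r.inv_polys" "\<And>v. p v = \<alpha> H v ^ 2 * f v"
      using r.inv_polys_vanishing[OF p(1)] by blast
    then show ?case
      by (intro bexI[of _ "\<epsilon> f"]) (auto simp: p(2) ops RS_simps intro!: arg_cong[of _ _ \<epsilon>])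
  next
    case (7 b)
    then show ?case using r.square_torsion_free[OF \<epsilon> M' c] by blast
  next
    case (8 n m)
    have "q m \<in> boundaries M n"
      using \<phi> 8 dg_hom_cocycles[OF M' M q_hom 8(2)] by (auto simp: resolves_def)
    then show ?case using q_iff 8 by blast
  next
    case (9 m)
    then have "q m \<in> boundaries M 0" using \<phi> dg_homD(6)[OF q_hom 9(1)] by (auto simp: resolves_def)
    then show ?case using q_iff M'.hpart_0_cocycles[OF 9(1)] by blast
  next
    case (12 x)
    then obtain f where f: "f \<in> polynomials scale" "x = \<epsilon> f" by (auto simp: RS_simps)
    have "(\<lambda>v. \<alpha> H v ^ 2 * f v) = (\<lambda>_. 0)" using 12(2) by (simp add: f(2) ops RS_simps eps)
    then have "f v = 0" for v using r.form_power_cancel[OF f(1), of 2] by (simp add: fun_eq_iff)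
    then show ?case by (auto simp: f(2) RS_simps intro!: arg_cong[of _ _ \<epsilon>])
  next
    case (13 s x)
    then obtain p f where f: "p \<in> r.inv_polys" "s = \<epsilon> p" "x = \<epsilon> f" by (auto simp: RS_simps)
    have "p = (\<lambda>v. \<alpha> H v ^ 2 * f v)" using 13(3) by (simp add: f ops eps)
    then have "restr H p = (\<lambda>_. 0)" by (auto simp: restr_def \<alpha>_zero[OF H, symmetric])
    then show ?case by (simp add: f lift RS_simps)
  qed (simp_all add: RS_simps)
  have R_b: "x = \<epsilon> (\<lambda>_. 0)" if "x \<in> boundaries ?R n" for x n
    using that by (auto simp: boundaries_def RS_simps)
  have "(\<lambda>m. \<phi> (q m)) ` hpart M' 0 = \<epsilon> ` r.qi_polys j"
  proof -
    \<comment> \<open>\<open>q\<close> reaches every class, and boundaries die in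
      \<open>k[V]\<close>; therefore \<open>M\<close> and \<open>M'\<close> have the same image in
      degree 0.\<close>
    have "\<exists>m\<in>hpart M' 0. \<phi> a = \<phi> (q m)" if a: "a \<in> hpart M 0" for a
    proof -
      obtain m where m: "m \<in> cocycles M' 0" "a \<ominus>\<^bsub>M\<^esub> q m \<in> boundaries M 0"
        using q_iff M.hpart_0_cocycles[OF a] by blast
      have c: "a \<in> carrier M" "q m \<in> carrier M"
        using M.hpart_carrier[OF a] dg_homD(1)[OF q_hom M'.cocycles_carrier[OF m(1)]] .
      interpret R: cdg ?R by (rule cdgI[OF R])
      have "\<phi> a \<ominus>\<^bsub>?R\<^esub> \<phi> (q m) = \<zero>\<^bsub>?R\<^esub>"
        using R_b[OF dg_hom_boundaries[OF M \<phi>_hom m(2)]] dg_hom_minus[OF M R \<phi>_hom c]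
        by (simp add: RS_simps)
      then have "\<phi> a = \<phi> (q m)"
        using dg_homD(1)[OF \<phi>_hom c(1)] dg_homD(1)[OF \<phi>_hom c(2)] by simp
      then show ?thesis using m(1) by (auto simp: cocycles_def)
    qed
    then have "(\<lambda>m. \<phi> (q m)) ` hpart M' 0 = \<phi> ` hpart M 0"
      using dg_homD(6)[OF q_hom] by (auto simp: image_iff)
    then show ?thesis using \<phi> by (simp add: resolves_def)
  qed
  moreover have "{s \<oplus>\<^bsub>?R\<^esub> \<epsilon> (\<lambda>v. \<alpha> H v ^ 2) \<otimes>\<^bsub>?R\<^esub> x | s x. s \<in> hpart ?S 0 \<and> x \<in> \<epsilon> ` r.qi_polys j}
      = \<epsilon> ` r.qi_polys (Suc j)"
  proof (intro subset_antisym subsetI)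
    fix y assume "y \<in> \<epsilon> ` r.qi_polys (Suc j)"
    then obtain p f where f: "p \<in> r.inv_polys" "f \<in> r.qi_polys j" "y = \<epsilon> (\<lambda>v. p v + \<alpha> H v ^ 2 * f v)"
      unfolding r.qi_polys_Suc by blast
    have "y = \<epsilon> p \<oplus>\<^bsub>?R\<^esub> \<epsilon> (\<lambda>v. \<alpha> H v ^ 2) \<otimes>\<^bsub>?R\<^esub> \<epsilon> f" by (simp add: f(3) ops)
    moreover have "\<epsilon> p \<in> hpart ?S 0" using f(1) by (simp add: RS_simps)
    ultimately show "y \<in> {s \<oplus>\<^bsub>?R\<^esub> \<epsilon> (\<lambda>v. \<alpha> H v ^ 2) \<otimes>\<^bsub>?R\<^esub> x | s x. s \<in> hpart ?S 0
      \<and> x \<in> \<epsilon> ` r.qi_polys j}"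
      using f(2) by blast
  qed (auto simp: RS_simps ops r.qi_polys_Suc intro!: imageI, blast)
  ultimately have "(\<lambda>a. \<phi> (q (rM a))) ` hpart J 0 = \<epsilon> ` r.qi_polys (Suc j)"
    using st.J_image by simp
  then show ?thesis
    unfolding resolves_def
    using dg_hom_compose[OF st.rM \<psi>] st.J_acyclic st.J_inj by blast
qed

end

context reflection_rep
begin

text \<open>The induction must also carry the last clause: \<open>c j\<close> followed by the map to
  \<open>k[V]\<close> is the inclusion of the invariants. The next join needs this compatibility to
  express its image as \<open>S + x Q_j\<close>.\<close>

lemma join_tower_resolves:
  fixes \<epsilon> :: "('v \<Rightarrow> 'k) \<Rightarrow> 'u"
  assumes \<epsilon>: "inj \<epsilon>" and tower: "join_tower scale G \<rho> \<epsilon> A c e"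
    and H: "H \<in> \<A>" and form: "reflection_form scale (\<rho> (refl H)) (\<alpha> H) u"
  shows "cdga (obj (A j) H) \<and>
    resolves (obj (A j) H) (RS \<epsilon> UNIV (polynomials scale)) (from_space e j H)
      (\<epsilon> ` reflection_form.qi_polys scale (\<rho> (refl H)) (\<alpha> H) j) \<and>
    (\<forall>x\<in>carrier (RS \<epsilon> UNIV (reflection_form.inv_polys scale (\<rho> (refl H)))). from_space e j H (c j H
      x) = x)"
proof -
  interpret r: reflection_form scale "\<rho> (refl H)" "\<alpha> H" u by fact
  let ?S = "RS \<epsilon> UNIV r.inv_polys" and ?N = "RS \<epsilon> H (restr H ` polynomials scale)"
  let ?R = "RS \<epsilon> UNIV (polynomials scale)"
  have R: "cdga ?R" by (rule cdga_RS[OF \<epsilon> V.subalgebra_polynomials])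
  interpret R: cdg ?R by (rule cdgI[OF R])
  have Sobj: "obj (quotient_fam scale G \<rho> \<epsilon>) H = ?S"
    using invariants_eq[OF H form] by (simp add: quotient_fam_def function_fam_def)
  have Nobj: "obj (hyperplane_fam scale G \<rho> \<epsilon>) H = ?N"
    by (simp add: hyperplane_fam_def function_fam_def)
  have A0: "obj (A 0) H = ?R"
    using tower by (simp add: join_tower_def space_fam_def function_fam_def)
  show ?thesis
  proof (induction j)
    case 0
    have "resolves ?R ?R (\<lambda>x. x) (\<epsilon> ` polynomials scale)"
      unfolding resolves_def
    proof (intro conjI dg_hom_id allI impI ballI)
      fix n :: int and a assume "n < 0" "a \<in> cocycles ?R n"
      then have "a = \<zero>\<^bsub>?R\<^esub>" by (auto simp: cocycles_def RS_simps)
      then show "a \<in> boundaries ?R n" using R.zero_boundaries by simp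
    qed (use R.zero_boundaries in \<open>auto simp: RS_simps\<close>)
    moreover have "c 0 H x = x" if "x \<in> carrier ?S" for x
      using tower H that Sobj by (auto simp: join_tower_def)
    ultimately show ?case using R by (simp add: A0 r.qi_polys_0 id_def)
  next
    case (Suc j)
    have "derived_join G (hyp_action \<rho>) \<A> (quotient_fam scale G \<rho> \<epsilon>) (A j) (hyperplane_fam scale G \<rho> \<epsilon>)
            (c j) (\<lambda>H. lift \<epsilon> (restr H)) (A (Suc j)) (c (Suc j)) (e j)"
      using tower by (simp add: join_tower_def)
    then obtain M' c' q Z zM zN N' w rM rN where
      hf: "homotopy_fibre_product G (hyp_action \<rho>) \<A> (quotient_fam scale G \<rho> \<epsilon>) (A j)
        (hyperplane_fam scale G \<rho> \<epsilon>) (c j) (\<lambda>H. lift \<epsilon> (restr H)) M' c' q Z zM zN"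
      and hp: "homotopy_pushout G (hyp_action \<rho>) \<A> M' (hyperplane_fam scale G \<rho> \<epsilon>) Z zM zN N' w (A
        (Suc j)) rM rN"
      and str: "\<forall>H\<in>\<A>. (\<forall>s\<in>carrier (obj (quotient_fam scale G \<rho> \<epsilon>) H).
            rM H (c (Suc j) H s) = c' H s) \<and>
          (\<forall>a\<in>carrier (obj (A (Suc j)) H). e j H a = q H (rM H a))"
      and cJ: "equiv_map G (hyp_action \<rho>) \<A> (quotient_fam scale G \<rho> \<epsilon>) (A (Suc j)) (c (Suc j))"
      unfolding derived_join_def by blast
    have M': "cdga (obj M' H)" and q: "quasi_iso (obj M' H) (obj (A j) H) (q H)"
      and c': "cofibration ?S (obj M' H) (c' H)" "\<And>s. s \<in> carrier ?S \<Longrightarrow> q H (c' H s) = c j H s"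
      and po: "is_pushout ?S (obj M' H) ?N (c' H) (lift \<epsilon> (restr H)) (obj Z H) (zM H) (zN H)"
      using hf H unfolding homotopy_fibre_product_def equiv_family_def equiv_quasi_iso_def
      by (auto simp: Sobj[symmetric] Nobj[symmetric])
    obtain p where fam: "equiv_family G (hyp_action \<rho>) \<A> N'" "equiv_family G (hyp_action \<rho>) \<A> (A
      (Suc j))"
      and wq: "equiv_quasi_iso G (hyp_action \<rho>) \<A> (hyperplane_fam scale G \<rho> \<epsilon>) N' w"
      and pf: "\<forall>i\<in>\<A>. fibration (obj N' i) (obj Z i) (p i) \<and>
         (\<forall>y\<in>carrier (obj (hyperplane_fam scale G \<rho> \<epsilon>) i). p i (w i y) = zN i y) \<and>
         is_pullback (obj M' i) (obj N' i) (obj Z i) (zM i) (p i) (obj (A (Suc j)) i) (rM i) (rN i)"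
      using hp unfolding homotopy_pushout_def by blast
    have N': "cdga (obj N' H)" and J: "cdga (obj (A (Suc j)) H)"
      using fam H unfolding equiv_family_def by blast+
    have w: "quasi_iso ?N (obj N' H) (w H)"
      using wq H unfolding equiv_quasi_iso_def Nobj[symmetric] by blast
    have p: "fibration (obj N' H) (obj Z H) (p H)"
      and pw: "\<And>y. y \<in> carrier ?N \<Longrightarrow> p H (w H y) = zN H y"
      and pb: "is_pullback (obj M' H) (obj N' H) (obj Z H) (zM H) (p H) (obj (A (Suc j)) H) (rM H)
        (rN H)"
      using bspec[OF pf H] unfolding Nobj by blast+
    let ?J = "obj (A (Suc j)) H"
    have \<phi>c: "from_space e j H (q H (c' H x)) = x" if "x \<in> carrier ?S" for x
      using Suc c'(2)[OF that] that by simp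
    have res: "resolves ?J ?R (\<lambda>a. from_space e j H (q H (rM H a))) (\<epsilon> ` r.qi_polys (Suc j))"
      by (rule join_step_resolves[OF H form \<epsilon> _ M' N' _ \<phi>c q c'(1) po w p pw pb])
        (use Suc in blast)+
    interpret J: cdg ?J by (rule cdgI[OF J])
    have e: "from_space e (Suc j) H a = from_space e j H (q H (rM H a))" if "a \<in> carrier ?J" for a
      using str H that by simp
    have "(\<lambda>a. from_space e j H (q H (rM H a))) \<in> dg_hom ?J ?R"
      using res unfolding resolves_def by blast
    from dg_hom_cong[OF J this e] have "from_space e (Suc j) H \<in> dg_hom ?J ?R" by blast
    moreover have "from_space e (Suc j) H ` hpart ?J 0
        = (\<lambda>a. from_space e j H (q H (rM H a))) ` hpart ?J 0"
      by (rule image_cong[OF HOL.refl]) (rule e[OF J.hpart_carrier])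
    moreover have "a \<in> boundaries ?J 0"
      if "a \<in> hpart ?J 0" "from_space e (Suc j) H a = \<zero>\<^bsub>?R\<^esub>" for a
      using res that e[OF J.hpart_carrier[OF that(1)]] unfolding resolves_def by metis
    ultimately have "resolves ?J ?R (from_space e (Suc j) H) (\<epsilon> ` r.qi_polys (Suc j))"
      using res unfolding resolves_def by metis
    moreover have "from_space e (Suc j) H (c (Suc j) H x) = x" if x: "x \<in> carrier ?S" for x
    proof -
      have "c (Suc j) H x \<in> carrier ?J"
        using cJ H x dg_homD(1)[of "c (Suc j) H" ?S ?J x] unfolding equiv_map_def Sobj[symmetric]
          by blast
      then have "from_space e (Suc j) H (c (Suc j) H x) = from_space e j H (q H (rM H (c (Suc j) H x)))"
        by (rule e)
      also have "rM H (c (Suc j) H x) = c' H x" using str H x unfolding Sobj[symmetric] by blast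
      finally show ?thesis using \<phi>c[OF x] by simp
    qed
    ultimately show ?case using J by blast
  qed
qed

section \<open>The homotopy colimit\<close>

text \<open>A reflection subgroup has only two elements, so nothing but the trivial subgroup lies
  strictly below it. The poset is a star, and each matching object at a leaf is the value at the
  centre.\<close>

lemma refl_subgroup_poset:
  assumes H: "H \<in> \<A>"
  shows "{q \<in> subgroup_poset scale G \<rho>. q < refl_subgroup scale G \<rho> H} = {{\<one>\<^bsub>G\<^esub>}}"
proof -
  have "refl_subgroup scale G \<rho> H' = refl_subgroup scale G \<rho> H"
    if "H' \<in> \<A>" "refl_subgroup scale G \<rho> H' \<subseteq> refl_subgroup scale G \<rho> H" for H'
    using that refl_not_one[OF that(1)] by (auto simp: refl_subgroup_def)
  moreover have "{\<one>\<^bsub>G\<^esub>} \<subset> refl_subgroup scale G \<rho> H"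
    using refl_not_one[OF H] by (auto simp: refl_subgroup_def)
  ultimately show ?thesis by (auto simp: subgroup_poset_def)
qed

lemma refl_subgroup_le_iff:
  assumes "p \<in> subgroup_poset scale G \<rho>" "q \<in> subgroup_poset scale G \<rho>"
  shows "q \<le> p \<longleftrightarrow> q = p \<or> q = {\<one>\<^bsub>G\<^esub>}"
proof (cases "p = {\<one>\<^bsub>G\<^esub>}")
  case True
  then show ?thesis using assms(2) by (auto simp: subgroup_poset_def refl_subgroup_def)
next
  case False
  then obtain H where H: "H \<in> \<A>" "p = refl_subgroup scale G \<rho> H" using assms(1)
    by (auto simp: subgroup_poset_def)
  have "q < p \<longleftrightarrow> q = {\<one>\<^bsub>G\<^esub>}" using refl_subgroup_poset[OF H(1)] assms(2) H(2) by blast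
  then show ?thesis by (auto simp: order_le_less)
qed

end

text \<open>\<open>t\<close> identifies \<open>R\<close> with the degree 0 cohomology of
  \<open>D\<close>, and \<open>R\<close> has no boundaries in degree 0, so the class of the degree 0
  part of \<open>\<pi> x\<close> corresponds to exactly one element of \<open>R\<close>. Defining
  \<open>f\<close> by this relation makes linearity, multiplicativity and later equivariance
  consequences of uniqueness.\<close>

lemma degree_0_map:
  assumes L: "cdga L" and D: "cdga D" and R: "cdga R"
    and \<pi>: "\<pi> \<in> dg_hom L D" and t: "quasi_iso R D t" and R0: "\<And>n. n \<noteq> 0 \<Longrightarrow> hpart R n = {\<zero>\<^bsub>R\<^esub>}"
  obtains f where "f \<in> dg_hom L R"
    "\<And>x y. x \<in> carrier L \<Longrightarrow> y \<in> hpart R 0 \<Longrightarrow>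
       f x = y \<longleftrightarrow> \<pi> (cdg.comp L 0 x) \<ominus>\<^bsub>D\<^esub> t y \<in> boundaries D 0"
proof -
  interpret L: cdg L by (rule cdgI[OF L])
  interpret D: cdg D by (rule cdgI[OF D])
  interpret R: cdg R by (rule cdgI[OF R])
  have t_hom: "t \<in> dg_hom R D" using t by (simp add: quasi_iso_def)
  note t_iff = t[unfolded quasi_iso_iff[OF R D t_hom]]
  define rel where "rel x y \<longleftrightarrow> y \<in> hpart R 0 \<and> \<pi> (L.comp 0 x) \<ominus>\<^bsub>D\<^esub> t y \<in> boundaries D 0" for x y
  have \<pi>0: "\<pi> (L.comp 0 x) \<in> hpart D 0" if "x \<in> carrier L" for x
    using dg_homD(6)[OF \<pi> L.comp_props(1)[OF that]] .
  have \<pi>c: "\<pi> (L.comp 0 x) \<in> carrier D" if "x \<in> carrier L" for x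
    using D.hpart_carrier[OF \<pi>0[OF that]] .
  have tc: "t y \<in> carrier D" if "y \<in> hpart R 0" for y
    using dg_homD(1)[OF t_hom R.hpart_carrier[OF that]] .
  have R_b: "y = \<zero>\<^bsub>R\<^esub>" if "y \<in> boundaries R 0" for y
    using that R0[of "-1"] by (auto simp: boundaries_def)
  have ex: "\<exists>y. rel x y" if "x \<in> carrier L" for x
    using t_iff D.hpart_0_cocycles[OF \<pi>0[OF that]] unfolding rel_def cocycles_def by blast
  have uniq: "y = y'" if "rel x y" "rel x y'" "x \<in> carrier L" for x y y'
  proof -
    have yy: "y \<in> hpart R 0" "y' \<in> hpart R 0" using that by (auto simp: rel_def)
    note c = R.hpart_carrier[OF yy(1)] R.hpart_carrier[OF yy(2)]
    have "(\<pi> (L.comp 0 x) \<ominus>\<^bsub>D\<^esub> t y') \<ominus>\<^bsub>D\<^esub> (\<pi> (L.comp 0 x) \<ominus>\<^bsub>D\<^esub> t y) = t y \<ominus>\<^bsub>D\<^esub> t y'"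
      using \<pi>c[OF that(3)] tc[OF yy(1)] tc[OF yy(2)]
      by (simp add: a_minus_def D.minus_add D.a_ac D.r_neg D.r_neg1)
    also have "\<dots> = t (y \<ominus>\<^bsub>R\<^esub> y')" using dg_hom_minus[OF R D t_hom c] by simp
    finally have "t (y \<ominus>\<^bsub>R\<^esub> y') = (\<pi> (L.comp 0 x) \<ominus>\<^bsub>D\<^esub> t y') \<ominus>\<^bsub>D\<^esub> (\<pi> (L.comp 0 x) \<ominus>\<^bsub>D\<^esub> t y)" ..
    also have "\<dots> \<in> boundaries D 0"
      using that unfolding rel_def by (blast intro: D.boundaries_minus)
    finally have "y \<ominus>\<^bsub>R\<^esub> y' \<in> boundaries R 0"
      using t_iff R.hpart_0_cocycles[OF R.hpart_minus[OF yy]] by blast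
    from R_b[OF this] show ?thesis using c by simp
  qed
  define f where "f x = (THE y. rel x y)" for x
  have f_iff: "f x = y \<longleftrightarrow> rel x y" if "x \<in> carrier L" for x y
    using ex[OF that] uniq[OF _ _ that] the_equality[of "rel x"] unfolding f_def by metis
  have f_rel: "rel x (f x)" if "x \<in> carrier L" for x using f_iff[OF that] by blast
  have f_hp: "f x \<in> hpart R 0" if "x \<in> carrier L" for x using f_rel[OF that] by (simp add: rel_def)
  have fc: "f x \<in> carrier R" if "x \<in> carrier L" for x using R.hpart_carrier[OF f_hp[OF that]] .
  have dz: "dif R y = \<zero>\<^bsub>R\<^esub>" if "y \<in> hpart R 0" for y using R.dif_hpart_0[OF that] .
  have f_zero: "f x = \<zero>\<^bsub>R\<^esub>" if "x \<in> carrier L" "L.comp 0 x = \<zero>\<^bsub>L\<^esub>" for x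
    using that dg_hom_zero[OF L D \<pi>] dg_hom_zero[OF R D t_hom] D.zero_boundaries
    by (simp add: f_iff rel_def a_minus_def)
  have "f \<in> dg_hom L R"
  proof (rule dg_homI)
    fix x assume x: "x \<in> carrier L"
    show "f x \<in> carrier R" using fc[OF x] .
    \<comment> \<open>The degree 0 part of \<open>d x\<close> is the differential of the part of
      degree -1, so its class is zero, matching the zero differential of \<open>R\<close> in degree
      0.\<close>
    have x1: "L.comp (- 1) x \<in> hpart L (- 1)" by (rule L.comp_props(1)[OF x])
    have "L.comp 0 (dif L x) = dif L (L.comp (- 1) x)" using L.comp_dif[OF x, of 0] by simp
    then have "\<pi> (L.comp 0 (dif L x)) \<in> boundaries D 0"
      using dg_hom_boundaries[OF L \<pi>, of _ 0] x1 by (auto simp: boundaries_def)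
    then have "f (dif L x) = \<zero>\<^bsub>R\<^esub>"
      using x dg_hom_zero[OF R D t_hom] \<pi>c[of "dif L x"] by (simp add: f_iff rel_def a_minus_def)
    then show "f (dif L x) = dif R (f x)" using dz[OF f_hp[OF x]] by simp
    note rx = f_rel[OF x, unfolded rel_def] and px = \<pi>c[OF x] and tx = tc[OF f_hp[OF x]]
    obtain a where a: "a \<in> hpart D (- 1)" "\<pi> (L.comp 0 x) \<ominus>\<^bsub>D\<^esub> t (f x) = dif D a"
      using rx by (auto simp: boundaries_def)
    have ac: "a \<in> carrier D" using D.hpart_carrier[OF a(1)] .
    show "f (c \<odot>\<^bsub>L\<^esub> x) = c \<odot>\<^bsub>R\<^esub> f x" for c
    proof -
      have "\<pi> (L.comp 0 (c \<odot>\<^bsub>L\<^esub> x)) \<ominus>\<^bsub>D\<^esub> t (c \<odot>\<^bsub>R\<^esub> f x) = c \<odot>\<^bsub>D\<^esub> (\<pi> (L.comp 0 x) \<ominus>\<^bsub>D\<^esub> t (f x))"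
        using x fc[OF x] px tx by (simp add: L.comp_smult dg_homD(5)[OF \<pi>] dg_homD(5)[OF t_hom]
            a_minus_def D.smult_add D.smult_neg)
      also have "\<dots> = dif D (c \<odot>\<^bsub>D\<^esub> a)" using a(2) ac by (simp add: D.dif_smult)
      also have "\<dots> \<in> boundaries D 0" using D.hpart_smult[OF a(1)] by (auto simp: boundaries_def)
      finally show ?thesis using x f_hp[OF x] R.hpart_smult by (simp add: f_iff rel_def)
    qed
    fix y assume y: "y \<in> carrier L"
    note ry = f_rel[OF y, unfolded rel_def] and py = \<pi>c[OF y] and ty = tc[OF f_hp[OF y]]
    obtain b where b: "b \<in> hpart D (- 1)" "\<pi> (L.comp 0 y) \<ominus>\<^bsub>D\<^esub> t (f y) = dif D b"
      using ry by (auto simp: boundaries_def)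
    have bc: "b \<in> carrier D" using D.hpart_carrier[OF b(1)] .
    show "f (x \<oplus>\<^bsub>L\<^esub> y) = f x \<oplus>\<^bsub>R\<^esub> f y"
    proof -
      have "\<pi> (L.comp 0 (x \<oplus>\<^bsub>L\<^esub> y)) \<ominus>\<^bsub>D\<^esub> t (f x \<oplus>\<^bsub>R\<^esub> f y)
          = (\<pi> (L.comp 0 x) \<ominus>\<^bsub>D\<^esub> t (f x)) \<oplus>\<^bsub>D\<^esub> (\<pi> (L.comp 0 y) \<ominus>\<^bsub>D\<^esub> t (f y))"
        using x y fc[OF x] fc[OF y] px tx py ty
        by (simp add: L.comp_add dg_homD(3)[OF \<pi>] dg_homD(3)[OF t_hom] a_minus_def D.minus_add D.a_ac)
      then show ?thesis using x y f_hp R.hpart_add D.boundaries_add rx ry by (simp add: f_iff rel_def)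
    qed
    show "f (x \<otimes>\<^bsub>L\<^esub> y) = f x \<otimes>\<^bsub>R\<^esub> f y"
    proof -
      let ?p = "\<pi> (L.comp 0 x)" and ?q = "\<pi> (L.comp 0 y)"
      \<comment> \<open>The factors are changed one at a time. Each summand is a boundary times an
        element of degree 0, hence again a boundary.\<close>
      have "?p \<otimes>\<^bsub>D\<^esub> ?q \<ominus>\<^bsub>D\<^esub> t (f x) \<otimes>\<^bsub>D\<^esub> t (f y)
          = (?p \<ominus>\<^bsub>D\<^esub> t (f x)) \<otimes>\<^bsub>D\<^esub> ?q \<oplus>\<^bsub>D\<^esub> t (f x) \<otimes>\<^bsub>D\<^esub> (?q \<ominus>\<^bsub>D\<^esub> t (f y))"
        using px py tx ty
        by (simp add: a_minus_def D.l_distr D.r_distr D.l_minus D.r_minus D.a_assoc D.r_neg1)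
      also have "(?p \<ominus>\<^bsub>D\<^esub> t (f x)) \<otimes>\<^bsub>D\<^esub> ?q = dif D (?q \<otimes>\<^bsub>D\<^esub> a)"
        using D.dif_hpart_0_mult[OF \<pi>0[OF y] ac] a(2) D.hpart_0_comm[OF \<pi>0[OF y], of "dif D a"] ac
          by simp
      also have "t (f x) \<otimes>\<^bsub>D\<^esub> (?q \<ominus>\<^bsub>D\<^esub> t (f y)) = dif D (t (f x) \<otimes>\<^bsub>D\<^esub> b)"
        using D.dif_hpart_0_mult[OF dg_homD(6)[OF t_hom f_hp[OF x]] bc] b(2) by simp
      finally have eq: "?p \<otimes>\<^bsub>D\<^esub> ?q \<ominus>\<^bsub>D\<^esub> t (f x) \<otimes>\<^bsub>D\<^esub> t (f y)
        = dif D (?q \<otimes>\<^bsub>D\<^esub> a) \<oplus>\<^bsub>D\<^esub> dif D (t (f x) \<otimes>\<^bsub>D\<^esub> b)" .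
      have "?q \<otimes>\<^bsub>D\<^esub> a \<in> hpart D (- 1)" using D.hpart_mult[OF \<pi>0[OF y] a(1)] by simp
      moreover have "t (f x) \<otimes>\<^bsub>D\<^esub> b \<in> hpart D (- 1)"
        using D.hpart_mult[OF dg_homD(6)[OF t_hom f_hp[OF x]] b(1)] by simp
      ultimately have "?p \<otimes>\<^bsub>D\<^esub> ?q \<ominus>\<^bsub>D\<^esub> t (f x) \<otimes>\<^bsub>D\<^esub> t (f y) \<in> boundaries D 0"
        unfolding eq by (intro D.boundaries_add) (auto simp: boundaries_def)
      then show ?thesis
        using x y f_hp[OF x] f_hp[OF y] fc[OF x] fc[OF y] R.hpart_mult[OF f_hp[OF x] f_hp[OF y]]
        by (simp add: f_iff rel_def L.comp_0_mult dg_homD(2)[OF \<pi>] dg_homD(2)[OF t_hom])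
    qed
  next
    show "f \<one>\<^bsub>L\<^esub> = \<one>\<^bsub>R\<^esub>"
      using R.hpart_one dg_homD(4)[OF \<pi>] dg_homD(4)[OF t_hom] D.zero_boundaries
      by (simp add: f_iff rel_def L.comp_hpart[OF L.hpart_one] a_minus_def D.r_neg)
    fix n x assume x: "x \<in> hpart L n"
    have xc: "x \<in> carrier L" by (rule L.hpart_carrier[OF x])
    show "f x \<in> hpart R n"
    proof (cases "n = 0")
      case False
      then show ?thesis using f_zero[OF xc] L.comp_hpart[OF x, of 0] by simp
    qed (use f_hp[OF xc] in simp)
  qed
  then show thesis
    using that[of f] f_iff by (simp add: rel_def)
qed

section \<open>Limits over a star-shaped poset\<close>

lemma (in abelian_group) minus_minus_cancel:
  assumes "x \<in> carrier G" "a \<in> carrier G" "b \<in> carrier G"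
  shows "(x \<ominus> a) \<ominus> (x \<ominus> b) = b \<ominus> a"
proof -
  have "(x \<ominus> a) \<ominus> (x \<ominus> b) = (x \<oplus> \<ominus> x) \<oplus> (b \<ominus> a)"
    using assms by (simp add: a_minus_def minus_add a_ac)
  then show ?thesis using assms by (simp add: r_neg)
qed

text \<open>\<open>D0\<close> and the \<open>D i\<close> are the centre and leaves of a fibrant
  replacement of the star formed by \<open>R\<close> and the \<open>A i\<close>. \<open>surj\<close>
  is Reedy fibrancy at the leaves; \<open>limit_ex\<close> and \<open>limit_eq\<close> express
  \<open>L\<close> as the fibre product of all leaves over the centre.\<close>

locale star_limit =
  fixes I :: "'i set" and L D0 R :: "('k::field_char_0, 'u) dg_alg" and D A :: "'i \<Rightarrow> ('k, 'u) dg_alg"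
    and r t \<pi> \<phi> :: "'i \<Rightarrow> 'u \<Rightarrow> 'u" and t0 \<pi>0 :: "'u \<Rightarrow> 'u" and Q :: "'i \<Rightarrow> 'u set"
  assumes L: "cdga L" and D0: "cdga D0" and R: "cdga R"
    and D: "\<And>i. i \<in> I \<Longrightarrow> cdga (D i)" and A: "\<And>i. i \<in> I \<Longrightarrow> cdga (A i)"
    and r: "\<And>i. i \<in> I \<Longrightarrow> r i \<in> dg_hom (D i) D0"
    and \<pi>: "\<And>i. i \<in> I \<Longrightarrow> \<pi> i \<in> dg_hom L (D i)" and \<pi>0: "\<pi>0 \<in> dg_hom L D0"
    and t: "\<And>i. i \<in> I \<Longrightarrow> quasi_iso (A i) (D i) (t i)" and t0: "quasi_iso R D0 t0"
    and res: "\<And>i. i \<in> I \<Longrightarrow> resolves (A i) R (\<phi> i) (Q i)"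
    and rt: "\<And>i a. i \<in> I \<Longrightarrow> a \<in> carrier (A i) \<Longrightarrow> r i (t i a) = t0 (\<phi> i a)"
    and R0: "\<And>n. n \<noteq> 0 \<Longrightarrow> hpart R n = {\<zero>\<^bsub>R\<^esub>}"
    and surj: "\<And>i n y. i \<in> I \<Longrightarrow> n < 0 \<Longrightarrow> y \<in> hpart D0 n \<Longrightarrow> \<exists>z\<in>hpart (D i) n. r i z = y"
    and r\<pi>: "\<And>i x n. i \<in> I \<Longrightarrow> x \<in> hpart L n \<Longrightarrow> r i (\<pi> i x) = \<pi>0 x"
    and limit_ex: "\<And>n y y0. y0 \<in> hpart D0 n \<Longrightarrow> (\<And>i. i \<in> I \<Longrightarrow> y i \<in> hpart (D i) n \<and> r i (y i) = y0) \<Longrightarrow>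
      \<exists>x\<in>hpart L n. \<pi>0 x = y0 \<and> (\<forall>i\<in>I. \<pi> i x = y i)"
    and limit_eq: "\<And>n x x'. x \<in> hpart L n \<Longrightarrow> x' \<in> hpart L n \<Longrightarrow> \<pi>0 x = \<pi>0 x' \<Longrightarrow>
      (\<And>i. i \<in> I \<Longrightarrow> \<pi> i x = \<pi> i x') \<Longrightarrow> x = x'"
begin

sublocale L: cdg L by (rule cdgI[OF L])
sublocale D0: cdg D0 by (rule cdgI[OF D0])
sublocale R: cdg R by (rule cdgI[OF R])

lemma t0_hom: "t0 \<in> dg_hom R D0" and t_hom: "i \<in> I \<Longrightarrow> t i \<in> dg_hom (A i) (D i)"
  and \<phi>_hom: "i \<in> I \<Longrightarrow> \<phi> i \<in> dg_hom (A i) R"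
  using t0 t res by (auto simp: quasi_iso_def resolves_def)

lemma R_boundaries: "y \<in> boundaries R n \<Longrightarrow> y = \<zero>\<^bsub>R\<^esub>"
proof -
  assume "y \<in> boundaries R n"
  then obtain z where z: "z \<in> hpart R (n - 1)" "y = dif R z" by (auto simp: boundaries_def)
  then show ?thesis
    using R0[of "n - 1"] R.dif_hpart_0[of z] by (cases "n - 1 = 0") auto
qed

lemma D0_acyclic:
  assumes "n < 0" "y \<in> cocycles D0 n"
  shows "y \<in> boundaries D0 n"
proof -
  obtain v where v: "v \<in> cocycles R n" "y \<ominus>\<^bsub>D0\<^esub> t0 v \<in> boundaries D0 n"
    using t0[unfolded quasi_iso_iff[OF R D0 t0_hom]] assms by blast
  have "v = \<zero>\<^bsub>R\<^esub>" using v(1) R0[of n] assms(1) by (auto simp: cocycles_def)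
  then show ?thesis
    using v(2) dg_hom_zero[OF R D0 t0_hom] D0.cocycles_carrier[OF assms(2)] by (simp add: a_minus_def)
qed

lemma D_acyclic:
  assumes i: "i \<in> I" and y: "n < 0" "y \<in> cocycles (D i) n"
  shows "y \<in> boundaries (D i) n"
proof -
  interpret Di: cdg "D i" by (rule cdgI[OF D[OF i]])
  obtain v where v: "v \<in> cocycles (A i) n" "y \<ominus>\<^bsub>D i\<^esub> t i v \<in> boundaries (D i) n"
    using t[OF i, unfolded quasi_iso_iff[OF A[OF i] D[OF i] t_hom[OF i]]] y by blast
  have "v \<in> boundaries (A i) n" using res[OF i] y(1) v(1) by (simp add: resolves_def)
  then have "t i v \<in> boundaries (D i) n" by (rule dg_hom_boundaries[OF A[OF i] t_hom[OF i]])
  moreover have c: "y \<in> carrier (D i)" "t i v \<in> carrier (D i)"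
    using Di.cocycles_carrier[OF y(2)] Di.boundaries_carrier[OF \<open>t i v \<in> boundaries (D i) n\<close>] by auto
  ultimately have "t i v \<oplus>\<^bsub>D i\<^esub> (y \<ominus>\<^bsub>D i\<^esub> t i v) \<in> boundaries (D i) n"
    using v(2) by (intro Di.boundaries_add)
  then show ?thesis using Di.add_minus_cancel[OF c(2,1)] by simp
qed

text \<open>The argument for the join, now for all leaves at once: one primitive \<open>y0\<close>
  is fixed at the centre, and the primitive on each leaf is corrected, independently of the others,
  until it restricts to \<open>y0\<close>.\<close>

lemma limit_boundary:
  assumes n: "n \<le> 0" and x: "x \<in> hpart L n" "\<pi>0 x \<in> boundaries D0 n"
    "\<And>i. i \<in> I \<Longrightarrow> \<pi> i x \<in> boundaries (D i) n"
  shows "x \<in> boundaries L n"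
proof -
  obtain y0 where y0: "y0 \<in> hpart D0 (n - 1)" "\<pi>0 x = dif D0 y0" using x(2)
    by (auto simp: boundaries_def)
  have y0c: "y0 \<in> carrier D0" using D0.hpart_carrier[OF y0(1)] .
  have "\<exists>y\<in>hpart (D i) (n - 1). \<pi> i x = dif (D i) y \<and> r i y = y0" if i: "i \<in> I" for i
  proof -
    interpret Di: cdg "D i" by (rule cdgI[OF D[OF i]])
    obtain y where y: "y \<in> hpart (D i) (n - 1)" "\<pi> i x = dif (D i) y"
      using x(3)[OF i] by (auto simp: boundaries_def)
    have yc: "y \<in> carrier (D i)" using Di.hpart_carrier[OF y(1)] .
    have ry: "r i y \<in> hpart D0 (n - 1)" "r i y \<in> carrier D0"
      using dg_homD(6)[OF r[OF i] y(1)] dg_homD(1)[OF r[OF i] yc] .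
    have "dif D0 y0 = dif D0 (r i y)"
      using dg_homD(7)[OF r[OF i] yc] r\<pi>[OF i x(1)] y(2) y0(2) by simp
    then have "y0 \<ominus>\<^bsub>D0\<^esub> r i y \<in> cocycles D0 (n - 1)"
      using D0.hpart_minus[OF y0(1) ry(1)] y0c ry(2) by (simp add: cocycles_def D0.dif_minus)
    then have "y0 \<ominus>\<^bsub>D0\<^esub> r i y \<in> boundaries D0 (n - 1)" using n by (intro D0_acyclic) auto
    then obtain z0 where z0: "z0 \<in> hpart D0 (n - 1 - 1)" "y0 \<ominus>\<^bsub>D0\<^esub> r i y = dif D0 z0"
      by (auto simp: boundaries_def)
    obtain z where z: "z \<in> hpart (D i) (n - 1 - 1)" "r i z = z0" using surj[OF i _ z0(1)] n by auto
    have zc: "z \<in> carrier (D i)" using Di.hpart_carrier[OF z(1)] .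
    have dz: "dif (D i) z \<in> hpart (D i) (n - 1)" using Di.dif_hpart[OF z(1)] by simp
    have "r i (y \<oplus>\<^bsub>D i\<^esub> dif (D i) z) = r i y \<oplus>\<^bsub>D0\<^esub> (y0 \<ominus>\<^bsub>D0\<^esub> r i y)"
      using dg_homD(3)[OF r[OF i] yc, of "dif (D i) z"] dg_homD(7)[OF r[OF i] zc] z(2) z0(2) zc by simp
    also have "\<dots> = y0" by (rule D0.add_minus_cancel[OF ry(2) y0c])
    finally have "r i (y \<oplus>\<^bsub>D i\<^esub> dif (D i) z) = y0" .
    moreover have "\<pi> i x = dif (D i) (y \<oplus>\<^bsub>D i\<^esub> dif (D i) z)"
      using y(2) yc zc by (simp add: Di.dif_add Di.dif_dif)
    ultimately show ?thesis using Di.hpart_add[OF y(1) dz] by blast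
  qed
  then obtain y where y: "\<And>i. i \<in> I \<Longrightarrow> y i \<in> hpart (D i) (n - 1) \<and> \<pi> i x = dif (D i) (y i)
    \<and> r i (y i) = y0"
    by metis
  then obtain b where b: "b \<in> hpart L (n - 1)" "\<pi>0 b = y0" "\<And>i. i \<in> I \<Longrightarrow> \<pi> i b = y i"
    using limit_ex[OF y0(1), of y] by blast
  have bc: "b \<in> carrier L" using L.hpart_carrier[OF b(1)] .
  have "x = dif L b"
  proof (rule limit_eq[OF x(1)])
    show "dif L b \<in> hpart L n" using L.dif_hpart[OF b(1)] by simp
    show "\<pi>0 x = \<pi>0 (dif L b)" using dg_homD(7)[OF \<pi>0 bc] b(2) y0(2) by simp
    show "\<pi> i x = \<pi> i (dif L b)" if "i \<in> I" for i
      using dg_homD(7)[OF \<pi>[OF that] bc] b(3)[OF that] y[OF that] by simp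
  qed
  then show ?thesis using b(1) by (auto simp: boundaries_def)
qed

lemma limit_acyclic:
  assumes "n < 0" "x \<in> cocycles L n"
  shows "x \<in> boundaries L n"
proof (rule limit_boundary)
  show "x \<in> hpart L n" using assms by (simp add: cocycles_def)
  show "\<pi>0 x \<in> boundaries D0 n"
    by (rule D0_acyclic[OF assms(1) dg_hom_cocycles[OF L D0 \<pi>0 assms(2)]])
  show "\<pi> i x \<in> boundaries (D i) n" if "i \<in> I" for i
    by (rule D_acyclic[OF that assms(1) dg_hom_cocycles[OF L D[OF that] \<pi>[OF that] assms(2)]])
qed (use assms in simp)

text \<open>The leaf component of \<open>x\<close> is cohomologous to some \<open>t i a\<close>.
  Restricted to the centre, \<open>\<phi> i a\<close> and \<open>y\<close> represent the same class,
  and elements of \<open>R\<close> are determined by their classes.\<close>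

lemma component_class:
  assumes i: "i \<in> I" and x: "x \<in> hpart L 0" and y: "y \<in> hpart R 0"
    and xy: "\<pi>0 x \<ominus>\<^bsub>D0\<^esub> t0 y \<in> boundaries D0 0"
  obtains a where "a \<in> hpart (A i) 0" "\<phi> i a = y" "\<pi> i x \<ominus>\<^bsub>D i\<^esub> t i a \<in> boundaries (D i) 0"
proof -
  interpret Di: cdg "D i" by (rule cdgI[OF D[OF i]])
  interpret Ai: cdg "A i" by (rule cdgI[OF A[OF i]])
  have px: "\<pi> i x \<in> hpart (D i) 0" using dg_homD(6)[OF \<pi>[OF i] x] .
  obtain a where a: "a \<in> cocycles (A i) 0" "\<pi> i x \<ominus>\<^bsub>D i\<^esub> t i a \<in> boundaries (D i) 0"
    using t[OF i, unfolded quasi_iso_iff[OF A[OF i] D[OF i] t_hom[OF i]]] Di.hpart_0_cocycles[OF px]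
      by blast
  have ac: "a \<in> carrier (A i)" "a \<in> hpart (A i) 0"
    using Ai.cocycles_carrier[OF a(1)] a(1) by (auto simp: cocycles_def)
  note pc = Di.hpart_carrier[OF px]
  have tc: "t i a \<in> carrier (D i)" using dg_homD(1)[OF t_hom[OF i] ac(1)] .
  have \<phi>a: "\<phi> i a \<in> hpart R 0" "\<phi> i a \<in> carrier R"
    using dg_homD(6)[OF \<phi>_hom[OF i] ac(2)] dg_homD(1)[OF \<phi>_hom[OF i] ac(1)] .
  have yc: "y \<in> carrier R" using R.hpart_carrier[OF y] .
  have c0: "\<pi>0 x \<in> carrier D0" "t0 y \<in> carrier D0" "t0 (\<phi> i a) \<in> carrier D0"
    using dg_homD(1)[OF \<pi>0 L.hpart_carrier[OF x]] dg_homD(1)[OF t0_hom] yc \<phi>a(2) by auto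
  have "r i (\<pi> i x \<ominus>\<^bsub>D i\<^esub> t i a) = \<pi>0 x \<ominus>\<^bsub>D0\<^esub> t0 (\<phi> i a)"
    using dg_hom_minus[OF D[OF i] D0 r[OF i] pc tc] r\<pi>[OF i x] rt[OF i ac(1)] by simp
  then have "\<pi>0 x \<ominus>\<^bsub>D0\<^esub> t0 (\<phi> i a) \<in> boundaries D0 0"
    using dg_hom_boundaries[OF D[OF i] r[OF i] a(2)] by simp
  then have "(\<pi>0 x \<ominus>\<^bsub>D0\<^esub> t0 y) \<ominus>\<^bsub>D0\<^esub> (\<pi>0 x \<ominus>\<^bsub>D0\<^esub> t0 (\<phi> i a)) \<in> boundaries D0 0"
    by (rule D0.boundaries_minus[OF xy])
  also have "(\<pi>0 x \<ominus>\<^bsub>D0\<^esub> t0 y) \<ominus>\<^bsub>D0\<^esub> (\<pi>0 x \<ominus>\<^bsub>D0\<^esub> t0 (\<phi> i a)) = t0 (\<phi> i a) \<ominus>\<^bsub>D0\<^esub> t0 y"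
    using c0 by (simp add: D0.minus_minus_cancel)
  also have "\<dots> = t0 (\<phi> i a \<ominus>\<^bsub>R\<^esub> y)" using dg_hom_minus[OF R D0 t0_hom \<phi>a(2) yc] by simp
  finally have "\<phi> i a \<ominus>\<^bsub>R\<^esub> y \<in> boundaries R 0"
    using t0[unfolded quasi_iso_iff[OF R D0 t0_hom]] R.hpart_0_cocycles[OF
      R.hpart_minus[OF \<phi>a(1) y]] by blast
  from R_boundaries[OF this] have "\<phi> i a = y" using \<phi>a(2) yc by simp
  then show thesis using that ac(2) a(2) by blast
qed

text \<open>Take \<open>y = 0\<close> in \<open>component_class\<close>: then \<open>a\<close> lies
  in the kernel of \<open>\<phi> i\<close>, so it is a boundary, and the leaf component of
  \<open>x\<close> is one too.\<close>

lemma limit_inj: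
  assumes x: "x \<in> hpart L 0" "\<pi>0 x \<in> boundaries D0 0"
  shows "x \<in> boundaries L 0"
proof (rule limit_boundary[OF _ x])
  fix i assume i: "i \<in> I"
  interpret Di: cdg "D i" by (rule cdgI[OF D[OF i]])
  interpret Ai: cdg "A i" by (rule cdgI[OF A[OF i]])
  have "\<pi>0 x \<ominus>\<^bsub>D0\<^esub> t0 \<zero>\<^bsub>R\<^esub> \<in> boundaries D0 0"
    using x dg_hom_zero[OF R D0 t0_hom] D0.boundaries_carrier by (simp add: a_minus_def)
  then obtain a where a: "a \<in> hpart (A i) 0" "\<phi> i a = \<zero>\<^bsub>R\<^esub>" "\<pi> i x \<ominus>\<^bsub>D i\<^esub> t i a \<in> boundaries (D i) 0"
    using component_class[OF i x(1) R.hpart_zero] by blast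
  have "a \<in> boundaries (A i) 0" using res[OF i] a(1,2) by (simp add: resolves_def)
  then have ta: "t i a \<in> boundaries (D i) 0" by (rule dg_hom_boundaries[OF A[OF i] t_hom[OF i]])
  have "t i a \<oplus>\<^bsub>D i\<^esub> (\<pi> i x \<ominus>\<^bsub>D i\<^esub> t i a) \<in> boundaries (D i) 0"
    by (rule Di.boundaries_add[OF ta a(3)])
  then show "\<pi> i x \<in> boundaries (D i) 0"
    using Di.add_minus_cancel[OF Di.boundaries_carrier[OF ta] dg_homD(1)[OF \<pi>[OF i]
      L.hpart_carrier[OF x(1)]]]
    by simp
qed simp

lemma limit_image:
  assumes "i \<in> I" "x \<in> hpart L 0" "y \<in> hpart R 0" "\<pi>0 x \<ominus>\<^bsub>D0\<^esub> t0 y \<in> boundaries D0 0"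
  shows "y \<in> Q i"
proof (rule component_class[OF assms])
  fix a assume "a \<in> hpart (A i) 0" "\<phi> i a = y"
  then have "y \<in> \<phi> i ` hpart (A i) 0" by blast
  then show "y \<in> Q i" using res[OF assms(1)] by (simp add: resolves_def)
qed

text \<open>Preimages of \<open>y\<close> are chosen on the leaves separately. By \<open>rt\<close>
  their images restrict to \<open>t0 y\<close> on the nose, not merely up to a boundary, so they
  assemble to a point of the limit.\<close>

lemma limit_surj:
  assumes y: "y \<in> hpart R 0" "\<And>i. i \<in> I \<Longrightarrow> y \<in> Q i"
  obtains x where "x \<in> hpart L 0" "\<pi>0 x = t0 y"
proof -
  have "\<exists>a\<in>hpart (A i) 0. \<phi> i a = y" if "i \<in> I" for i
  proof -
    have "y \<in> \<phi> i ` hpart (A i) 0" using y(2)[OF that] res[OF that] by (simp add: resolves_def)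
    then show ?thesis by blast
  qed
  then obtain a where a: "\<And>i. i \<in> I \<Longrightarrow> a i \<in> hpart (A i) 0 \<and> \<phi> i (a i) = y" by metis
  have "t i (a i) \<in> hpart (D i) 0 \<and> r i (t i (a i)) = t0 y" if i: "i \<in> I" for i
  proof -
    have ai: "a i \<in> hpart (A i) 0" "\<phi> i (a i) = y" using a[OF i] by auto
    show ?thesis
      using dg_homD(6)[OF t_hom[OF i] ai(1)] rt[OF i cdg.hpart_carrier[OF cdgI[OF A[OF i]] ai(1)]] ai(2)
      by simp
  qed
  then show thesis
    using limit_ex[OF dg_homD(6)[OF t0_hom y(1)], of "\<lambda>i. t i (a i)"] that by blast
qed

end

section \<open>The group action on quasi-invariants\<close>

context reflection_rep
begin

text \<open>The conjugate by \<open>g\<close> fixes exactly the translate of \<open>H\<close>, which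
  has the dimension of \<open>H\<close> since \<open>\<rho> g\<close> is injective. It is therefore
  a reflection, and uniqueness identifies it.\<close>

lemma conjugate_reflection:
  assumes g: "g \<in> carrier G" and H: "H \<in> \<A>"
  shows "\<rho> g ` H \<in> \<A>" "refl (\<rho> g ` H) = g \<otimes>\<^bsub>G\<^esub> refl H \<otimes>\<^bsub>G\<^esub> inv\<^bsub>G\<^esub> g"
proof -
  let ?t = "g \<otimes>\<^bsub>G\<^esub> refl H \<otimes>\<^bsub>G\<^esub> inv\<^bsub>G\<^esub> g"
  note s = refl_props[OF H]
  have t: "?t \<in> carrier G" using g s(1) by simp
  have \<rho>t: "\<rho> ?t v = \<rho> g (\<rho> (refl H) (\<rho> (inv\<^bsub>G\<^esub> g) v))" for v
    using g s(1) by (simp add: \<rho>_mult)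
  have fixH: "\<rho> (refl H) v = v \<longleftrightarrow> v \<in> H" for v
    using s(3) by (auto simp: fixed_space_def)
  have fix_t: "\<rho> ?t v = v \<longleftrightarrow> v \<in> \<rho> g ` H" for v
  proof
    assume "\<rho> ?t v = v"
    then have "\<rho> (inv\<^bsub>G\<^esub> g) (\<rho> g (\<rho> (refl H) (\<rho> (inv\<^bsub>G\<^esub> g) v))) = \<rho> (inv\<^bsub>G\<^esub> g) v" by (simp only: \<rho>t)
    then have "\<rho> (inv\<^bsub>G\<^esub> g) v \<in> H" using g fixH by simp
    then show "v \<in> \<rho> g ` H" using g by (intro image_eqI[of _ _ "\<rho> (inv\<^bsub>G\<^esub> g) v"]) simp_all
  next
    assume "v \<in> \<rho> g ` H"
    then obtain x where x: "x \<in> H" "v = \<rho> g x" by blast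
    then have "\<rho> (refl H) x = x" using fixH by blast
    then show "\<rho> ?t v = v" using g x(2) by (simp add: \<rho>t)
  qed
  then have fs: "fixed_space \<rho> {?t} = \<rho> g ` H" by (auto simp: fixed_space_def)
  have "finite_dimensional_vector_space_pair_1 scale Basis scale"
    using fin_dim V.vector_space_axioms by (simp add: finite_dimensional_vector_space_pair_1_def)
  moreover have inj: "inj (\<rho> g)" using \<rho>_inv(1)[OF g] by (metis injI)
  ultimately have dim: "V.dim (\<rho> g ` H) = V.dim H"
    using finite_dimensional_vector_space_pair_1.dim_image_eq[OF _ \<rho>_linear[OF g]] inj_on_subset
      by blast
  have H_eq: "H = {v. \<rho> (refl H) v = v}" using fixH by auto
  have "is_reflection scale (\<rho> ?t)"
    unfolding is_reflection_def
  proof (intro conjI)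
    show "Vector_Spaces.linear scale scale (\<rho> ?t)" by (rule \<rho>_linear[OF t])
    have "\<rho> (refl H) (\<rho> (refl H) v) = v" for v
      using s(2) by (simp add: is_reflection_def o_def id_def fun_eq_iff)
    then show "\<rho> ?t \<circ> \<rho> ?t = id" using g by (auto simp: fun_eq_iff \<rho>t)
    have "{v. \<rho> ?t v = v} = \<rho> g ` H" using fix_t by blast
    moreover have "V.dim H + 1 = V.dim UNIV"
      using s(2) H_eq unfolding is_reflection_def by simp
    ultimately show "V.dim {v. \<rho> ?t v = v} + 1 = V.dim UNIV" using dim by simp
  qed
  then show "\<rho> g ` H \<in> \<A>" using t fs unfolding reflection_hyperplanes_def by blast
  then show "refl (\<rho> g ` H) = ?t" by (rule refl_eqI[OF _ t \<open>is_reflection scale (\<rho> ?t)\<close> fs])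
qed

text \<open>The condition for \<open>p\<close> at the hyperplane \<open>H'\<close>, the translate of
  \<open>H\<close> by the inverse of \<open>g\<close>, becomes the condition for the translate at
  \<open>H\<close>: the pulled-back form is proportional to the form of \<open>H\<close>, and
  invariance of \<open>k\<close> makes the exponents equal.\<close>

lemma translate_quasi_invariants:
  assumes k: "k \<in> multiplicities G \<rho> \<A>" and g: "g \<in> carrier G"
    and p: "p \<in> quasi_invariants scale G \<rho> \<alpha> k"
  shows "translate G \<rho> g p \<in> quasi_invariants scale G \<rho> \<alpha> k"
proof -
  let ?h = "inv\<^bsub>G\<^esub> g"
  have h: "?h \<in> carrier G" using g by simp
  have pol: "(\<lambda>v. q (\<rho> ?h v)) \<in> polynomials scale" if "q \<in> polynomials scale" for q
    by (rule V.polynomials_compose[OF that \<rho>_linear[OF h]])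
  have "\<exists>q\<in>polynomials scale. \<forall>v. p (\<rho> ?h (\<rho> (refl H) v)) - p (\<rho> ?h v) = \<alpha> H v ^ (2 * k H) * q v"
    if H: "H \<in> \<A>" for H
  proof -
    let ?H' = "\<rho> ?h ` H"
    note H' = conjugate_reflection[OF h H]
    have kH: "k ?H' = k H" using k h H by (simp add: multiplicities_def)
    obtain q where q: "q \<in> polynomials scale"
      "\<And>v. p (\<rho> (refl ?H') v) - p v = \<alpha> ?H' v ^ (2 * k ?H') * q v"
      using p H'(1) unfolding quasi_invariants_eq by blast
    have conj: "\<rho> (refl ?H') (\<rho> ?h v) = \<rho> ?h (\<rho> (refl H) v)" for v
      using g h refl_props(1)[OF H] unfolding H'(2) by (simp add: \<rho>_mult)
    obtain u where "reflection_form scale (\<rho> (refl H)) (\<alpha> H) u" using refl_form[OF H] .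
    then interpret r: reflection_form scale "\<rho> (refl H)" "\<alpha> H" u .
    \<comment> \<open>Forms are chosen for each hyperplane separately; \<open>c\<close> is the
      proportionality factor, read off at \<open>u\<close>, where the form of \<open>H\<close> is 1.
      Its power is absorbed in the cofactor.\<close>
    define c where "c = \<alpha> ?H' (\<rho> ?h u)"
    have scaled: "\<alpha> ?H' (\<rho> ?h v) = c * \<alpha> H v" for v
    proof -
      have "r.pr v \<in> H" using r.a_pr \<alpha>_zero[OF H] by blast
      then have "\<alpha> ?H' (\<rho> ?h (r.pr v)) = 0" using \<alpha>_zero[OF H'(1)] by blast
      then have "\<alpha> ?H' (\<rho> ?h v) - \<alpha> H v * \<alpha> ?H' (\<rho> ?h u) = 0"
        by (simp only: r.pr_def \<rho>_linearD[OF h] linear_formD[OF \<alpha>_linear[OF H'(1)]])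
      then show ?thesis by (simp add: c_def mult.commute)
    qed
    have "p (\<rho> ?h (\<rho> (refl H) v)) - p (\<rho> ?h v)
        = \<alpha> H v ^ (2 * k H) * (c ^ (2 * k H) * q (\<rho> ?h v))" for v
      using q(2)[of "\<rho> ?h v"] by (simp add: conj scaled kH power_mult_distrib mult.left_commute)
    then show ?thesis by (intro bexI[OF _ V.polynomials_scale[OF pol[OF q(1)], of "c ^ (2 * k H)"]]
      allI)
  qed
  moreover have "p \<in> polynomials scale" using p unfolding quasi_invariants_eq by blast
  ultimately show ?thesis
    using pol unfolding quasi_invariants_eq by (auto simp: translate_def o_def)
qed

lemma subalgebra_quasi_invariants: "function_subalgebra UNIV (quasi_invariants scale G \<rho> \<alpha> k)"
proof -
  let ?Q = "quasi_invariants scale G \<rho> \<alpha> k"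
  let ?P = "\<lambda>H p. \<exists>q\<in>polynomials scale. \<forall>v. p (\<rho> (refl H) v) - p v = \<alpha> H v ^ (2 * k H) * q v"
  have Q: "p \<in> ?Q \<longleftrightarrow> p \<in> polynomials scale \<and> (\<forall>H\<in>\<A>. ?P H p)" for p
    by (auto simp: quasi_invariants_eq)
  have const: "(\<lambda>_. c) \<in> ?Q" for c
    using polynomials.const[of c scale] polynomials.const[of 0 scale]
      by (auto simp: Q intro!: bexI[of _ "\<lambda>_. 0"])
  have add: "(\<lambda>v. p v + f v) \<in> ?Q" if "p \<in> ?Q" "f \<in> ?Q" for p f
  proof -
    have "?P H (\<lambda>v. p v + f v)" if H: "H \<in> \<A>" for H
    proof -
      obtain q q' where *: "q \<in> polynomials scale" "q' \<in> polynomials scale"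
        "\<And>v. p (\<rho> (refl H) v) - p v = \<alpha> H v ^ (2 * k H) * q v"
        "\<And>v. f (\<rho> (refl H) v) - f v = \<alpha> H v ^ (2 * k H) * q' v"
        using \<open>p \<in> ?Q\<close> \<open>f \<in> ?Q\<close> H unfolding Q by metis
      have "p (\<rho> (refl H) v) + f (\<rho> (refl H) v) - (p v + f v) = \<alpha> H v ^ (2 * k H) * (q v + q' v)" for v
        unfolding distrib_left *(3,4)[symmetric] by simp
      then show ?thesis by (intro bexI[OF _ polynomials.add[OF *(1,2)]] allI)
    qed
    then show ?thesis using that polynomials.add unfolding Q by blast
  qed
  have mult: "(\<lambda>v. p v * f v) \<in> ?Q" if "p \<in> ?Q" "f \<in> ?Q" for p f
  proof -
    have pol: "p \<in> polynomials scale" "f \<in> polynomials scale" using that unfolding Q by auto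
    have "?P H (\<lambda>v. p v * f v)" if H: "H \<in> \<A>" for H
    proof -
      obtain q q' where *: "q \<in> polynomials scale" "q' \<in> polynomials scale"
        "\<And>v. p (\<rho> (refl H) v) - p v = \<alpha> H v ^ (2 * k H) * q v"
        "\<And>v. f (\<rho> (refl H) v) - f v = \<alpha> H v ^ (2 * k H) * q' v"
        using \<open>p \<in> ?Q\<close> \<open>f \<in> ?Q\<close> H unfolding Q by metis
      let ?s = "\<rho> (refl H)"
      have s_pol: "(\<lambda>v. f (?s v)) \<in> polynomials scale"
        by (rule V.polynomials_compose[OF pol(2) \<rho>_linear[OF refl_props(1)[OF H]]])
      have "p (?s v) * f (?s v) - p v * f v = \<alpha> H v ^ (2 * k H) * (q v * f (?s v) + p v * q' v)" for v
      proof -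
        \<comment> \<open>The twisted Leibniz rule for the operator that sends \<open>p\<close> to
          its reflection minus \<open>p\<close>.\<close>
        have "p (?s v) * f (?s v) - p v * f v = (p (?s v) - p v) * f (?s v) + p v * (f (?s v) - f v)"
          by (simp add: left_diff_distrib right_diff_distrib)
        then show ?thesis unfolding *(3,4) by (simp add: distrib_left mult.assoc mult.left_commute)
      qed
      then show ?thesis
        by (intro bexI[OF _ polynomials.add[OF polynomials.mult[OF *(1) s_pol] polynomials.mult[OF
          pol(1) *(2)]]] allI)
    qed
    then show ?thesis using polynomials.mult[OF pol] unfolding Q by blast
  qed
  show ?thesis
    using const[of 1] add mult mult[OF const] by (auto simp: function_subalgebra_def restr_def)
qed

lemma equiv_family_RSpec_qi:
  assumes \<epsilon>: "inj \<epsilon>" and k: "k \<in> multiplicities G \<rho> \<A>"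
  shows "equiv_family G (\<lambda>_ _. ()) UNIV (RSpec_qi scale G \<rho> \<epsilon> \<alpha> k)"
proof -
  let ?Q = "quasi_invariants scale G \<rho> \<alpha> k"
  note [simp] = the_inv_f_f[OF \<epsilon>] and ops = RS_ops[OF \<epsilon>]
  have obj: "obj (RSpec_qi scale G \<rho> \<epsilon> \<alpha> k) i = RS \<epsilon> UNIV ?Q" for i
    by (simp add: RSpec_qi_def function_fam_def)
  have act: "act (RSpec_qi scale G \<rho> \<epsilon> \<alpha> k) g i (\<epsilon> p) = \<epsilon> (translate G \<rho> g p)" for g i p
    by (simp add: RSpec_qi_def function_fam_def lift_def)
  have z: "translate G \<rho> g (\<lambda>_. 0) = (\<lambda>_. 0)" for g by (simp add: translate_def o_def)
  show ?thesis
    unfolding equiv_family_def obj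
  proof (intro conjI ballI)
    show "cdga (RS \<epsilon> UNIV ?Q)" by (rule cdga_RS[OF \<epsilon> subalgebra_quasi_invariants])
    fix g :: 'g and i :: unit assume g: "g \<in> carrier G"
    have tr: "translate G \<rho> g (\<lambda>v. p v + q v) = (\<lambda>v. translate G \<rho> g p v + translate G \<rho> g q v)"
      "translate G \<rho> g (\<lambda>v. p v * q v) = (\<lambda>v. translate G \<rho> g p v * translate G \<rho> g q v)"
      "translate G \<rho> g (\<lambda>v. c * p v) = (\<lambda>v. c * translate G \<rho> g p v)"
      "translate G \<rho> g (restr UNIV (\<lambda>_. c)) = restr UNIV (\<lambda>_. c)" for p q :: "'v \<Rightarrow> 'k" and c
      by (simp_all add: translate_def o_def restr_def)
    show "act (RSpec_qi scale G \<rho> \<epsilon> \<alpha> k) g i \<in> dg_hom (RS \<epsilon> UNIV ?Q) (RS \<epsilon> UNIV ?Q)"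
    proof (rule dg_homI)
      fix x assume "x \<in> carrier (RS \<epsilon> UNIV ?Q)"
      then obtain p where p: "p \<in> ?Q" "x = \<epsilon> p" by (auto simp: RS_simps)
      show "act (RSpec_qi scale G \<rho> \<epsilon> \<alpha> k) g i x \<in> carrier (RS \<epsilon> UNIV ?Q)"
        using translate_quasi_invariants[OF k g p(1)] by (simp add: p(2) act RS_simps)
      show "act (RSpec_qi scale G \<rho> \<epsilon> \<alpha> k) g i (b \<odot>\<^bsub>RS \<epsilon> UNIV ?Q\<^esub> x)
          = b \<odot>\<^bsub>RS \<epsilon> UNIV ?Q\<^esub> act (RSpec_qi scale G \<rho> \<epsilon> \<alpha> k) g i x" for b
        unfolding p(2) ops act tr(3) ..
      fix y assume "y \<in> carrier (RS \<epsilon> UNIV ?Q)"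
      then obtain q where q: "y = \<epsilon> q" by (auto simp: RS_simps)
      show "act (RSpec_qi scale G \<rho> \<epsilon> \<alpha> k) g i (x \<otimes>\<^bsub>RS \<epsilon> UNIV ?Q\<^esub> y)
          = act (RSpec_qi scale G \<rho> \<epsilon> \<alpha> k) g i x \<otimes>\<^bsub>RS \<epsilon> UNIV ?Q\<^esub> act (RSpec_qi scale G \<rho> \<epsilon> \<alpha> k) g i y"
        unfolding p(2) q ops act tr(2) ..
      show "act (RSpec_qi scale G \<rho> \<epsilon> \<alpha> k) g i (x \<oplus>\<^bsub>RS \<epsilon> UNIV ?Q\<^esub> y)
          = act (RSpec_qi scale G \<rho> \<epsilon> \<alpha> k) g i x \<oplus>\<^bsub>RS \<epsilon> UNIV ?Q\<^esub> act (RSpec_qi scale G \<rho> \<epsilon> \<alpha> k) g i y"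
        unfolding p(2) q ops act tr(1) ..
    next
      show "act (RSpec_qi scale G \<rho> \<epsilon> \<alpha> k) g i \<one>\<^bsub>RS \<epsilon> UNIV ?Q\<^esub> = \<one>\<^bsub>RS \<epsilon> UNIV ?Q\<^esub>"
        unfolding RS_simps act tr(4) ..
      fix n x assume "x \<in> hpart (RS \<epsilon> UNIV ?Q) n"
      then show "act (RSpec_qi scale G \<rho> \<epsilon> \<alpha> k) g i x \<in> hpart (RS \<epsilon> UNIV ?Q) n"
        using translate_quasi_invariants[OF k g] by (auto simp: RS_simps act z split: if_splits)
    qed (simp add: RS_simps act z)
  next
    fix x assume "x \<in> carrier (RS \<epsilon> UNIV ?Q)"
    then obtain p where p: "x = \<epsilon> p" by (auto simp: RS_simps)
    show "act (RSpec_qi scale G \<rho> \<epsilon> \<alpha> k) \<one>\<^bsub>G\<^esub> i x = x" for i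
      by (simp add: p act) (simp add: translate_def o_def)
    fix g h assume gh: "g \<in> carrier G" "h \<in> carrier G"
    have "translate G \<rho> (g \<otimes>\<^bsub>G\<^esub> h) p = translate G \<rho> g (translate G \<rho> h p)"
      using gh by (auto simp: translate_def o_def fun_eq_iff G.inv_mult_group \<rho>_mult)
    then show "act (RSpec_qi scale G \<rho> \<epsilon> \<alpha> k) (g \<otimes>\<^bsub>G\<^esub> h) i x =
      act (RSpec_qi scale G \<rho> \<epsilon> \<alpha> k) g () (act (RSpec_qi scale G \<rho> \<epsilon> \<alpha> k) h i x)" for i
      by (simp add: p act)
  qed auto
qed

text \<open>The fibrant diagram is an instance of \<open>star_limit\<close> with centre
  \<open>k[V]\<close> and leaves the joins of multiplicity \<open>k H\<close>. The map comes from
  \<open>degree_0_map\<close> at the centre; the leaves confine its image to the intersection of the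
  one-reflection conditions, and that intersection is the algebra of quasi-invariants.\<close>

lemma derived_qi_space_quasi_iso:
  fixes \<epsilon> :: "('v \<Rightarrow> 'k) \<Rightarrow> 'u"
  assumes \<epsilon>: "inj \<epsilon>" and k: "k \<in> multiplicities G \<rho> \<A>" and dL: "derived_qi_space scale G \<rho> \<epsilon> k L"
  shows "\<exists>f. equiv_quasi_iso G (\<lambda>_ _. ()) UNIV L (RSpec_qi scale G \<rho> \<epsilon> \<alpha> k) f"
proof -
  let ?I = "subgroup_poset scale G \<rho>" and ?W = "refl_subgroup scale G \<rho>" and ?o = "{\<one>\<^bsub>G\<^esub>}"
  let ?Q = "quasi_invariants scale G \<rho> \<alpha> k"
  let ?R = "RS \<epsilon> UNIV (polynomials scale)"
  obtain A c e where tower: "join_tower scale G \<rho> \<epsilon> A c e"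
    and hoc: "homotopy_colimit G (conj_action G) ?I (qi_diagram scale G \<rho> \<epsilon> A k) (qi_diagram_maps \<rho>
      e k) L"
    using dL unfolding derived_qi_space_def by blast
  define D where "D = qi_diagram scale G \<rho> \<epsilon> A k"
  define m where "m = qi_diagram_maps \<rho> e k"
  have Ddiag: "equiv_diagram G (conj_action G) ?I D m" and Lfam: "equiv_family G (\<lambda>_ _. ()) UNIV L"
    using hoc unfolding homotopy_colimit_def D_def m_def by blast+
  obtain D' r' t \<pi> where D'diag: "equiv_diagram G (conj_action G) ?I D' r'"
    and t: "equiv_quasi_iso G (conj_action G) ?I D D' t"
    and tm': "\<forall>p\<in>?I. \<forall>q\<in>?I. q \<le> p \<longrightarrow> (\<forall>x\<in>carrier (obj D p). t q (m p q x) = r' p q (t p x))"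
    and reedy: "reedy_fibrant ?I D' r'"
    and \<pi>': "\<forall>p\<in>?I. \<pi> p \<in> dg_hom (obj L ()) (obj D' p)"
    and \<pi>_eq': "\<forall>g\<in>carrier G. \<forall>p\<in>?I. \<forall>x\<in>carrier (obj L ()).
       \<pi> (conj_action G g p) (act L g () x) = act D' g p (\<pi> p x)"
    and lim': "\<forall>n. bij_betw (\<lambda>x. \<lambda>p\<in>?I. \<pi> p x) (hpart (obj L ()) n) (compatible ?I D' r' n)"
    using hoc unfolding homotopy_colimit_def D_def[symmetric] m_def[symmetric]
    by (elim exE conjE) (rule that; assumption)
  note tm = tm'[rule_format] and \<pi> = bspec[OF \<pi>'] and \<pi>_eq = \<pi>_eq'[rule_format] and lim
    = lim'[rule_format]
  have one_I: "?o \<in> ?I" by (simp add: subgroup_poset_def)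
  have W_I: "?W H \<in> ?I" if "H \<in> \<A>" for H using that by (simp add: subgroup_poset_def)
  have le1: "?o \<le> ?W H" for H by (simp add: refl_subgroup_def)
  have W_ne: "?W H \<noteq> ?o" if "H \<in> \<A>" for H
    using refl_not_one[OF that] by (auto simp: refl_subgroup_def)
  have D1: "obj D ?o = ?R"
    by (simp add: D_def qi_diagram_def Let_def space_fam_def function_fam_def)
  have DW: "obj D (?W H) = obj (A (k H)) H" if "H \<in> \<A>" for H
    unfolding D_def qi_diagram_def Let_def
    by (simp only: W_ne[OF that] fixed_space_refl_subgroup[OF that] if_False fam.simps)
  have mW: "m (?W H) ?o = from_space e (k H) H" if "H \<in> \<A>" for H
    using W_ne[OF that] fixed_space_refl_subgroup[OF that] by (simp add: m_def qi_diagram_maps_def)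
  note D'_parts = D'diag[unfolded equiv_diagram_def]
  have D'_cdga: "cdga (obj D' p)" if "p \<in> ?I" for p
    using D'_parts[THEN conjunct1] that by (simp add: equiv_family_def)
  have r'_hom: "r' p q \<in> dg_hom (obj D' p) (obj D' q)" if "p \<in> ?I" "q \<in> ?I" "q \<le> p" for p q
    using D'_parts[THEN conjunct2, THEN conjunct1] that by simp
  have r'_id: "r' p p x = x" if "p \<in> ?I" "x \<in> carrier (obj D' p)" for p x
    using D'_parts[THEN conjunct2, THEN conjunct2, THEN conjunct1] that by simp
  have L: "cdga (obj L ())" using Lfam unfolding equiv_family_def by blast
  have R: "cdga ?R" by (rule cdga_RS[OF \<epsilon> V.subalgebra_polynomials])
  have tq: "quasi_iso (obj D p) (obj D' p) (t p)" if "p \<in> ?I" for p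
    using t that unfolding equiv_quasi_iso_def by blast
  have t1: "quasi_iso ?R (obj D' ?o) (t ?o)" using tq[OF one_I] by (simp only: D1)
  define QH where "QH H = \<epsilon> ` reflection_form.qi_polys scale (\<rho> (refl H)) (\<alpha> H) (k H)" for H
  interpret st: star_limit \<A> "obj L ()" "obj D' ?o" ?R "\<lambda>H. obj D' (?W H)" "\<lambda>H. obj (A (k H)) H"
    "\<lambda>H. r' (?W H) ?o" "\<lambda>H. t (?W H)" "\<lambda>H. \<pi> (?W H)" "\<lambda>H. from_space e (k H) H" "t ?o" "\<pi> ?o" QH
  proof (rule star_limit.intro[OF L D'_cdga[OF one_I] R], goal_cases)
    case (1 H)
    then show ?case by (rule D'_cdga[OF W_I])
  next
    case (2 H)
    obtain u where "reflection_form scale (\<rho> (refl H)) (\<alpha> H) u" using refl_form[OF 2] .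
    then show ?case using join_tower_resolves[OF \<epsilon> tower 2, of u "k H"] by blast
  next
    case (3 H)
    then show ?case by (rule r'_hom[OF W_I one_I le1])
  next
    case (4 H)
    then show ?case by (rule \<pi>[OF W_I])
  next
    case 5
    show ?case by (rule \<pi>[OF one_I])
  next
    case (6 H)
    then show ?case using tq[OF W_I[OF 6]] DW[OF 6] by simp
  next
    case 7
    show ?case by (rule t1)
  next
    case (8 H)
    obtain u where "reflection_form scale (\<rho> (refl H)) (\<alpha> H) u" using refl_form[OF 8] .
    then show ?case using join_tower_resolves[OF \<epsilon> tower 8, of u "k H"] unfolding QH_def by blast
  next
    case (9 H a)
    then have "a \<in> carrier (obj D (?W H))" by (simp add: DW)
    from tm[OF W_I[OF 9(1)] one_I le1 this] show ?case by (simp add: mW[OF 9(1)])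
  next
    case (10 n)
    then show ?case by (simp add: RS_simps)
  next
    case (11 H n y)
    \<comment> \<open>Compatible families below a leaf consist of a single value at the trivial
      subgroup, so Reedy fibrancy becomes surjectivity of the leaf onto the centre.\<close>
    have P: "{q \<in> ?I. q < ?W H} = {?o}" by (rule refl_subgroup_poset[OF 11(1)])
    have yc: "y \<in> carrier (obj D' ?o)" by (rule cdg.hpart_carrier[OF cdgI[OF D'_cdga[OF one_I]] 11(3)])
    have "(\<lambda>p\<in>{?o}. y) \<in> compatible {q \<in> ?I. q < ?W H} D' r' n"
      unfolding P compatible_def using 11(3) r'_id[OF one_I yc] by simp
    then obtain z where z: "z \<in> hpart (obj D' (?W H)) n"
      "\<forall>q\<in>?I. q < ?W H \<longrightarrow> r' (?W H) q z = (\<lambda>p\<in>{?o}. y) q"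
      using reedy W_I[OF 11(1)] 11(2) unfolding reedy_fibrant_def by blast
    have "?o < ?W H" using P by blast
    then show ?case using z one_I by auto
  next
    case (12 H x n)
    have "(\<lambda>p\<in>?I. \<pi> p x) \<in> compatible ?I D' r' n"
      using bij_betwE[OF lim] 12(2) by blast
    then have "r' (?W H) ?o ((\<lambda>p\<in>?I. \<pi> p x) (?W H)) = (\<lambda>p\<in>?I. \<pi> p x) ?o"
      using W_I[OF 12(1)] one_I le1[of H] unfolding compatible_def by blast
    then show ?case using W_I[OF 12(1)] one_I by simp
  next
    case (13 n y y0)
    \<comment> \<open>The data are indexed by hyperplanes but a compatible family by subgroups; the
      fixed space translates between them.\<close>
    define z where "z = (\<lambda>p\<in>?I. if p = ?o then y0 else y (fixed_space \<rho> p))"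
    have z1: "z ?o = y0" using one_I by (simp add: z_def)
    have zW: "z (?W H) = y H" if "H \<in> \<A>" for H
      using W_I[OF that] W_ne[OF that] fixed_space_refl_subgroup[OF that] by (simp add: z_def)
    have p_cases: "p = ?o \<or> (\<exists>H\<in>\<A>. p = ?W H)" if "p \<in> ?I" for p
      using that by (auto simp: subgroup_poset_def)
    have z_hp: "z p \<in> hpart (obj D' p) n" if "p \<in> ?I" for p
      using p_cases[OF that] z1 zW 13 by auto
    have "z \<in> compatible ?I D' r' n"
      unfolding compatible_def
    proof (intro CollectI conjI ballI impI)
      show "z \<in> (\<Pi>\<^sub>E p\<in>?I. hpart (obj D' p) n)"
        using z_hp by (auto simp: PiE_def extensional_def z_def)
      fix p q assume pq: "p \<in> ?I" "q \<in> ?I" "q \<le> p"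
      have c: "z p \<in> carrier (obj D' p)"
        by (rule cdg.hpart_carrier[OF cdgI[OF D'_cdga[OF pq(1)]] z_hp[OF pq(1)]])
      show "r' p q (z p) = z q"
      proof (cases "q = p")
        case True
        then show ?thesis using r'_id[OF pq(1) c] by simp
      next
        case False
        then have "q = ?o" using refl_subgroup_le_iff[OF pq(1,2)] pq(3) by blast
        moreover obtain H where "H \<in> \<A>" "p = ?W H" using p_cases[OF pq(1)] False \<open>q = ?o\<close> by blast
        ultimately show ?thesis using z1 zW 13(2) by simp
      qed
    qed
    then have "z \<in> (\<lambda>x. \<lambda>p\<in>?I. \<pi> p x) ` hpart (obj L ()) n"
      unfolding bij_betw_imp_surj_on[OF lim] .
    then obtain x where x: "(\<lambda>p\<in>?I. \<pi> p x) = z" "x \<in> hpart (obj L ()) n"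
      by (elim imageE) (rule that[OF HOL.sym])
    have xz: "\<pi> p x = z p" if "p \<in> ?I" for p
    proof -
      have "z p = (\<lambda>p\<in>?I. \<pi> p x) p" by (simp only: x(1))
      then show ?thesis by (simp only: restrict_apply that if_True)
    qed
    have "\<pi> ?o x = y0" by (simp only: xz[OF one_I] z1)
    moreover have "\<pi> (?W H) x = y H" if "H \<in> \<A>" for H by (simp only: xz[OF W_I[OF that]] zW[OF that])
    ultimately show ?case using x(2) by blast
  next
    case (14 n x x')
    have "\<pi> p x = \<pi> p x'" if "p \<in> ?I" for p
      using that 14 by (auto simp: subgroup_poset_def)
    then have "(\<lambda>p\<in>?I. \<pi> p x) = (\<lambda>p\<in>?I. \<pi> p x')" by (auto simp: restrict_def)
    then show ?case using lim[of n] 14(1,2) unfolding bij_betw_def inj_on_def by blast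
  qed
  let ?T = "RS \<epsilon> UNIV ?Q"
  have T: "cdga ?T" by (rule cdga_RS[OF \<epsilon> subalgebra_quasi_invariants])
  interpret T: cdg ?T by (rule cdgI[OF T])
  have R0: "hpart ?R n = {\<zero>\<^bsub>?R\<^esub>}" if "n \<noteq> 0" for n using that by (simp add: RS_simps)
  obtain f where f: "f \<in> dg_hom (obj L ()) ?R"
    "\<And>x y. x \<in> carrier (obj L ()) \<Longrightarrow> y \<in> hpart ?R 0 \<Longrightarrow>
       f x = y \<longleftrightarrow> \<pi> ?o (st.L.comp 0 x) \<ominus>\<^bsub>obj D' ?o\<^esub> t ?o y \<in> boundaries (obj D' ?o) 0"
    using degree_0_map[OF L D'_cdga[OF one_I] R \<pi>[OF one_I] t1 R0] by blast
  have f0: "f x \<in> hpart ?R 0" if "x \<in> carrier (obj L ())" for x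
    using dg_homD(1)[OF f(1) that] by (simp add: RS_simps)
  \<comment> \<open>The requirement \<open>p \<in> polynomials scale\<close> stands separately so
    that the equivalence also covers an empty set of hyperplanes.\<close>
  have mem_Q: "p \<in> ?Q \<longleftrightarrow> p \<in> polynomials scale \<and> (\<forall>H\<in>\<A>. \<epsilon> p \<in> QH H)" for p
  proof -
    have "\<epsilon> p \<in> QH H \<longleftrightarrow> p \<in> polynomials scale \<and>
        (\<exists>q\<in>polynomials scale. \<forall>v. p (\<rho> (refl H) v) - p v = \<alpha> H v ^ (2 * k H) * q v)"
          if H: "H \<in> \<A>" for H
    proof -
      obtain u where "reflection_form scale (\<rho> (refl H)) (\<alpha> H) u" using refl_form[OF H] .
      then interpret r: reflection_form scale "\<rho> (refl H)" "\<alpha> H" u .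
      show ?thesis using inj_image_mem_iff[OF \<epsilon>] by (simp add: QH_def r.qi_polys_def)
    qed
    then show ?thesis unfolding quasi_invariants_eq by blast
  qed
  have fQ: "f x \<in> \<epsilon> ` ?Q" if x: "x \<in> carrier (obj L ())" for x
  proof -
    obtain p where p: "p \<in> polynomials scale" "f x = \<epsilon> p" using f0[OF x] by (auto simp: RS_simps)
    have "f x \<in> QH H" if "H \<in> \<A>" for H
      using st.limit_image[OF that st.L.comp_props(1)[OF x] f0[OF x]] f(2)[OF x f0[OF x]] by blast
    then have "p \<in> ?Q" using p mem_Q by simp
    then show ?thesis using p(2) by blast
  qed
  have f_hom: "f \<in> dg_hom (obj L ()) ?T"
  proof (rule dg_homI)
    fix n x assume x: "x \<in> hpart (obj L ()) n"
    show "f x \<in> hpart ?T n"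
      using dg_homD(6)[OF f(1) x] fQ[OF st.L.hpart_carrier[OF x]]
        by (simp add: RS_simps split: if_splits)
  qed (use dg_homD[OF f(1)] fQ in \<open>auto simp: RSpec_def function_algebra_def\<close>)
  have zeroT: "\<zero>\<^bsub>?T\<^esub> = \<zero>\<^bsub>?R\<^esub>" by (simp add: RS_simps)
  have T_boundaries: "y = \<zero>\<^bsub>?R\<^esub>" if "y \<in> boundaries ?T n" for y n
    using that by (auto simp: boundaries_def RS_simps)
  have "quasi_iso (obj L ()) ?T f"
  proof (subst quasi_iso_iff[OF L T f_hom], intro conjI allI ballI impI)
    fix n x assume x: "x \<in> cocycles (obj L ()) n" "f x \<in> boundaries ?T n"
    have xn: "x \<in> hpart (obj L ()) n" and xc: "x \<in> carrier (obj L ())"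
      using x(1) st.L.cocycles_carrier by (auto simp: cocycles_def)
    consider "n < 0" | "n = 0" | "n > 0" by linarith
    then show "x \<in> boundaries (obj L ()) n"
    proof cases
      case 1
      then show ?thesis using st.limit_acyclic x(1) by blast
    next
      case 2
      have "f x = \<zero>\<^bsub>?R\<^esub>" by (rule T_boundaries[OF x(2)])
      then have "\<pi> ?o x \<ominus>\<^bsub>obj D' ?o\<^esub> t ?o \<zero>\<^bsub>?R\<^esub> \<in> boundaries (obj D' ?o) 0"
        using f(2)[OF xc st.R.hpart_zero] st.L.comp_hpart[OF xn, of 0] 2 by simp
      then have "\<pi> ?o x \<in> boundaries (obj D' ?o) 0"
        using dg_hom_zero[OF R D'_cdga[OF one_I] st.t0_hom] dg_homD(1)[OF st.\<pi>0 xc]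
          by (simp add: a_minus_def)
      then show ?thesis using st.limit_inj xn 2 by simp
    next
      case 3
      then show ?thesis using st.L.hpart_pos[OF xn] st.L.zero_boundaries by simp
    qed
  next
    fix n y assume y: "y \<in> cocycles ?T n"
    show "\<exists>x\<in>cocycles (obj L ()) n. y \<ominus>\<^bsub>?T\<^esub> f x \<in> boundaries ?T n"
    proof (cases "n = 0")
      case True
      then obtain p where p: "p \<in> ?Q" "y = \<epsilon> p" using y by (auto simp: cocycles_def RS_simps)
      then have yR: "y \<in> hpart ?R 0" "\<And>H. H \<in> \<A> \<Longrightarrow> y \<in> QH H" using mem_Q by (auto simp: RS_simps)
      obtain x where x: "x \<in> hpart (obj L ()) 0" "\<pi> ?o x = t ?o y" using st.limit_surj[OF yR] by blast
      have "t ?o y \<in> carrier (obj D' ?o)" using dg_homD(1)[OF st.t0_hom st.R.hpart_carrier[OF yR(1)]] .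
      then have "f x = y"
        using f(2)[OF st.L.hpart_carrier[OF x(1)] yR(1)] st.L.comp_hpart[OF x(1), of 0] x(2)
          st.D0.zero_boundaries by (simp add: a_minus_def st.D0.r_neg)
      then show ?thesis
        using True st.L.hpart_0_cocycles[OF x(1)] T.zero_boundaries T.cocycles_carrier[OF y]
        by (intro bexI[of _ x]) (simp_all add: a_minus_def T.r_neg)
    next
      case False
      then have "y = \<zero>\<^bsub>?T\<^esub>" using y by (simp add: cocycles_def RS_simps)
      moreover have "f \<zero>\<^bsub>obj L ()\<^esub> = \<zero>\<^bsub>?T\<^esub>" by (rule dg_hom_zero[OF L T f_hom])
      moreover have "\<zero>\<^bsub>obj L ()\<^esub> \<in> cocycles (obj L ()) n" by (simp add: cocycles_def)
      ultimately show ?thesis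
        using T.zero_boundaries by (intro bexI[of _ "\<zero>\<^bsub>obj L ()\<^esub>"]) (simp_all add: a_minus_def)
    qed
  qed
  moreover have "f (act L g () x) = act (RSpec_qi scale G \<rho> \<epsilon> \<alpha> k) g () (f x)"
    if g: "g \<in> carrier G" and x: "x \<in> carrier (obj L ())" for g x
  proof -
    have aL: "act L g () \<in> dg_hom (obj L ()) (obj L ())"
      using Lfam g unfolding equiv_family_def by blast
    \<comment> \<open>Conjugation fixes the trivial subgroup, so \<open>g\<close> acts on the
      algebra in which \<open>f\<close> is characterised. There the translate of \<open>f x\<close>
      satisfies the condition that defines \<open>f\<close> at the image of \<open>x\<close> under
      \<open>g\<close>, and uniqueness concludes.\<close>
    have conj1: "conj_action G g ?o = ?o" using g by (simp add: conj_action_def)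
    have aD': "act D' g ?o \<in> dg_hom (obj D' ?o) (obj D' ?o)"
      using bspec[OF bspec[OF D'_parts[THEN conjunct1, unfolded equiv_family_def, THEN conjunct2,
        THEN conjunct1] g] one_I]
      unfolding conj1 by blast
    have aD: "act D g ?o \<in> dg_hom ?R ?R"
      using bspec[OF bspec[OF Ddiag[unfolded equiv_diagram_def, THEN conjunct1, unfolded
        equiv_family_def,
        THEN conjunct2, THEN conjunct1] g] one_I]
      unfolding conj1 D1 by blast
    have act_eq: "act D g ?o y = act (RSpec_qi scale G \<rho> \<epsilon> \<alpha> k) g () y" for y
      by (simp add: D_def qi_diagram_def Let_def space_fam_def RSpec_qi_def function_fam_def)
    have fx: "f x \<in> carrier ?R" by (rule dg_homD(1)[OF f(1) x])
    let ?x0 = "st.L.comp 0 x"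
    have x0: "?x0 \<in> carrier (obj L ())" using x by simp
    have "st.L.comp 0 (act L g () x) = act L g () ?x0" by (rule dg_hom_comp[OF L L aL x])
    moreover have "\<pi> ?o (act L g () ?x0) = act D' g ?o (\<pi> ?o ?x0)"
      using \<pi>_eq[OF g one_I x0] conj1 by simp
    moreover have "t ?o (act D g ?o (f x)) = act D' g ?o (t ?o (f x))"
    proof -
      have "\<forall>x\<in>carrier (obj D ?o). t (conj_action G g ?o) (act D g ?o x) = act D' g ?o (t ?o x)"
        using t g one_I unfolding equiv_quasi_iso_def equiv_map_def by blast
      then show ?thesis using fx unfolding conj1 D1 by blast
    qed
    moreover have "act D' g ?o (\<pi> ?o ?x0 \<ominus>\<^bsub>obj D' ?o\<^esub> t ?o (f x)) \<in> boundaries (obj D' ?o) 0"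
      using dg_hom_boundaries[OF D'_cdga[OF one_I] aD'] f(2)[OF x f0[OF x]] by blast
    ultimately have "\<pi> ?o (st.L.comp 0 (act L g () x)) \<ominus>\<^bsub>obj D' ?o\<^esub> t ?o (act D g ?o (f x)) \<in>
      boundaries (obj D' ?o) 0"
      using dg_hom_minus[OF D'_cdga[OF one_I] D'_cdga[OF one_I] aD' dg_homD(1)[OF st.\<pi>0 x0]
        dg_homD(1)[OF st.t0_hom fx]] by simp
    then have "f (act L g () x) = act D g ?o (f x)"
      using f(2)[OF dg_homD(1)[OF aL x] dg_homD(6)[OF aD f0[OF x]]] by blast
    then show ?thesis by (simp add: act_eq)
  qed
  moreover have "obj (RSpec_qi scale G \<rho> \<epsilon> \<alpha> k) () = ?T" by (simp add: RSpec_qi_def function_fam_def)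
  ultimately show ?thesis
    using f_hom unfolding equiv_quasi_iso_def equiv_map_def by (intro exI[of _ "\<lambda>_. f"]) simp
qed

end

theorem theorem3p1:
  fixes scale :: "'k::field_char_0 \<Rightarrow> 'v::ab_group_add \<Rightarrow> 'v"
    and Basis :: "'v set"
    and G :: "'g monoid"
    and S :: "'g set"
    and \<rho> :: "'g \<Rightarrow> 'v \<Rightarrow> 'v"
    and \<alpha> :: "'v set \<Rightarrow> 'v \<Rightarrow> 'k"
    and k :: "'v set \<Rightarrow> nat"
    and \<epsilon> :: "('v \<Rightarrow> 'k) \<Rightarrow> 'u"
    and L :: "('g, unit, 'k, 'u) fam"
  assumes "coxeter_reflection_rep scale Basis G S \<rho>"
    and "hyperplane_forms scale (reflection_hyperplanes scale G \<rho>) \<alpha>"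
    and "k \<in> multiplicities G \<rho> (reflection_hyperplanes scale G \<rho>)"
    and "inj \<epsilon>"
    and "derived_qi_space scale G \<rho> \<epsilon> k L"
  shows "equivariantly_equivalent G L (RSpec_qi scale G \<rho> \<epsilon> \<alpha> k)
       \<and> equivariantly_equivalent G (RSpec_qi scale G \<rho> \<epsilon> \<alpha> k)
           (classical_in_dAff \<epsilon> (qi_variety scale G \<rho> \<alpha> k))"
proof
  interpret reflection_rep scale Basis G S \<rho> \<alpha>
    using assms(1,2) by unfold_locales
  have "equiv_family G (\<lambda>_ _. ()) UNIV L"
    using assms(5) unfolding derived_qi_space_def homotopy_colimit_def by blast
  then show "equivariantly_equivalent G L (RSpec_qi scale G \<rho> \<epsilon> \<alpha> k)"
    using equiv_family_RSpec_qi[OF assms(4,3)] derived_qi_space_quasi_iso[OF assms(4,3,5)]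
    unfolding equivariantly_equivalent_def by (intro r_into_equivclp) blast
  \<comment> \<open>Embedding the classical variety into dAff yields the same algebra with the same
    action by translation, so the second equivalence is reflexivity.\<close>
  have "RSpec_qi scale G \<rho> \<epsilon> \<alpha> k = classical_in_dAff \<epsilon> (qi_variety scale G \<rho> \<alpha> k)"
    by (simp add: RSpec_qi_def classical_in_dAff_def qi_variety_def function_fam_def)
  then show "equivariantly_equivalent G (RSpec_qi scale G \<rho> \<epsilon> \<alpha> k)
           (classical_in_dAff \<epsilon> (qi_variety scale G \<rho> \<alpha> k))"
    by (simp add: equivariantly_equivalent_def)
qed

end
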